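(* Let $d\ge 1$ and let $p:\mathbb{R}^d\to\mathbb{C}$ have the form $p(\xi)=p_0+\sum_{j=1}^h p_{m_j}(\xi)$, where $p_0\in\mathbb{C}$, $0<m_1<m_2<\dots<m_h=M$, and each $p_{m_j}$ is smooth in $\mathbb{R}^d\setminus\{0\}$ and positively homogeneous of degree $m_j$. Suppose that there is $C>0$ such that $|p(\xi)|\ge C\langle\xi\rangle^M$ for all $\xi\in\mathbb{R}^d$, and that at least one of the $p_{m_j}$ is not smooth (on $\mathbb{R}^d$). Let $F$ be a polynomial in $u,\overline{u}$ (with complex coefficients), with $F(0)=0$ and $F'(0)=0$. Let $u$ be a distribution solution of $p(D)u=F(u)$ in $\mathbb{R}^d$ satisfying $\langle x\rangle^{\epsilon_0}u\in L^\infty(\mathbb{R}^d)$ for some $\epsilon_0>0$. Then there exists $\epsilon>0$ such that $u$ extends to a bounded holomorphic function $u(x+iy)$ in the strip $\{z=x+iy\in\mathbb{C}^d:\ |y|<\epsilon\}$.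
   Context: Here $\langle x\rangle=(1+|x|^2)^{1/2}$, and $F'$ denotes the differential of $F$ regarded as a map on $\mathbb{C}\cong\mathbb{R}^2$ (so $F$ has no constant and no linear terms in $u,\overline u$). Positively homogeneous of degree $\mu>0$ means $f(t\xi)=t^{\mu}f(\xi)$ for $t>0$, $\xi\ne 0$, with $f(0)=0$; "not smooth" means not $C^\infty$ on all of $\mathbb{R}^d$. The Fourier transform is $\widehat{u}(\xi)=\int_{\mathbb{R}^d}e^{-ix\xi}u(x)\,dx$, and $p(D)$ is the Fourier multiplier with symbol $p$, i.e. $\widehat{p(D)\varphi}=p\,\widehat{\varphi}$ for Schwartz $\varphi$. For $u\in L^\infty(\mathbb{R}^d)$, $p(D)u$ is the tempered distribution defined by $\langle p(D)u,\varphi\rangle=\int_{\mathbb{R}^d}u\,(\check p(D)\varphi)\,dx$ for Schwartz $\varphi$, where $\check p(\xi)=p(-\xi)$ (the function $\check p(D)\varphi$ is integrable). $F(u)$ denotes $x\mapsto F(u(x))$, and a distribution solution is a $u$ for which $p(D)u=F(u)$ as tempered distributions. *)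

theory Defs
  imports "HOL-Analysis.Analysis"
begin

definition partial_deriv :: "'d::finite \<Rightarrow> (real^'d \<Rightarrow> complex) \<Rightarrow> real^'d \<Rightarrow> complex" where
  "partial_deriv i f x = frechet_derivative f (at x) (axis i 1)"

definition iterated_partial :: "'d::finite list \<Rightarrow> (real^'d \<Rightarrow> complex) \<Rightarrow> real^'d \<Rightarrow> complex" where
  "iterated_partial is f = foldr partial_deriv is f"

text \<open>
  The class \<open>C\<^sup>\<infinity>\<close> on an \<^emph>\<open>open\<close> set \<open>S\<close>: iterated partial derivatives of all orders
  exist, and each of them is (Frechet) differentiable, hence continuous, on \<open>S\<close>.
  Asking \<^const>\<open>iterated_partial\<close> of the shorter lists to be differentiable guarantees that
  the values of \<^const>\<open>frechet_derivative\<close> entering the longer ones are genuine derivatives.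
\<close>
definition smooth_on :: "(real^'d::finite) set \<Rightarrow> (real^'d \<Rightarrow> complex) \<Rightarrow> bool" where
  "smooth_on S f \<longleftrightarrow> (\<forall>is. \<forall>x\<in>S. iterated_partial is f differentiable (at x))"

definition pos_homogeneous :: "real \<Rightarrow> (real^'d::finite \<Rightarrow> complex) \<Rightarrow> bool" where
  "pos_homogeneous \<mu> f \<longleftrightarrow>
     (\<forall>t>0. \<forall>\<xi>. \<xi> \<noteq> 0 \<longrightarrow> f (t *\<^sub>R \<xi>) = of_real (t powr \<mu>) * f \<xi>) \<and> f 0 = 0"

definition japanese_bracket :: "real^'d::finite \<Rightarrow> real" where
  "japanese_bracket x = sqrt (1 + (norm x)\<^sup>2)"

definition schwartz :: "(real^'d::finite \<Rightarrow> complex) \<Rightarrow> bool" where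
  "schwartz \<phi> \<longleftrightarrow> smooth_on UNIV \<phi> \<and>
     (\<forall>k is. \<exists>K. \<forall>x. japanese_bracket x ^ k * norm (iterated_partial is \<phi> x) \<le> K)"

definition fourier :: "(real^'d::finite \<Rightarrow> complex) \<Rightarrow> real^'d \<Rightarrow> complex" where
  "fourier f \<xi> = (LINT x|lebesgue. exp (- \<i> * of_real (x \<bullet> \<xi>)) * f x)"

definition inverse_fourier :: "(real^'d::finite \<Rightarrow> complex) \<Rightarrow> real^'d \<Rightarrow> complex" where
  "inverse_fourier g x =
     of_real (1 / (2 * pi) ^ CARD('d)) * (LINT \<xi>|lebesgue. exp (\<i> * of_real (x \<bullet> \<xi>)) * g \<xi>)"

text \<open>
  \<open>p(D)\<phi>\<close> for Schwartz \<open>\<phi>\<close>. For a continuous symbol of polynomial growth the function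
  \<open>p(\<xi>) * fourier \<phi> \<xi>\<close> is integrable, so the inverse transform is an honest integral.
\<close>
definition fourier_multiplier ::
    "(real^'d::finite \<Rightarrow> complex) \<Rightarrow> (real^'d \<Rightarrow> complex) \<Rightarrow> real^'d \<Rightarrow> complex" where
  "fourier_multiplier p \<phi> = inverse_fourier (\<lambda>\<xi>. p \<xi> * fourier \<phi> \<xi>)"

definition in_Linfty :: "(real^'d::finite \<Rightarrow> complex) \<Rightarrow> bool" where
  "in_Linfty u \<longleftrightarrow> u \<in> borel_measurable lebesgue \<and> (\<exists>K. AE x in lebesgue. norm (u x) \<le> K)"

text \<open>
  The action on test functions of the tempered distribution \<open>p(D)u\<close>, for \<open>u \<in> L\<^sup>\<infinity>\<close>,
  where \<open>p\<close> is a symbol for which \<open>p(-D)\<phi>\<close> is integrable for all Schwartz \<open>\<phi>\<close>.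
\<close>
definition multiplier_distribution ::
    "(real^'d::finite \<Rightarrow> complex) \<Rightarrow> (real^'d \<Rightarrow> complex) \<Rightarrow> (real^'d \<Rightarrow> complex) \<Rightarrow> complex" where
  "multiplier_distribution p u \<phi> =
     (LINT x|lebesgue. u x * fourier_multiplier (\<lambda>\<xi>. p (- \<xi>)) \<phi> x)"

definition distribution_solution ::
    "(real^'d::finite \<Rightarrow> complex) \<Rightarrow> (complex \<Rightarrow> complex) \<Rightarrow> (real^'d \<Rightarrow> complex) \<Rightarrow> bool" where
  "distribution_solution p F u \<longleftrightarrow>
     (\<forall>\<phi>. schwartz \<phi> \<longrightarrow> multiplier_distribution p u \<phi> = (LINT x|lebesgue. F (u x) * \<phi> x))"

definition polynomial_in_conjugates :: "(complex \<Rightarrow> complex) \<Rightarrow> bool" where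
  "polynomial_in_conjugates F \<longleftrightarrow>
     (\<exists>N (c :: nat \<Rightarrow> nat \<Rightarrow> complex). \<forall>z. F z = (\<Sum>j\<le>N. \<Sum>k\<le>N. c j k * z ^ j * cnj z ^ k))"

definition complex_strip :: "real \<Rightarrow> (complex^'d::finite) set" where
  "complex_strip \<epsilon> = {z. norm (\<chi> j. Im (z $ j)) < \<epsilon>}"

definition embed_complex :: "real^'d::finite \<Rightarrow> complex^'d" where
  "embed_complex x = (\<chi> j. of_real (x $ j))"

text \<open>Holomorphy in several variables on an \<^emph>\<open>open\<close> set: the Frechet derivative exists and is
  complex linear.\<close>
definition holomorphic_on_vec :: "(complex^'d::finite \<Rightarrow> complex) \<Rightarrow> (complex^'d) set \<Rightarrow> bool" where
  "holomorphic_on_vec f \<Omega> \<longleftrightarrow>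
     (\<forall>z\<in>\<Omega>. \<exists>L. (f has_derivative L) (at z) \<and> Vector_Spaces.linear (*s) (*) L)"

end

(* The linear part is inverted with an absolutely integrable kernel: the symbol 1/p is decomposed by
   dyadic rescalings of a difference psi of two low-pass symbols, and the pieces psi(r xi)/p(xi) have
   kernels of L^1 norm O(r^min(M,1)), since integration by parts only needs finitely many
   derivatives and psi vanishes at the origin to an order that compensates the singularities of p
   there.  Hence u = Phi_r * u + k_r * F(u) with ||k_r||_1 as small as we please as r tends to 0,
   where Phi_r is a finite sum of Gaussians, so that Phi_r * u is entire and bounded on the strip
   |Im z| < r by a constant that does not depend on r.  For small ||k_r||_1 the map
   v |-> Phi_r * u + k_r * F(v) is a contraction, both on bounded functions on R^d and on bounded
   holomorphic functions on the strip; the fixed point on the strip therefore extends u.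
   Since the equation may only be tested against Schwartz functions and 1/p is singular at the
   origin, psi(r xi)/p(xi) is first multiplied by exp(-eps/|xi|^2), and then eps tends to 0. *)

theory Submission
  imports Defs "HOL-Probability.Distributions" "HOL-Complex_Analysis.Cauchy_Integral_Formula"
begin

section \<open>Lebesgue integrals over Euclidean space\<close>

text \<open>The multiplier 1/p helps at neither end: at infinity it decays only like a power, so its
  kernel is not regular, and at the origin it may fail to be smooth, so its kernel decays slowly.
  Hence only integrability is asked of k_r. Convolution with it translates in real directions, which
  map the strip to itself, and therefore preserves bounded holomorphic functions; all analyticity
  enters through Phi_r. The width of the strip is tied to the scale r because a heat kernel of time
  j r^2 grows on |Im z| < r by a factor of at most exp(1/(4 j)). This removes a circularity: the sup
  bound of u fixes a radius R, R fixes the Lipschitz constant of the nonlinearity, this fixes the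
  required L^1 norm of k_r, and only then is r chosen. The low-pass symbol 1 - (1 -
  exp(-|\<xi>|^2))^L meets two opposing demands: it is a sum of Gaussians, and the difference of two
  of its dilates vanishes to order 2 L at 0. Of these orders, 2 d + 2 are spent on integration by
  parts, two on removing the cutoff exp(-eps/|\<xi>|^2), and one on the singularity of the rescaled
  1/p; L = d + 3 covers them.\<close>

lemma lborel_integrable_affine:
  fixes f :: "'a::euclidean_space \<Rightarrow> 'b::{banach, second_countable_topology}"
  assumes "c \<noteq> 0" and f: "integrable lborel f"
  shows "integrable lborel (\<lambda>x. f (t + c *\<^sub>R x))"
proof -
  have "integrable (density (distr lborel borel (\<lambda>x. t + c *\<^sub>R x)) (\<lambda>_. ennreal (\<bar>c\<bar> ^ DIM('a)))) f"
    using f lborel_affine[OF \<open>c \<noteq> 0\<close>, of t] by (simp add: ennreal_power)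
  then have "integrable (distr lborel borel (\<lambda>x. t + c *\<^sub>R x)) (\<lambda>x. (\<bar>c\<bar> ^ DIM('a)) *\<^sub>R f x)"
    using f by (subst (asm) integrable_density) (auto dest: borel_measurable_integrable)
  then have "integrable (distr lborel borel (\<lambda>x. t + c *\<^sub>R x)) (\<lambda>x. (1 / \<bar>c\<bar> ^ DIM('a)) *\<^sub>R ((\<bar>c\<bar> ^ DIM('a)) *\<^sub>R f x))"
    by (rule integrable_scaleR_right)
  then have "integrable (distr lborel borel (\<lambda>x. t + c *\<^sub>R x)) f"
    using \<open>c \<noteq> 0\<close> by simp
  then show ?thesis
    by (subst (asm) integrable_distr_eq) (use f in \<open>auto dest: borel_measurable_integrable\<close>)
qed

lemma lborel_integral_affine:
  fixes f :: "'a::euclidean_space \<Rightarrow> 'b::{banach, second_countable_topology}"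
  assumes c: "c \<noteq> 0"
  shows "(LINT x|lborel. f x) = \<bar>c\<bar> ^ DIM('a) *\<^sub>R (LINT x|lborel. f (t + c *\<^sub>R x))"
proof (cases "integrable lborel f")
  case True
  note f = borel_measurable_integrable[OF True]
  have "(LINT x|lborel. f x) =
      integral\<^sup>L (density (distr lborel borel (\<lambda>x. t + c *\<^sub>R x)) (\<lambda>_. ennreal (\<bar>c\<bar> ^ DIM('a)))) f"
    using lborel_affine[OF c, of t] by (simp add: ennreal_power)
  also have "\<dots> = (LINT x|distr lborel borel (\<lambda>x. t + c *\<^sub>R x). (\<bar>c\<bar> ^ DIM('a)) *\<^sub>R f x)"
    using f by (subst integral_density) auto
  also have "\<dots> = (LINT x|lborel. (\<bar>c\<bar> ^ DIM('a)) *\<^sub>R f (t + c *\<^sub>R x))"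
    using f by (subst integral_distr) auto
  finally show ?thesis by simp
next
  case False
  \<comment> \<open>Both integrals are 0 by convention once neither function is integrable;
    integrability is carried back by the inverse affine map.\<close>
  have "\<not> integrable lborel (\<lambda>x. f (t + c *\<^sub>R x))"
  proof
    assume "integrable lborel (\<lambda>x. f (t + c *\<^sub>R x))"
    then have "integrable lborel (\<lambda>x. f (t + c *\<^sub>R ((- (1 / c)) *\<^sub>R t + (1 / c) *\<^sub>R x)))"
      by (rule lborel_integrable_affine[rotated]) (use c in simp)
    moreover have "(\<lambda>x. f (t + c *\<^sub>R ((- (1 / c)) *\<^sub>R t + (1 / c) *\<^sub>R x))) = f"
      using c by (auto simp: algebra_simps)
    ultimately show False using False by metis
  qed
  with False show ?thesis by (simp add: not_integrable_integral_eq)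
qed

text \<open>Affine bijections preserve null sets. This is needed with \<open>c = -1\<close>: the
  integral equation evaluates at \<open>x - s\<close> a function that is controlled only almost
  everywhere.\<close>

lemma AE_lborel_affine:
  fixes t :: "'a::euclidean_space"
  assumes "AE x in lborel. P x" and "c \<noteq> 0"
  shows "AE x in lborel. P (t + c *\<^sub>R x)"
proof -
  obtain N where N: "N \<in> null_sets lborel" "{x. \<not> P x} \<subseteq> N"
    using AE_E2[OF assms(1)] assms(1) by (auto simp: eventually_ae_filter)
  have eq: "density (distr lborel borel (\<lambda>x. t + c *\<^sub>R x)) (\<lambda>_. ennreal (\<bar>c\<bar> ^ DIM('a))) = lborel"
    using lborel_affine[OF \<open>c \<noteq> 0\<close>, of t] by (simp add: ennreal_power)
  have "AE x in density (distr lborel borel (\<lambda>x. t + c *\<^sub>R x)) (\<lambda>_. ennreal (\<bar>c\<bar> ^ DIM('a))). x \<notin> N"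
    unfolding eq by (rule AE_not_in[OF N(1)])
  then have "AE x in distr lborel borel (\<lambda>x. t + c *\<^sub>R x). x \<notin> N"
    using \<open>c \<noteq> 0\<close> by (subst (asm) AE_density) auto
  then have "AE x in lborel. t + c *\<^sub>R x \<notin> N"
    using N by (subst (asm) AE_distr_iff) auto
  then show ?thesis by eventually_elim (use N in auto)
qed

text \<open>Tonelli for products of one-variable functions. Nonnegativity allows the value to be
  computed as a \<open>nn_integral\<close>, and its finiteness yields integrability.\<close>

lemma integrable_lborel_prod:
  fixes f :: "real \<Rightarrow> real"
  assumes f: "integrable lborel f" and nonneg: "\<And>x. 0 \<le> f x"
  shows "integrable lborel (\<lambda>x::real^'d::finite. \<Prod>i\<in>UNIV. f (x $ i))"
    and "(LINT x|lborel. (\<Prod>i\<in>UNIV. f ((x::real^'d) $ i))) = (LINT x|lborel. f x) ^ CARD('d)"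
proof -
  have fm[measurable]: "f \<in> borel_measurable borel"
    using borel_measurable_integrable[OF f] by simp
  have eq: "(\<Prod>i\<in>UNIV. f (x $ i)) = (\<Prod>b\<in>Basis. f (x \<bullet> b))" for x :: "real^'d"
  proof -
    have "(\<Prod>b\<in>Basis. f (x \<bullet> b)) = (\<Prod>b\<in>(\<lambda>i. axis i 1) ` UNIV. f (x \<bullet> b))"
      by (rule prod.cong) (auto simp: Basis_vec_def)
    also have "\<dots> = (\<Prod>i\<in>UNIV. f (x \<bullet> axis i 1))"
      by (subst prod.reindex) (auto simp: inj_on_def axis_eq_axis)
    finally show ?thesis by (simp add: inner_axis)
  qed
  have nn: "(\<integral>\<^sup>+x. ennreal (\<Prod>i\<in>UNIV. f ((x::real^'d) $ i)) \<partial>lborel) = ennreal ((LINT x|lborel. f x) ^ CARD('d))"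
  proof -
    have "(\<integral>\<^sup>+x. ennreal (\<Prod>i\<in>UNIV. f ((x::real^'d) $ i)) \<partial>lborel)
        = (\<integral>\<^sup>+x. (\<Prod>b\<in>Basis. ennreal (f ((x::real^'d) \<bullet> b))) \<partial>lborel)"
      by (simp add: eq prod_ennreal nonneg)
    also have "\<dots> = (\<Prod>b\<in>(Basis::(real^'d) set). (\<integral>\<^sup>+x. ennreal (f x) \<partial>lborel))"
      by (rule nn_integral_lborel_prod) auto
    also have "(\<integral>\<^sup>+x. ennreal (f x) \<partial>lborel) = ennreal (LINT x|lborel. f x)"
      by (rule nn_integral_eq_integral[OF f]) (simp add: nonneg)
    finally show ?thesis
      by (simp add: ennreal_power nonneg)
  qed
  show int: "integrable lborel (\<lambda>x::real^'d. \<Prod>i\<in>UNIV. f (x $ i))"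
    by (rule integrableI_nonneg) (auto simp: nn prod_nonneg nonneg)
  have "ennreal (LINT x|lborel. (\<Prod>i\<in>UNIV. f ((x::real^'d) $ i))) = ennreal ((LINT x|lborel. f x) ^ CARD('d))"
    by (subst nn_integral_eq_integral[OF int, symmetric]) (auto simp: nn prod_nonneg nonneg)
  then show "(LINT x|lborel. (\<Prod>i\<in>UNIV. f ((x::real^'d) $ i))) = (LINT x|lborel. f x) ^ CARD('d)"
    by (subst (asm) ennreal_inj) (auto intro!: Bochner_Integration.integral_nonneg prod_nonneg simp: nonneg)
qed

section \<open>An integrable majorant on Euclidean space\<close>

lemma norm_vec_squared: "(norm (x::real^'d::finite))\<^sup>2 = (\<Sum>i\<in>UNIV. (x $ i)\<^sup>2)"
  by (simp add: norm_vec_def L2_set_def sum_nonneg)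

text \<open>The common majorant for symbols and kernels. The exponent \<open>CARD('d)\<close> gives
  decay of order 2 d, which is integrable in dimension d, and it makes the function smaller than the
  product of the one-dimensional functions 1 / (1 + x_i^2).\<close>

definition envelope :: "real^'d::finite \<Rightarrow> real" where
  "envelope x = 1 / (1 + (norm x)\<^sup>2) ^ CARD('d)"

lemma envelope_pos: "0 < envelope x"
  by (simp add: envelope_def add_pos_nonneg)

lemma envelope_measurable [measurable]: "envelope \<in> borel_measurable borel"
  unfolding envelope_def[abs_def] by measurable

text \<open>The primitive is \<open>arctan\<close>; the half-line is treated first and then
  reflected.\<close>

lemma integrable_inverse_one_plus_square: "integrable lborel (\<lambda>x::real. 1 / (1 + x\<^sup>2))"
proof -
  have "(\<integral>\<^sup>+x\<in>{0..}. ennreal (1 / (1 + x\<^sup>2)) \<partial>lborel) = ennreal (pi / 2 - arctan 0)"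
    by (rule nn_integral_FTC_atLeast[where F=arctan])
      (auto intro!: derivative_eq_intros tendsto_arctan_at_top simp: field_simps add_nonneg_eq_0_iff)
  then have "(\<integral>\<^sup>+x. ennreal (indicator {0..} x * (1 / (1 + x\<^sup>2))) \<partial>lborel) < \<infinity>"
    by (subst nn_integral_cong[where v="\<lambda>x. ennreal (1 / (1 + x\<^sup>2)) * indicator {0..} x"])
      (auto simp: indicator_def)
  then have A: "integrable lborel (\<lambda>x::real. indicator {0..} x * (1 / (1 + x\<^sup>2)))"
    by (intro integrableI_nonneg) (auto simp: indicator_def)
  have B: "integrable lborel (\<lambda>x::real. indicator {0..} (0 + (-1) * x) * (1 / (1 + (0 + (-1) * x)\<^sup>2)))"
    by (rule lborel_integrable_real_affine[OF A]) simp
  show ?thesis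
    by (rule Bochner_Integration.integrable_bound[OF Bochner_Integration.integrable_add[OF A B]])
      (auto simp: indicator_def)
qed

lemma envelope_integrable: "integrable lborel (envelope :: real^'d::finite \<Rightarrow> real)"
proof (rule Bochner_Integration.integrable_bound)
  show "integrable lborel (\<lambda>x::real^'d. \<Prod>i\<in>UNIV. 1 / (1 + (x $ i)\<^sup>2))"
    by (rule integrable_lborel_prod[OF integrable_inverse_one_plus_square]) simp
  have "norm (envelope x) \<le> norm (\<Prod>i\<in>UNIV. 1 / (1 + (x $ i)\<^sup>2))" for x :: "real^'d"
  proof -
    have le: "(x $ i)\<^sup>2 \<le> (norm x)\<^sup>2" for i
      using component_le_norm_cart[of x i] by (simp add: abs_le_square_iff[symmetric])
    have "(\<Prod>i\<in>(UNIV::'d set). 1 + (x $ i)\<^sup>2) \<le> (\<Prod>i\<in>(UNIV::'d set). 1 + (norm x)\<^sup>2)"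
      by (rule prod_mono) (auto simp: le)
    moreover have "0 < (\<Prod>i\<in>(UNIV::'d set). 1 + (x $ i)\<^sup>2)"
      by (rule prod_pos) (simp add: add_pos_nonneg)
    ultimately show ?thesis
      by (simp add: envelope_def prod_dividef abs_prod[symmetric] frac_le)
  qed
  then show "AE x in lborel. norm (envelope x) \<le> norm (\<Prod>i\<in>UNIV. 1 / (1 + ((x::real^'d) $ i)\<^sup>2))"
    by simp
qed simp

text \<open>A shift by at most 1 costs a constant factor, because 1 + |x|^2 is at most 3 + 2 |x +
  y|^2. This keeps difference quotients and small complex neighbourhoods under one integrable
  majorant.\<close>

lemma envelope_shift:
  fixes x y :: "real^'d::finite"
  assumes "norm y \<le> 1"
  shows "envelope (x + y) \<le> 4 ^ CARD('d) * envelope x"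
proof -
  have "(norm x)\<^sup>2 \<le> 2 * (norm (x + y))\<^sup>2 + 2 * (norm y)\<^sup>2"
  proof -
    have "norm x \<le> norm (x + y) + norm y"
      using norm_triangle_ineq4[of "x + y" y] by simp
    then have "(norm x)\<^sup>2 \<le> (norm (x + y) + norm y)\<^sup>2"
      by (rule power_mono) simp
    also have "\<dots> \<le> 2 * (norm (x + y))\<^sup>2 + 2 * (norm y)\<^sup>2"
      using sum_squares_bound[of "norm (x + y)" "norm y"] by (simp add: power2_sum)
    finally show ?thesis .
  qed
  moreover have "(norm y)\<^sup>2 \<le> 1"
    using assms by (simp add: power_le_one)
  ultimately have "1 + (norm x)\<^sup>2 \<le> 4 * (1 + (norm (x + y))\<^sup>2)"
    by (smt (verit) zero_le_power2)
  then have "(1 + (norm x)\<^sup>2) ^ CARD('d) \<le> 4 ^ CARD('d) * (1 + (norm (x + y))\<^sup>2) ^ CARD('d)"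
    unfolding power_mult_distrib[symmetric] by (rule power_mono) (simp add: add_nonneg_nonneg)
  then show ?thesis
    by (simp add: envelope_def divide_simps add_pos_nonneg mult.commute)
qed

section \<open>Gaussian integrals\<close>

lemma has_bochner_integral_exp_minus_square:
  "has_bochner_integral lborel (\<lambda>x::real. exp (- x\<^sup>2)) (sqrt pi)"
  using has_bochner_integral_even_function[OF gaussian_moment_0] by simp

lemma exp_minus_norm_square:
  "integrable lborel (\<lambda>x::real^'d::finite. exp (- (norm x)\<^sup>2))"
  "(LINT x::real^'d|lborel. exp (- (norm x)\<^sup>2)) = sqrt pi ^ CARD('d)"
proof -
  have eq: "exp (- (norm x)\<^sup>2) = (\<Prod>i\<in>UNIV. exp (- (x $ i)\<^sup>2))" for x :: "real^'d"
    by (simp add: norm_vec_squared exp_sum[symmetric] sum_negf)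
  have I: "integrable lborel (\<lambda>x::real. exp (- x\<^sup>2))" "(LINT x|lborel. exp (- (x::real)\<^sup>2)) = sqrt pi"
    using has_bochner_integral_exp_minus_square by (auto simp: has_bochner_integral_iff)
  show "integrable lborel (\<lambda>x::real^'d. exp (- (norm x)\<^sup>2))"
    unfolding eq by (rule integrable_lborel_prod(1)[OF I(1)]) simp
  show "(LINT x::real^'d|lborel. exp (- (norm x)\<^sup>2)) = sqrt pi ^ CARD('d)"
    unfolding eq by (subst integrable_lborel_prod(2)[OF I(1)]) (simp_all add: I(2))
qed

lemma gaussian_integral:
  assumes "0 < b"
  shows "integrable lborel (\<lambda>x::real^'d::finite. exp (- b * (norm x)\<^sup>2))"
    and "(LINT x::real^'d|lborel. exp (- b * (norm x)\<^sup>2)) = sqrt (pi / b) ^ CARD('d)"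
proof -
  have eq: "exp (- (norm (0 + sqrt b *\<^sub>R x))\<^sup>2) = exp (- b * (norm x)\<^sup>2)" for x :: "real^'d"
    using assms by (simp add: power_mult_distrib)
  have "sqrt b \<noteq> 0" using assms by simp
  from lborel_integrable_affine[OF this, of "\<lambda>x::real^'d. exp (- (norm x)\<^sup>2)" 0, OF exp_minus_norm_square(1)]
  show "integrable lborel (\<lambda>x::real^'d. exp (- b * (norm x)\<^sup>2))"
    unfolding eq .
  from lborel_integral_affine[OF \<open>sqrt b \<noteq> 0\<close>, of "\<lambda>x::real^'d. exp (- (norm x)\<^sup>2)" 0]
  have "sqrt pi ^ CARD('d) = sqrt b ^ CARD('d) * (LINT x::real^'d|lborel. exp (- b * (norm x)\<^sup>2))"
    unfolding eq exp_minus_norm_square(2) using assms by simp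
  then show "(LINT x::real^'d|lborel. exp (- b * (norm x)\<^sup>2)) = sqrt (pi / b) ^ CARD('d)"
    using assms by (simp add: real_sqrt_divide power_divide field_simps)
qed

section \<open>Symbols singular at the origin\<close>

lemma partial_deriv_eq: "(f has_derivative f') (at x) \<Longrightarrow> partial_deriv i f x = f' (axis i 1)"
  by (simp add: partial_deriv_def frechet_derivative_at[symmetric])

lemma partial_deriv_cong:
  assumes "open S" "x \<in> S" "\<And>y. y \<in> S \<Longrightarrow> f y = g y"
  shows "partial_deriv i f x = partial_deriv i g x"
proof -
  have "(f has_derivative D) (at x) \<longleftrightarrow> (g has_derivative D) (at x)" for D
    using assms has_derivative_transform_within_open[OF _ assms(1,2)] by metis
  then show ?thesis by (simp add: partial_deriv_def frechet_derivative_def)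
qed

lemma has_derivative_partial_deriv:
  "f differentiable (at x) \<Longrightarrow> (f has_derivative frechet_derivative f (at x)) (at x)"
  by (simp add: frechet_derivative_works)

text \<open>The weight absorbs all constants, so that a bound uniform in a parameter is a weight with
  a fixed factor. The value at the origin is irrelevant throughout.\<close>

primrec symbol_bound :: "nat \<Rightarrow> (real^'d::finite \<Rightarrow> real) \<Rightarrow> (real^'d \<Rightarrow> complex) \<Rightarrow> bool" where
  "symbol_bound 0 w f \<longleftrightarrow> (\<forall>\<xi>. \<xi> \<noteq> 0 \<longrightarrow> norm (f \<xi>) \<le> w \<xi>)"
| "symbol_bound (Suc n) w f \<longleftrightarrow> (\<forall>\<xi>. \<xi> \<noteq> 0 \<longrightarrow> norm (f \<xi>) \<le> w \<xi> \<and> f differentiable (at \<xi>)) \<and>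
     (\<forall>i. symbol_bound n (\<lambda>\<xi>. w \<xi> / norm \<xi>) (partial_deriv i f))"

lemma symbol_bound_norm: "symbol_bound n w f \<Longrightarrow> \<xi> \<noteq> 0 \<Longrightarrow> norm (f \<xi>) \<le> w \<xi>"
  by (cases n) auto

lemma symbol_bound_nonneg: "symbol_bound n w f \<Longrightarrow> \<xi> \<noteq> 0 \<Longrightarrow> 0 \<le> w \<xi>"
  using symbol_bound_norm norm_ge_zero order_trans by blast

lemma symbol_bound_mono:
  "symbol_bound n w f \<Longrightarrow> (\<And>\<xi>. \<xi> \<noteq> 0 \<Longrightarrow> w \<xi> \<le> v \<xi>) \<Longrightarrow> symbol_bound n v f"
proof (induction n arbitrary: w v f)
  case 0
  then show ?case by force
next
  case (Suc n)
  have "symbol_bound n (\<lambda>\<xi>. v \<xi> / norm \<xi>) (partial_deriv i f)" for i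
    by (rule Suc.IH[of "\<lambda>\<xi>. w \<xi> / norm \<xi>"]) (use Suc.prems in \<open>auto intro!: divide_right_mono\<close>)
  moreover have "norm (f \<xi>) \<le> v \<xi>" if "\<xi> \<noteq> 0" for \<xi>
    using Suc.prems(1) Suc.prems(2)[OF that] that by (auto intro: order_trans[of _ "w \<xi>"])
  ultimately show ?case using Suc.prems by auto
qed

text \<open>The complement of the origin is open, so agreement there passes to derivatives of every
  order.\<close>

lemma symbol_bound_cong:
  assumes "symbol_bound n w f" and "\<And>\<xi>. \<xi> \<noteq> 0 \<Longrightarrow> f \<xi> = g \<xi>"
  shows "symbol_bound n w g"
  using assms
proof (induction n arbitrary: w f g)
  case 0
  then show ?case by auto
next
  case (Suc n)
  have "g differentiable (at \<xi>)" if "\<xi> \<noteq> 0" for \<xi>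
  proof -
    have "(f has_derivative frechet_derivative f (at \<xi>)) (at \<xi>)"
      using Suc.prems that by (intro has_derivative_partial_deriv) auto
    then have "(g has_derivative frechet_derivative f (at \<xi>)) (at \<xi>)"
      by (rule has_derivative_transform_within_open[of _ _ _ _ "- {0}"]) (use Suc.prems that in auto)
    then show ?thesis by (auto simp: differentiable_def)
  qed
  moreover have "symbol_bound n (\<lambda>\<xi>. w \<xi> / norm \<xi>) (partial_deriv i g)" for i
  proof (rule Suc.IH)
    show "symbol_bound n (\<lambda>\<xi>. w \<xi> / norm \<xi>) (partial_deriv i f)"
      using Suc.prems by simp
    show "partial_deriv i f \<xi> = partial_deriv i g \<xi>" if "\<xi> \<noteq> 0" for \<xi>
      by (rule partial_deriv_cong[of "- {0}"]) (use Suc.prems that in auto)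
  qed
  ultimately show ?case using Suc.prems by auto
qed

lemma symbol_bound_le: "symbol_bound n w f \<Longrightarrow> k \<le> n \<Longrightarrow> symbol_bound k w f"
proof (induction k arbitrary: n w f)
  case 0
  then show ?case using symbol_bound_norm by auto
next
  case (Suc k)
  then obtain n' where n': "n = Suc n'" "k \<le> n'" by (cases n) auto
  have "symbol_bound k (\<lambda>\<xi>. w \<xi> / norm \<xi>) (partial_deriv i f)" for i
    using Suc.prems n' by (intro Suc.IH[of n']) auto
  then show ?case using Suc.prems n' by auto
qed

lemma symbol_bound_zero: "(\<And>\<xi>. \<xi> \<noteq> 0 \<Longrightarrow> 0 \<le> w \<xi>) \<Longrightarrow> symbol_bound n w (\<lambda>_. 0)"
proof (induction n arbitrary: w)
  case (Suc n)
  have "partial_deriv i (\<lambda>_. 0) = (\<lambda>_::real^'a. 0)" for i :: 'a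
    by (auto simp: partial_deriv_def)
  then show ?case using Suc by auto
qed auto

lemma symbol_bound_const: "norm c \<le> K \<Longrightarrow> symbol_bound n (\<lambda>_. K) (\<lambda>_::real^'d::finite. c)"
proof (cases n)
  case (Suc k)
  assume K: "norm c \<le> K"
  then have "0 \<le> K" using norm_ge_zero order_trans by blast
  have "partial_deriv i (\<lambda>_. c) = (\<lambda>_::real^'d. 0)" for i :: 'd
    by (auto simp: partial_deriv_def)
  then show ?thesis using Suc K \<open>0 \<le> K\<close> by (auto intro!: symbol_bound_zero)
qed auto

lemma symbol_bound_add:
  "symbol_bound n w f \<Longrightarrow> symbol_bound n v g \<Longrightarrow> symbol_bound n (\<lambda>\<xi>. w \<xi> + v \<xi>) (\<lambda>\<xi>. f \<xi> + g \<xi>)"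
proof (induction n arbitrary: w v f g)
  case 0
  then show ?case by (auto intro: norm_triangle_mono)
next
  case (Suc n)
  have "symbol_bound n (\<lambda>\<xi>. (w \<xi> + v \<xi>) / norm \<xi>) (partial_deriv i (\<lambda>\<xi>. f \<xi> + g \<xi>))" for i
  proof -
    have "symbol_bound n (\<lambda>\<xi>. w \<xi> / norm \<xi> + v \<xi> / norm \<xi>) (\<lambda>\<xi>. partial_deriv i f \<xi> + partial_deriv i g \<xi>)"
      using Suc by auto
    moreover have "partial_deriv i f \<xi> + partial_deriv i g \<xi> = partial_deriv i (\<lambda>\<xi>. f \<xi> + g \<xi>) \<xi>" if "\<xi> \<noteq> 0" for \<xi>
      using Suc.prems that
      by (subst partial_deriv_eq[OF has_derivative_add[OF has_derivative_partial_deriv has_derivative_partial_deriv]])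
        (auto simp: partial_deriv_def)
    ultimately show ?thesis
      unfolding add_divide_distrib by (rule symbol_bound_cong)
  qed
  then show ?case using Suc.prems by (auto intro: norm_triangle_mono)
qed

lemma symbol_bound_cmult:
  "symbol_bound n w f \<Longrightarrow> symbol_bound n (\<lambda>\<xi>. norm c * w \<xi>) (\<lambda>\<xi>. c * f \<xi>)"
proof (induction n arbitrary: w f)
  case 0
  then show ?case by (auto simp: norm_mult mult_left_mono)
next
  case (Suc n)
  have "symbol_bound n (\<lambda>\<xi>. norm c * w \<xi> / norm \<xi>) (partial_deriv i (\<lambda>\<xi>. c * f \<xi>))" for i
  proof -
    have "symbol_bound n (\<lambda>\<xi>. norm c * (w \<xi> / norm \<xi>)) (\<lambda>\<xi>. c * partial_deriv i f \<xi>)"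
      using Suc.prems by (intro Suc.IH) auto
    moreover have "c * partial_deriv i f \<xi> = partial_deriv i (\<lambda>\<xi>. c * f \<xi>) \<xi>" if "\<xi> \<noteq> 0" for \<xi>
      using Suc.prems that
      by (subst partial_deriv_eq[OF has_derivative_mult_right[OF has_derivative_partial_deriv]])
        (auto simp: partial_deriv_def)
    ultimately show ?thesis
      by (auto intro: symbol_bound_cong)
  qed
  then show ?case using Suc.prems by (auto simp: norm_mult mult_left_mono)
qed

text \<open>By the Leibniz rule each derivative turns one product into two, hence the factor
  \<open>2 ^ n\<close>.\<close>

lemma symbol_bound_mult:
  "symbol_bound n w f \<Longrightarrow> symbol_bound n v g \<Longrightarrow> symbol_bound n (\<lambda>\<xi>. 2 ^ n * (w \<xi> * v \<xi>)) (\<lambda>\<xi>. f \<xi> * g \<xi>)"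
proof (induction n arbitrary: w v f g)
  case 0
  then show ?case by (auto simp: norm_mult mult_mono')
next
  case (Suc n)
  note le = symbol_bound_le[OF Suc.prems(1), of n] symbol_bound_le[OF Suc.prems(2), of n]
  have "symbol_bound n (\<lambda>\<xi>. 2 ^ Suc n * (w \<xi> * v \<xi>) / norm \<xi>) (partial_deriv i (\<lambda>\<xi>. f \<xi> * g \<xi>))" for i
  proof -
    have "symbol_bound n (\<lambda>\<xi>. 2 ^ n * (w \<xi> * (v \<xi> / norm \<xi>)) + 2 ^ n * (w \<xi> / norm \<xi> * v \<xi>))
        (\<lambda>\<xi>. f \<xi> * partial_deriv i g \<xi> + partial_deriv i f \<xi> * g \<xi>)"
      using Suc le by (intro symbol_bound_add Suc.IH) auto
    then have "symbol_bound n (\<lambda>\<xi>. 2 ^ Suc n * (w \<xi> * v \<xi>) / norm \<xi>)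
        (\<lambda>\<xi>. f \<xi> * partial_deriv i g \<xi> + partial_deriv i f \<xi> * g \<xi>)"
      by (rule symbol_bound_mono) (simp add: field_simps)
    moreover have "f \<xi> * partial_deriv i g \<xi> + partial_deriv i f \<xi> * g \<xi> = partial_deriv i (\<lambda>\<xi>. f \<xi> * g \<xi>) \<xi>" if "\<xi> \<noteq> 0" for \<xi>
      using Suc.prems that
      by (subst partial_deriv_eq[OF has_derivative_mult[OF has_derivative_partial_deriv has_derivative_partial_deriv]])
        (auto simp: partial_deriv_def)
    ultimately show ?thesis
      by (rule symbol_bound_cong)
  qed
  moreover have "norm (f \<xi> * g \<xi>) \<le> 2 ^ Suc n * (w \<xi> * v \<xi>)" if "\<xi> \<noteq> 0" for \<xi>
  proof -
    have "norm (f \<xi> * g \<xi>) \<le> 1 * (w \<xi> * v \<xi>)"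
      using Suc.prems that by (auto simp: norm_mult mult_mono')
    also have "\<dots> \<le> 2 ^ Suc n * (w \<xi> * v \<xi>)"
      using that Suc.prems[THEN symbol_bound_nonneg] by (intro mult_right_mono one_le_power) auto
    finally show ?thesis .
  qed
  ultimately show ?case using Suc.prems by auto
qed

lemma symbol_bound_coordinate:
  "symbol_bound n norm (\<lambda>\<xi>::real^'d::finite. of_real (\<xi> $ i))"
proof (cases n)
  case 0
  then show ?thesis by (auto simp: component_le_norm_cart)
next
  case (Suc k)
  have D: "((\<lambda>\<xi>::real^'d. complex_of_real (\<xi> $ i)) has_derivative (\<lambda>v. complex_of_real (v $ i))) (at \<xi>)" for \<xi>
    by (auto intro!: derivative_eq_intros bounded_linear.has_derivative[OF bounded_linear_vec_nth])
  have "symbol_bound k (\<lambda>\<xi>::real^'d. norm \<xi> / norm \<xi>) (partial_deriv j (\<lambda>\<xi>. of_real (\<xi> $ i)))" for j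
    by (rule symbol_bound_mono[of _ "\<lambda>_. 1"], rule symbol_bound_cong[of _ _ "\<lambda>_. of_real (axis j 1 $ i)"])
      (auto simp: partial_deriv_eq[OF D] axis_def intro: symbol_bound_const)
  then show ?thesis using Suc D by (auto simp: component_le_norm_cart differentiable_def)
qed

text \<open>Symbol estimates are invariant under dilation: the factor r of the chain rule is
  cancelled by the weight 1 / |r \<xi>| that comes with each derivative. No constant depends on
  r.\<close>

lemma symbol_bound_scale:
  assumes "r \<noteq> 0"
  shows "symbol_bound n w f \<Longrightarrow> symbol_bound n (\<lambda>\<xi>. w (r *\<^sub>R \<xi>)) (\<lambda>\<xi>. f (r *\<^sub>R \<xi>))"
proof (induction n arbitrary: w f)
  case 0
  then show ?case using assms by auto
next
  case (Suc n)
  have D: "((\<lambda>\<xi>. f (r *\<^sub>R \<xi>)) has_derivative (\<lambda>v. frechet_derivative f (at (r *\<^sub>R \<xi>)) (r *\<^sub>R v))) (at \<xi>)"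
    if "\<xi> \<noteq> 0" for \<xi>
  proof -
    have "((\<lambda>\<xi>. r *\<^sub>R \<xi>) has_derivative (\<lambda>v. r *\<^sub>R v)) (at \<xi>)"
      by (rule has_derivative_scaleR_right[OF has_derivative_ident])
    moreover have "(f has_derivative frechet_derivative f (at (r *\<^sub>R \<xi>))) (at (r *\<^sub>R \<xi>))"
      using Suc.prems that assms by (intro has_derivative_partial_deriv) simp
    ultimately show ?thesis
      by (rule has_derivative_compose)
  qed
  have "symbol_bound n (\<lambda>\<xi>. w (r *\<^sub>R \<xi>) / norm \<xi>) (partial_deriv i (\<lambda>\<xi>. f (r *\<^sub>R \<xi>)))" for i
  proof -
    have "symbol_bound n (\<lambda>\<xi>. norm (complex_of_real r) * (w (r *\<^sub>R \<xi>) / norm (r *\<^sub>R \<xi>)))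
       (\<lambda>\<xi>. of_real r * partial_deriv i f (r *\<^sub>R \<xi>))"
      using Suc by (intro symbol_bound_cmult Suc.IH) auto
    then have "symbol_bound n (\<lambda>\<xi>. w (r *\<^sub>R \<xi>) / norm \<xi>) (\<lambda>\<xi>. of_real r * partial_deriv i f (r *\<^sub>R \<xi>))"
      by (rule symbol_bound_mono) (use assms in simp)
    moreover have "of_real r * partial_deriv i f (r *\<^sub>R \<xi>) = partial_deriv i (\<lambda>\<xi>. f (r *\<^sub>R \<xi>)) \<xi>" if "\<xi> \<noteq> 0" for \<xi>
    proof -
      have "f differentiable (at (r *\<^sub>R \<xi>))" using Suc.prems that assms by auto
      then have "linear (frechet_derivative f (at (r *\<^sub>R \<xi>)))" by (rule linear_frechet_derivative)
      then show ?thesis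
        unfolding partial_deriv_eq[OF D[OF that]]
        unfolding partial_deriv_def
        by (simp only: linear_scale scaleR_conv_of_real[of r "_::complex"])
    qed
    ultimately show ?thesis
      by (rule symbol_bound_cong)
  qed
  then show ?case using Suc.prems assms D by (auto simp: differentiable_def)
qed

lemma symbol_bound_min:
  "symbol_bound n w f \<Longrightarrow> symbol_bound n v f \<Longrightarrow> symbol_bound n (\<lambda>\<xi>. min (w \<xi>) (v \<xi>)) f"
proof (induction n arbitrary: w v f)
  case 0
  then show ?case by auto
next
  case (Suc n)
  have "symbol_bound n (\<lambda>\<xi>. min (w \<xi>) (v \<xi>) / norm \<xi>) (partial_deriv i f)" for i
    by (rule symbol_bound_mono[of _ "\<lambda>\<xi>. min (w \<xi> / norm \<xi>) (v \<xi> / norm \<xi>)"])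
      (use Suc in \<open>auto simp: min_divide_distrib_right\<close>)
  then show ?case using Suc.prems by auto
qed

text \<open>The constant may depend on the number of derivatives but not on the parameter. This is
  what later makes the L^1 bounds uniform in the scale and in the cutoff. A single symbol is a
  family over \<open>{()}\<close>.\<close>

definition symbol_family ::
    "'a set \<Rightarrow> ('a \<Rightarrow> real^'d::finite \<Rightarrow> real) \<Rightarrow> ('a \<Rightarrow> real^'d \<Rightarrow> complex) \<Rightarrow> bool" where
  "symbol_family A w f \<longleftrightarrow> (\<forall>n. \<exists>C\<ge>0. \<forall>a\<in>A. symbol_bound n (\<lambda>\<xi>. C * w a \<xi>) (f a))"

lemma symbol_familyE:
  assumes "symbol_family A w f"
  obtains C where "0 \<le> C" "\<And>a. a \<in> A \<Longrightarrow> symbol_bound n (\<lambda>\<xi>. C * w a \<xi>) (f a)"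
  using assms unfolding symbol_family_def by metis

lemma symbol_familyI:
  "(\<And>n. \<exists>C\<ge>0. \<forall>a\<in>A. symbol_bound n (\<lambda>\<xi>. C * w a \<xi>) (f a)) \<Longrightarrow> symbol_family A w f"
  unfolding symbol_family_def by blast

lemma symbol_family_mono:
  assumes "symbol_family A w f" "0 \<le> K" "B \<subseteq> A"
    and "\<And>a \<xi>. a \<in> B \<Longrightarrow> \<xi> \<noteq> 0 \<Longrightarrow> w a \<xi> \<le> K * v a \<xi>"
  shows "symbol_family B v f"
proof (rule symbol_familyI)
  fix n
  obtain C where C: "0 \<le> C" "\<And>a. a \<in> A \<Longrightarrow> symbol_bound n (\<lambda>\<xi>. C * w a \<xi>) (f a)"
    using symbol_familyE[OF assms(1)] by blast
  have "symbol_bound n (\<lambda>\<xi>. (C * K) * v a \<xi>) (f a)" if "a \<in> B" for a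
    using assms that C by (intro symbol_bound_mono[OF C(2)]) (auto simp: mult.assoc mult_left_mono)
  then show "\<exists>C\<ge>0. \<forall>a\<in>B. symbol_bound n (\<lambda>\<xi>. C * v a \<xi>) (f a)"
    using C(1) assms(2) by (intro exI[of _ "C * K"]) auto
qed

lemma symbol_family_cong:
  assumes "symbol_family A w f" "\<And>a \<xi>. a \<in> A \<Longrightarrow> \<xi> \<noteq> 0 \<Longrightarrow> f a \<xi> = g a \<xi>"
  shows "symbol_family A w g"
proof (rule symbol_familyI)
  fix n
  obtain C where C: "0 \<le> C" "\<And>a. a \<in> A \<Longrightarrow> symbol_bound n (\<lambda>\<xi>. C * w a \<xi>) (f a)"
    using symbol_familyE[OF assms(1)] by blast
  have "symbol_bound n (\<lambda>\<xi>. C * w a \<xi>) (g a)" if "a \<in> A" for a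
    using C(2)[OF that] by (rule symbol_bound_cong) (rule assms(2)[OF that])
  with C(1) show "\<exists>C\<ge>0. \<forall>a\<in>A. symbol_bound n (\<lambda>\<xi>. C * w a \<xi>) (g a)" by blast
qed

lemma symbol_family_const:
  "norm c \<le> K \<Longrightarrow> symbol_family A (\<lambda>_ _. K) (\<lambda>_ _. c)"
  by (auto simp: symbol_family_def intro!: exI[of _ 1] symbol_bound_const)

lemma symbol_family_coordinate: "symbol_family A (\<lambda>_. norm) (\<lambda>_ \<xi>. of_real (\<xi> $ i))"
  by (auto simp: symbol_family_def intro!: exI[of _ 1] symbol_bound_coordinate)

lemma symbol_family_add:
  assumes "symbol_family A w f" "symbol_family A w g"
  shows "symbol_family A w (\<lambda>a \<xi>. f a \<xi> + g a \<xi>)"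
proof (rule symbol_familyI)
  fix n
  obtain C where C: "0 \<le> C" "\<And>a. a \<in> A \<Longrightarrow> symbol_bound n (\<lambda>\<xi>. C * w a \<xi>) (f a)"
    using symbol_familyE[OF assms(1)] by blast
  obtain D where D: "0 \<le> D" "\<And>a. a \<in> A \<Longrightarrow> symbol_bound n (\<lambda>\<xi>. D * w a \<xi>) (g a)"
    using symbol_familyE[OF assms(2)] by blast
  have "symbol_bound n (\<lambda>\<xi>. (C + D) * w a \<xi>) (\<lambda>\<xi>. f a \<xi> + g a \<xi>)" if "a \<in> A" for a
    using symbol_bound_add[OF C(2)[OF that] D(2)[OF that]] by (simp add: distrib_right)
  then show "\<exists>C\<ge>0. \<forall>a\<in>A. symbol_bound n (\<lambda>\<xi>. C * w a \<xi>) (\<lambda>\<xi>. f a \<xi> + g a \<xi>)"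
    using C(1) D(1) by (intro exI[of _ "C + D"]) auto
qed

lemma symbol_family_mult:
  assumes "symbol_family A w f" "symbol_family A v g"
  shows "symbol_family A (\<lambda>a \<xi>. w a \<xi> * v a \<xi>) (\<lambda>a \<xi>. f a \<xi> * g a \<xi>)"
proof (rule symbol_familyI)
  fix n
  obtain C where C: "0 \<le> C" "\<And>a. a \<in> A \<Longrightarrow> symbol_bound n (\<lambda>\<xi>. C * w a \<xi>) (f a)"
    using symbol_familyE[OF assms(1)] by blast
  obtain D where D: "0 \<le> D" "\<And>a. a \<in> A \<Longrightarrow> symbol_bound n (\<lambda>\<xi>. D * v a \<xi>) (g a)"
    using symbol_familyE[OF assms(2)] by blast
  have "symbol_bound n (\<lambda>\<xi>. (2 ^ n * C * D) * (w a \<xi> * v a \<xi>)) (\<lambda>\<xi>. f a \<xi> * g a \<xi>)" if "a \<in> A" for a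
    using symbol_bound_mult[OF C(2)[OF that] D(2)[OF that]] by (simp add: mult_ac)
  then show "\<exists>C\<ge>0. \<forall>a\<in>A. symbol_bound n (\<lambda>\<xi>. C * (w a \<xi> * v a \<xi>)) (\<lambda>\<xi>. f a \<xi> * g a \<xi>)"
    using C(1) D(1) by (intro exI[of _ "2 ^ n * C * D"]) auto
qed

lemma symbol_family_cmult:
  assumes "symbol_family A w f"
  shows "symbol_family A w (\<lambda>a \<xi>. c * f a \<xi>)"
proof -
  have "symbol_family A (\<lambda>a \<xi>. norm c * w a \<xi>) (\<lambda>a \<xi>. c * f a \<xi>)"
    by (rule symbol_family_mult[OF symbol_family_const[OF order_refl] assms])
  then show ?thesis by (rule symbol_family_mono[of _ _ _ "norm c"]) auto
qed

lemma symbol_family_diff: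
  assumes "symbol_family A w f" "symbol_family A w g"
  shows "symbol_family A w (\<lambda>a \<xi>. f a \<xi> - g a \<xi>)"
  using symbol_family_add[OF assms(1) symbol_family_cmult[OF assms(2), of "-1"]] by simp

lemma symbol_family_zero: "symbol_family A w (\<lambda>_ _. 0)"
  by (auto simp: symbol_family_def intro!: exI[of _ 0] symbol_bound_zero)

lemma symbol_family_sum:
  assumes "\<And>i. i \<in> I \<Longrightarrow> symbol_family A w (f i)"
  shows "symbol_family A w (\<lambda>a \<xi>. \<Sum>i\<in>I. f i a \<xi>)"
  using assms by (induction I rule: infinite_finite_induct)
    (auto intro!: symbol_family_zero symbol_family_add)

lemma symbol_family_power:
  assumes "symbol_family A w f"
  shows "symbol_family A (\<lambda>a \<xi>. w a \<xi> ^ k) (\<lambda>a \<xi>. f a \<xi> ^ k)"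
  by (induction k) (auto intro!: symbol_family_const symbol_family_mult assms)

text \<open>By dilation invariance one symbol yields a uniform family, namely all its dilates;
  negative factors are included, which covers reflection.\<close>

lemma symbol_family_scale:
  assumes "symbol_family {()} (\<lambda>_. w) (\<lambda>_. f)"
  shows "symbol_family (- {0}) (\<lambda>r \<xi>. w (r *\<^sub>R \<xi>)) (\<lambda>r \<xi>. f (r *\<^sub>R \<xi>))"
proof (rule symbol_familyI)
  fix n
  obtain C where C: "0 \<le> C" "\<And>a. a \<in> {()} \<Longrightarrow> symbol_bound n (\<lambda>\<xi>. C * w \<xi>) f"
    using symbol_familyE[OF assms, where n=n] by blast
  have "symbol_bound n (\<lambda>\<xi>. C * w (r *\<^sub>R \<xi>)) (\<lambda>\<xi>. f (r *\<^sub>R \<xi>))" if "r \<in> - {0}" for r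
    using symbol_bound_scale[OF _ C(2)] that by auto
  with C(1) show "\<exists>C\<ge>0. \<forall>r\<in>- {0}. symbol_bound n (\<lambda>\<xi>. C * w (r *\<^sub>R \<xi>)) (\<lambda>\<xi>. f (r *\<^sub>R \<xi>))"
    by blast
qed

text \<open>Combines an estimate that is good near the origin with one that is good at infinity.
  Their constants may differ, whence the maximum.\<close>

lemma symbol_family_min:
  assumes "symbol_family A w f" "symbol_family A v f"
    and "\<And>a \<xi>. a \<in> A \<Longrightarrow> 0 \<le> w a \<xi>" "\<And>a \<xi>. a \<in> A \<Longrightarrow> 0 \<le> v a \<xi>"
  shows "symbol_family A (\<lambda>a \<xi>. min (w a \<xi>) (v a \<xi>)) f"
proof (rule symbol_familyI)
  fix n
  obtain C where C: "0 \<le> C" "\<And>a. a \<in> A \<Longrightarrow> symbol_bound n (\<lambda>\<xi>. C * w a \<xi>) (f a)"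
    using symbol_familyE[OF assms(1)] by blast
  obtain D where D: "0 \<le> D" "\<And>a. a \<in> A \<Longrightarrow> symbol_bound n (\<lambda>\<xi>. D * v a \<xi>) (f a)"
    using symbol_familyE[OF assms(2)] by blast
  have "symbol_bound n (\<lambda>\<xi>. max C D * min (w a \<xi>) (v a \<xi>)) (f a)" if "a \<in> A" for a
    using symbol_bound_min[OF C(2)[OF that] D(2)[OF that]]
  proof (rule symbol_bound_mono)
    fix \<xi> :: "real^'b"
    have "min (C * w a \<xi>) (D * v a \<xi>) \<le> min (max C D * w a \<xi>) (max C D * v a \<xi>)"
      using assms(3,4)[OF that] by (intro min.mono mult_right_mono) auto
    also have "\<dots> = max C D * min (w a \<xi>) (v a \<xi>)"
      using C(1) D(1) by (subst min_mult_distrib_left) auto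
    finally show "min (C * w a \<xi>) (D * v a \<xi>) \<le> max C D * min (w a \<xi>) (v a \<xi>)" .
  qed
  then show "\<exists>C\<ge>0. \<forall>a\<in>A. symbol_bound n (\<lambda>\<xi>. C * min (w a \<xi>) (v a \<xi>)) (f a)"
    using C(1) by (intro exI[of _ "max C D"]) auto
qed

text \<open>Induction on the number of derivatives: the derivative of 1/f is -(1/f) f' (1/f), and
  the two outer factors are covered by the induction hypothesis. The lower bound on f is used for
  the order zero estimate.\<close>

lemma symbol_family_inverse:
  assumes f: "symbol_family A w f" and "0 < c"
    and lower: "\<And>a \<xi>. a \<in> A \<Longrightarrow> \<xi> \<noteq> 0 \<Longrightarrow> c * w a \<xi> \<le> norm (f a \<xi>)"
    and w: "\<And>a \<xi>. a \<in> A \<Longrightarrow> \<xi> \<noteq> 0 \<Longrightarrow> 0 < w a \<xi>"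
  shows "symbol_family A (\<lambda>a \<xi>. 1 / w a \<xi>) (\<lambda>a \<xi>. 1 / f a \<xi>)"
proof (rule symbol_familyI)
  have f0: "f a \<xi> \<noteq> 0" and norm_le: "norm (1 / f a \<xi>) \<le> (1 / c) * (1 / w a \<xi>)"
    if "a \<in> A" "\<xi> \<noteq> 0" for a \<xi>
  proof -
    have "0 < c * w a \<xi>" using that w \<open>0 < c\<close> by simp
    with lower[OF that] show "f a \<xi> \<noteq> 0" "norm (1 / f a \<xi>) \<le> (1 / c) * (1 / w a \<xi>)"
      by (auto simp: norm_divide intro!: frac_le)
  qed
  fix n
  show "\<exists>C\<ge>0. \<forall>a\<in>A. symbol_bound n (\<lambda>\<xi>. C * (1 / w a \<xi>)) (\<lambda>\<xi>. 1 / f a \<xi>)"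
  proof (induction n)
    case 0
    show ?case using norm_le \<open>0 < c\<close> by (intro exI[of _ "1 / c"]) auto
  next
    case (Suc n)
    then obtain C where C: "0 \<le> C" "\<And>a. a \<in> A \<Longrightarrow> symbol_bound n (\<lambda>\<xi>. C * (1 / w a \<xi>)) (\<lambda>\<xi>. 1 / f a \<xi>)"
      by blast
    obtain D where D: "0 \<le> D" "\<And>a. a \<in> A \<Longrightarrow> symbol_bound (Suc n) (\<lambda>\<xi>. D * w a \<xi>) (f a)"
      using symbol_familyE[OF f] by blast
    \<comment> \<open>The first entry bounds 1/f itself, the second collects the constants of the
      two products in -(1/f) f' (1/f).\<close>
    define K where "K = max (1 / c) (2 ^ n * 2 ^ n * C * C * D)"
    have K0: "0 \<le> K" using \<open>0 < c\<close> by (auto simp: K_def le_max_iff_disj)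
    have "symbol_bound (Suc n) (\<lambda>\<xi>. K * (1 / w a \<xi>)) (\<lambda>\<xi>. 1 / f a \<xi>)" if a: "a \<in> A" for a
    proof -
      have der: "((\<lambda>\<xi>. 1 / f a \<xi>) has_derivative
          (\<lambda>v. - (1 / f a \<xi> * (frechet_derivative (f a) (at \<xi>) v * (1 / f a \<xi>))))) (at \<xi>)" if "\<xi> \<noteq> 0" for \<xi>
      proof -
        have "(f a has_derivative frechet_derivative (f a) (at \<xi>)) (at \<xi>)"
          using D(2)[OF a] that by (intro has_derivative_partial_deriv) auto
        from Deriv.has_derivative_inverse[OF f0[OF a that] this] show ?thesis
          by (simp add: field_simps inverse_eq_divide)
      qed
      have "norm (1 / f a \<xi>) \<le> K * (1 / w a \<xi>)" if "\<xi> \<noteq> 0" for \<xi>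
      proof -
        have "(1 / c) * (1 / w a \<xi>) \<le> K * (1 / w a \<xi>)"
          using w[OF a that] by (intro mult_right_mono) (auto simp: K_def)
        with norm_le[OF a that] show ?thesis by (rule order_trans)
      qed
      moreover have "symbol_bound n (\<lambda>\<xi>. K * (1 / w a \<xi>) / norm \<xi>) (partial_deriv i (\<lambda>\<xi>. 1 / f a \<xi>))" for i
      proof -
        have *: "symbol_bound n (\<lambda>\<xi>. D * w a \<xi> / norm \<xi>) (partial_deriv i (f a))"
          using D(2)[OF a] by simp
        have "symbol_bound n (\<lambda>\<xi>. norm (-1::complex) * (2 ^ n * (C * (1 / w a \<xi>) * (2 ^ n * ((D * w a \<xi> / norm \<xi>) * (C * (1 / w a \<xi>)))))))
          (\<lambda>\<xi>. -1 * (1 / f a \<xi> * (partial_deriv i (f a) \<xi> * (1 / f a \<xi>))))"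
          by (intro symbol_bound_cmult symbol_bound_mult C(2) a *)
        then have "symbol_bound n (\<lambda>\<xi>. K * (1 / w a \<xi>) / norm \<xi>)
          (\<lambda>\<xi>. -1 * (1 / f a \<xi> * (partial_deriv i (f a) \<xi> * (1 / f a \<xi>))))"
        proof (rule symbol_bound_mono)
          fix \<xi> :: "real^'b" assume "\<xi> \<noteq> 0"
          have "norm (-1::complex) * (2 ^ n * (C * (1 / w a \<xi>) * (2 ^ n * ((D * w a \<xi> / norm \<xi>) * (C * (1 / w a \<xi>))))))
            = (2 ^ n * 2 ^ n * C * C * D) * (1 / w a \<xi> / norm \<xi>)"
            using w[OF a \<open>\<xi> \<noteq> 0\<close>] \<open>\<xi> \<noteq> 0\<close> by (simp add: field_simps)
          also have "\<dots> \<le> K * (1 / w a \<xi> / norm \<xi>)"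
            using w[OF a \<open>\<xi> \<noteq> 0\<close>] by (intro mult_right_mono) (auto simp: K_def)
          finally show "norm (-1::complex) * (2 ^ n * (C * (1 / w a \<xi>) * (2 ^ n * ((D * w a \<xi> / norm \<xi>) * (C * (1 / w a \<xi>))))))
            \<le> K * (1 / w a \<xi>) / norm \<xi>" by simp
        qed
        then show ?thesis
          by (rule symbol_bound_cong) (simp add: partial_deriv_eq[OF der] partial_deriv_def[of i "f a"])
      qed
      ultimately show ?thesis using der by (auto simp: differentiable_def)
    qed
    with K0 show ?case by blast
  qed
qed

section \<open>Exponentials of symbols\<close>

lemma power_times_exp_minus_le: "0 < (x::real) \<Longrightarrow> exp (- x) \<le> fact m * (1 / x ^ m)"
proof -
  assume "0 < x"
  \<comment> \<open>The exponential series dominates its single term of degree m.\<close>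
  have "(\<Sum>n\<in>{m}. x ^ n /\<^sub>R fact n) \<le> (\<Sum>n. x ^ n /\<^sub>R fact n)"
    using \<open>0 < x\<close> by (intro sum_le_suminf[OF summable_exp_generic]) auto
  then have "(\<Sum>n\<in>{m}. x ^ n /\<^sub>R fact n) \<le> exp x"
    by (simp add: exp_def)
  then show ?thesis using \<open>0 < x\<close> by (simp add: exp_minus field_simps)
qed

text \<open>Differentiation brings out \<rho>', of size \<rho> / |\<xi>|. In the first estimate the
  surplus factor \<rho> is absorbed by the arbitrary negative power of \<rho> that the exponential
  provides. In the second, order zero is 1 - exp(-\<rho>) \<le> \<rho>, and every derivative has
  already the right size.\<close>

lemma symbol_family_exp_minus:
  assumes \<rho>: "symbol_family A \<rho> (\<lambda>a \<xi>. of_real (\<rho> a \<xi>))"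
    and pos: "\<And>a \<xi>. a \<in> A \<Longrightarrow> \<xi> \<noteq> 0 \<Longrightarrow> 0 < \<rho> a \<xi>"
  shows "symbol_family A (\<lambda>a \<xi>. 1 / \<rho> a \<xi> ^ m) (\<lambda>a \<xi>. exp (- of_real (\<rho> a \<xi>)))"
    and "symbol_family A \<rho> (\<lambda>a \<xi>. 1 - exp (- of_real (\<rho> a \<xi>)))"
proof -
  have der: "((\<lambda>\<xi>. exp (- complex_of_real (\<rho> a \<xi>))) has_derivative
      (\<lambda>v. - (frechet_derivative (\<lambda>\<xi>. complex_of_real (\<rho> a \<xi>)) (at \<xi>) v * exp (- complex_of_real (\<rho> a \<xi>))))) (at \<xi>)"
    if "a \<in> A" "\<xi> \<noteq> 0" for a \<xi>
  proof -
    obtain D where "\<And>a. a \<in> A \<Longrightarrow> symbol_bound (Suc 0) (\<lambda>\<xi>. D * \<rho> a \<xi>) (\<lambda>\<xi>. complex_of_real (\<rho> a \<xi>))"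
      using symbol_familyE[OF \<rho>, where n="Suc 0"] by blast
    from this[OF that(1)] have "((\<lambda>\<xi>. complex_of_real (\<rho> a \<xi>)) has_derivative
        frechet_derivative (\<lambda>\<xi>. complex_of_real (\<rho> a \<xi>)) (at \<xi>)) (at \<xi>)"
      using that by (intro has_derivative_partial_deriv) auto
    from has_derivative_compose[OF has_derivative_minus[OF this] DERIV_exp[unfolded has_field_derivative_def]] show ?thesis
      by (simp add: mult.commute)
  qed
  have main: "\<exists>C\<ge>0. \<forall>a\<in>A. symbol_bound n (\<lambda>\<xi>. C * (1 / \<rho> a \<xi> ^ m)) (\<lambda>\<xi>. exp (- of_real (\<rho> a \<xi>)))" for n m
  proof (induction n arbitrary: m)
    case 0
    have "norm (exp (- complex_of_real (\<rho> a \<xi>))) \<le> fact m * (1 / \<rho> a \<xi> ^ m)" if "a \<in> A" "\<xi> \<noteq> 0" for a \<xi>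
      using power_times_exp_minus_le[OF pos[OF that], of m] by simp
    then show ?case by (intro exI[of _ "fact m"]) auto
  next
    case (Suc n)
    \<comment> \<open>The exponent is raised by one in order to pay for the factor \<rho> produced
      by the derivative.\<close>
    from Suc[of "Suc m"] obtain C where C: "0 \<le> C" "\<And>a. a \<in> A \<Longrightarrow>
        symbol_bound n (\<lambda>\<xi>. C * (1 / \<rho> a \<xi> ^ Suc m)) (\<lambda>\<xi>. exp (- of_real (\<rho> a \<xi>)))"
      by blast
    obtain D where D: "0 \<le> D" "\<And>a. a \<in> A \<Longrightarrow> symbol_bound (Suc n) (\<lambda>\<xi>. D * \<rho> a \<xi>) (\<lambda>\<xi>. of_real (\<rho> a \<xi>))"
      using symbol_familyE[OF \<rho>] by blast
    define K where "K = max (fact m) (2 ^ n * C * D)"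
    have K0: "0 \<le> K" by (auto simp: K_def le_max_iff_disj)
    have "symbol_bound (Suc n) (\<lambda>\<xi>. K * (1 / \<rho> a \<xi> ^ m)) (\<lambda>\<xi>. exp (- of_real (\<rho> a \<xi>)))" if a: "a \<in> A" for a
    proof -
      have "norm (exp (- complex_of_real (\<rho> a \<xi>))) \<le> K * (1 / \<rho> a \<xi> ^ m)" if "\<xi> \<noteq> 0" for \<xi>
      proof -
        have "norm (exp (- complex_of_real (\<rho> a \<xi>))) \<le> fact m * (1 / \<rho> a \<xi> ^ m)"
          using power_times_exp_minus_le[OF pos[OF a that]] by simp
        also have "\<dots> \<le> K * (1 / \<rho> a \<xi> ^ m)"
          using pos[OF a that] by (intro mult_right_mono) (auto simp: K_def)
        finally show ?thesis .
      qed
      moreover have "symbol_bound n (\<lambda>\<xi>. K * (1 / \<rho> a \<xi> ^ m) / norm \<xi>) (partial_deriv i (\<lambda>\<xi>. exp (- of_real (\<rho> a \<xi>))))" for i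
      proof -
        have *: "symbol_bound n (\<lambda>\<xi>. D * \<rho> a \<xi> / norm \<xi>) (partial_deriv i (\<lambda>\<xi>. of_real (\<rho> a \<xi>)))"
          using D(2)[OF a] by simp
        have "symbol_bound n (\<lambda>\<xi>. norm (-1::complex) * (2 ^ n * ((D * \<rho> a \<xi> / norm \<xi>) * (C * (1 / \<rho> a \<xi> ^ Suc m)))))
          (\<lambda>\<xi>. -1 * (partial_deriv i (\<lambda>\<xi>. of_real (\<rho> a \<xi>)) \<xi> * exp (- of_real (\<rho> a \<xi>))))"
          by (intro symbol_bound_cmult symbol_bound_mult C(2) a *)
        then have "symbol_bound n (\<lambda>\<xi>. K * (1 / \<rho> a \<xi> ^ m) / norm \<xi>)
          (\<lambda>\<xi>. -1 * (partial_deriv i (\<lambda>\<xi>. of_real (\<rho> a \<xi>)) \<xi> * exp (- of_real (\<rho> a \<xi>))))"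
        proof (rule symbol_bound_mono)
          fix \<xi> :: "real^'b" assume "\<xi> \<noteq> 0"
          have "norm (-1::complex) * (2 ^ n * ((D * \<rho> a \<xi> / norm \<xi>) * (C * (1 / \<rho> a \<xi> ^ Suc m))))
            = (2 ^ n * C * D) * (1 / \<rho> a \<xi> ^ m / norm \<xi>)"
            using pos[OF a \<open>\<xi> \<noteq> 0\<close>] \<open>\<xi> \<noteq> 0\<close> by (simp add: field_simps)
          also have "\<dots> \<le> K * (1 / \<rho> a \<xi> ^ m / norm \<xi>)"
            using pos[OF a \<open>\<xi> \<noteq> 0\<close>] by (intro mult_right_mono) (auto simp: K_def)
          finally show "norm (-1::complex) * (2 ^ n * ((D * \<rho> a \<xi> / norm \<xi>) * (C * (1 / \<rho> a \<xi> ^ Suc m))))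
            \<le> K * (1 / \<rho> a \<xi> ^ m) / norm \<xi>" by simp
        qed
        then show ?thesis
          by (rule symbol_bound_cong) (simp add: partial_deriv_eq[OF der[OF a]] partial_deriv_def[of i "\<lambda>\<xi>. of_real (\<rho> a \<xi>)"])
      qed
      ultimately show ?thesis using der[OF a] by (auto simp: differentiable_def)
    qed
    with K0 show ?case by blast
  qed
  then show "symbol_family A (\<lambda>a \<xi>. 1 / \<rho> a \<xi> ^ m) (\<lambda>a \<xi>. exp (- of_real (\<rho> a \<xi>)))"
    by (intro symbol_familyI)
  have norm_le: "norm (1 - exp (- complex_of_real (\<rho> a \<xi>))) \<le> \<rho> a \<xi>" if "a \<in> A" "\<xi> \<noteq> 0" for a \<xi>
  proof -
    have "1 - exp (- complex_of_real (\<rho> a \<xi>)) = of_real (1 - exp (- \<rho> a \<xi>))"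
      by (simp add: exp_of_real[symmetric])
    then have "norm (1 - exp (- complex_of_real (\<rho> a \<xi>))) = \<bar>1 - exp (- \<rho> a \<xi>)\<bar>"
      by (simp only: norm_of_real)
    also have "\<dots> \<le> \<rho> a \<xi>"
      using pos[OF that] exp_ge_add_one_self[of "- \<rho> a \<xi>"] by (simp add: abs_if)
    finally show ?thesis .
  qed
  show "symbol_family A \<rho> (\<lambda>a \<xi>. 1 - exp (- of_real (\<rho> a \<xi>)))"
  proof (rule symbol_familyI)
    fix n
    show "\<exists>C\<ge>0. \<forall>a\<in>A. symbol_bound n (\<lambda>\<xi>. C * \<rho> a \<xi>) (\<lambda>\<xi>. 1 - exp (- complex_of_real (\<rho> a \<xi>)))"
    proof (cases n)
      case 0
      then show ?thesis using norm_le by (intro exI[of _ 1]) auto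
    next
      case (Suc k)
      from main[of k 0] obtain C where C: "0 \<le> C" "\<And>a. a \<in> A \<Longrightarrow>
          symbol_bound k (\<lambda>\<xi>. C * 1) (\<lambda>\<xi>. exp (- of_real (\<rho> a \<xi>)))"
        by auto
      obtain D where D: "0 \<le> D" "\<And>a. a \<in> A \<Longrightarrow> symbol_bound (Suc k) (\<lambda>\<xi>. D * \<rho> a \<xi>) (\<lambda>\<xi>. of_real (\<rho> a \<xi>))"
        using symbol_familyE[OF \<rho>] by blast
      define K where "K = max 1 (2 ^ k * C * D)"
      have K0: "0 \<le> K" by (auto simp: K_def le_max_iff_disj)
      have "symbol_bound (Suc k) (\<lambda>\<xi>. K * \<rho> a \<xi>) (\<lambda>\<xi>. 1 - exp (- of_real (\<rho> a \<xi>)))" if a: "a \<in> A" for a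
      proof -
        have d1: "((\<lambda>\<xi>. 1 - exp (- complex_of_real (\<rho> a \<xi>))) has_derivative
          (\<lambda>v. frechet_derivative (\<lambda>\<xi>. complex_of_real (\<rho> a \<xi>)) (at \<xi>) v * exp (- complex_of_real (\<rho> a \<xi>)))) (at \<xi>)"
          if "\<xi> \<noteq> 0" for \<xi>
          using has_derivative_diff[OF has_derivative_const[of 1] der[OF a that]] by simp
        have "norm (1 - exp (- complex_of_real (\<rho> a \<xi>))) \<le> K * \<rho> a \<xi>" if "\<xi> \<noteq> 0" for \<xi>
        proof -
          have "1 * \<rho> a \<xi> \<le> K * \<rho> a \<xi>"
            using pos[OF a that] by (intro mult_right_mono) (auto simp: K_def)
          with norm_le[OF a that] show ?thesis by simp
        qed
        moreover have "symbol_bound k (\<lambda>\<xi>. K * \<rho> a \<xi> / norm \<xi>) (partial_deriv i (\<lambda>\<xi>. 1 - exp (- of_real (\<rho> a \<xi>))))" for i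
        proof -
          have *: "symbol_bound k (\<lambda>\<xi>. D * \<rho> a \<xi> / norm \<xi>) (partial_deriv i (\<lambda>\<xi>. of_real (\<rho> a \<xi>)))"
            using D(2)[OF a] by simp
          have "symbol_bound k (\<lambda>\<xi>. 2 ^ k * ((D * \<rho> a \<xi> / norm \<xi>) * (C * 1)))
            (\<lambda>\<xi>. partial_deriv i (\<lambda>\<xi>. of_real (\<rho> a \<xi>)) \<xi> * exp (- of_real (\<rho> a \<xi>)))"
            by (intro symbol_bound_mult C(2) a *)
          then have "symbol_bound k (\<lambda>\<xi>. K * \<rho> a \<xi> / norm \<xi>)
            (\<lambda>\<xi>. partial_deriv i (\<lambda>\<xi>. of_real (\<rho> a \<xi>)) \<xi> * exp (- of_real (\<rho> a \<xi>)))"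
          proof (rule symbol_bound_mono)
            fix \<xi> :: "real^'b" assume "\<xi> \<noteq> 0"
            have "(2 ^ k * C * D) * (\<rho> a \<xi> / norm \<xi>) \<le> K * (\<rho> a \<xi> / norm \<xi>)"
              using pos[OF a \<open>\<xi> \<noteq> 0\<close>] by (intro mult_right_mono) (auto simp: K_def)
            then show "2 ^ k * ((D * \<rho> a \<xi> / norm \<xi>) * (C * 1)) \<le> K * \<rho> a \<xi> / norm \<xi>"
              by (simp add: mult_ac)
          qed
          then show ?thesis
            by (rule symbol_bound_cong) (simp add: partial_deriv_eq[OF d1] partial_deriv_def[of i "\<lambda>\<xi>. of_real (\<rho> a \<xi>)"])
        qed
        ultimately show ?thesis using d1 by (auto simp: differentiable_def)
      qed
      with K0 Suc show ?thesis by blast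
    qed
  qed
qed

section \<open>The Fourier integral of functions with integrable envelope\<close>

text \<open>A quadratic remainder replaces epsilon arguments. It serves for symbols at the origin,
  for Fourier integrals and for integrals of holomorphic functions with a parameter.\<close>

lemma has_derivative_of_square_remainder:
  fixes f :: "'a::real_normed_vector \<Rightarrow> 'b::real_normed_vector"
  assumes "bounded_linear L" and "0 < r"
    and rem: "\<And>h. norm h < r \<Longrightarrow> norm (f (x + h) - f x - L h) \<le> (norm h)\<^sup>2 * K"
  shows "(f has_derivative L) (at x)"
  unfolding has_derivative_at
proof
  have lim: "((\<lambda>h::'a. norm h * K) \<longlongrightarrow> 0) (at 0)"
    by (auto intro!: tendsto_eq_intros)
  show "((\<lambda>h. norm (f (x + h) - f x - L h) / norm h) \<longlongrightarrow> 0) (at 0)"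
  proof (rule tendsto_sandwich[OF _ _ tendsto_const lim])
    have "\<forall>\<^sub>F h in at (0::'a). norm h < r"
      using \<open>0 < r\<close> by (auto simp: eventually_at intro!: exI[of _ r])
    then show "\<forall>\<^sub>F h in at 0. norm (f (x + h) - f x - L h) / norm h \<le> norm h * K"
    proof (eventually_elim)
      case (elim h)
      then show ?case using rem[OF elim] by (cases "h = 0") (auto simp: divide_simps power2_eq_square mult_ac)
    qed
  qed auto
qed fact

text \<open>The inverse transform without its constant, taken over \<open>lborel\<close>. Both
  transforms of the statement reduce to it by a reflection or a factor, and Fubini and measurability
  can then be handled with Borel functions.\<close>

definition fourier_integral :: "(real^'d::finite \<Rightarrow> complex) \<Rightarrow> real^'d \<Rightarrow> complex" where
  "fourier_integral g x = (LINT \<xi>|lborel. exp (\<i> * of_real (x \<bullet> \<xi>)) * g \<xi>)"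

lemma inverse_fourier_eq:
  fixes g :: "real^'d::finite \<Rightarrow> complex"
  assumes [measurable]: "g \<in> borel_measurable borel"
  shows "inverse_fourier g x = of_real (1 / (2 * pi) ^ CARD('d)) * fourier_integral g x"
  unfolding inverse_fourier_def fourier_integral_def by (subst integral_completion) auto

lemma fourier_eq:
  fixes g :: "real^'d::finite \<Rightarrow> complex"
  assumes [measurable]: "g \<in> borel_measurable borel"
  shows "fourier g x = fourier_integral g (- x)"
  unfolding fourier_def fourier_integral_def
  by (subst integral_completion) (auto simp: inner_commute)

lemma fourier_integral_cmult: "fourier_integral (\<lambda>\<xi>. c * g \<xi>) x = c * fourier_integral g x"
  unfolding fourier_integral_def by (subst integral_mult_right_zero[symmetric]) (simp add: mult_ac)

lemma integrable_envelope_bound: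
  fixes g :: "real^'d::finite \<Rightarrow> 'b::{banach, second_countable_topology}"
  assumes "g \<in> borel_measurable borel" "\<And>\<xi>. norm (g \<xi>) \<le> A * envelope \<xi>"
  shows "integrable lborel g"
  by (rule Bochner_Integration.integrable_bound[of _ "\<lambda>\<xi>. A * envelope \<xi>"])
    (use assms envelope_integrable in \<open>auto intro!: AE_I2 order_trans[OF assms(2)]\<close>)

definition envelope_mass :: "'d::finite itself \<Rightarrow> real" where
  "envelope_mass _ = (LINT x|lborel. envelope (x :: real^'d))"

lemma envelope_mass_nonneg: "0 \<le> envelope_mass TYPE('d::finite)"
  unfolding envelope_mass_def by (intro Bochner_Integration.integral_nonneg) (simp add: envelope_pos less_imp_le)

lemma norm_integral_envelope_le:
  fixes g :: "real^'d::finite \<Rightarrow> 'b::{banach, second_countable_topology}"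
  assumes "\<And>\<xi>. norm (g \<xi>) \<le> A * envelope \<xi>"
  shows "norm (LINT \<xi>|lborel. g \<xi>) \<le> A * envelope_mass TYPE('d)"
proof -
  have "norm (LINT \<xi>|lborel. g \<xi>) \<le> (LINT \<xi>|lborel. A * envelope (\<xi>::real^'d))"
  proof (cases "integrable lborel g")
    case True
    then show ?thesis
      by (rule Bochner_Integration.integral_norm_bound_integral) (use assms envelope_integrable in auto)
  next
    case False
    \<comment> \<open>The Bochner integral of a non-integrable function is 0, and the right-hand
      side is nonnegative because it majorises a norm.\<close>
    have "0 \<le> (LINT \<xi>|lborel. A * envelope (\<xi>::real^'d))"
      by (intro Bochner_Integration.integral_nonneg order_trans[OF norm_ge_zero assms])
    with False show ?thesis
      by (simp add: not_integrable_integral_eq)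
  qed
  then show ?thesis by (simp add: envelope_mass_def)
qed

lemma norm_exp_i_mult [simp]: "norm (exp (\<i> * of_real t) * z) = norm z"
  by (simp add: norm_mult)

lemma norm_fourier_integral_le:
  fixes g :: "real^'d::finite \<Rightarrow> complex"
  assumes "\<And>\<xi>. norm (g \<xi>) \<le> A * envelope \<xi>"
  shows "norm (fourier_integral g x) \<le> A * envelope_mass TYPE('d)"
  unfolding fourier_integral_def by (rule norm_integral_envelope_le) (simp add: assms)

text \<open>Integration by parts through difference quotients: translation invariance moves the
  shift from g to the exponential, and both resulting expressions have a limit as the step tends to
  0.\<close>

lemma fourier_integral_partial_deriv:
  fixes g :: "real^'d::finite \<Rightarrow> complex"
  assumes diff: "\<And>\<xi>. g differentiable (at \<xi>)"
    and g: "\<And>\<xi>. norm (g \<xi>) \<le> A * envelope \<xi>"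
    and dg: "\<And>\<xi>. norm (partial_deriv j g \<xi>) \<le> A * envelope \<xi>"
  shows "fourier_integral (partial_deriv j g) x = - \<i> * of_real (x $ j) * fourier_integral g x"
proof -
  define e :: "real^'d" where "e = axis j 1"
  define s :: "nat \<Rightarrow> real" where "s n = 1 / real (Suc n)" for n
  have s_pos: "0 < s n" and s_le: "s n \<le> 1" for n by (auto simp: s_def)
  have s_lim: "s \<longlonglongrightarrow> 0" unfolding s_def by (rule LIMSEQ_Suc[OF lim_1_over_n])
  have s_at: "filterlim s (at 0) sequentially"
    using s_lim s_pos by (auto simp: filterlim_at intro!: always_eventually) (metis less_irrefl)
  have A: "0 \<le> A"
    using order_trans[OF norm_ge_zero g[of 0]] envelope_pos[of "0::real^'d"] by (simp add: zero_le_mult_iff)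
  have g_cont: "continuous_on UNIV g"
    using diff by (simp add: differentiable_imp_continuous_on differentiable_on_def)
  then have [measurable]: "g \<in> borel_measurable borel"
    by (rule borel_measurable_continuous_onI)
  define D where "D n \<xi> = (g (\<xi> + s n *\<^sub>R e) - g \<xi>) /\<^sub>R s n" for n \<xi>
  have [measurable]: "D n \<in> borel_measurable borel" for n
    unfolding D_def[abs_def] by measurable
  have line: "((\<lambda>t. g (\<xi> + t *\<^sub>R e)) has_vector_derivative partial_deriv j g (\<xi> + t *\<^sub>R e)) (at t within S)" for \<xi> t S
  proof -
    have "((\<lambda>t. \<xi> + t *\<^sub>R e) has_derivative (\<lambda>h. h *\<^sub>R e)) (at t within S)"
      by (auto intro!: derivative_eq_intros)
    from has_derivative_compose[OF this has_derivative_partial_deriv[OF diff]]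
    have "((\<lambda>t. g (\<xi> + t *\<^sub>R e)) has_derivative (\<lambda>h. frechet_derivative g (at (\<xi> + t *\<^sub>R e)) (h *\<^sub>R e))) (at t within S)" .
    then show ?thesis
      by (simp add: has_vector_derivative_def partial_deriv_def e_def
          linear_scale[OF linear_frechet_derivative[OF diff]])
  qed
  have D_lim: "(\<lambda>n. D n \<xi>) \<longlonglongrightarrow> partial_deriv j g \<xi>" for \<xi>
  proof -
    have "((\<lambda>h. norm (g (\<xi> + h *\<^sub>R e) - g \<xi> - h *\<^sub>R partial_deriv j g \<xi>) / norm h) \<longlongrightarrow> 0) (at 0)"
      using line[of \<xi> 0 UNIV] by (simp add: has_vector_derivative_def has_derivative_at)
    from filterlim_compose[OF this s_at]
    have "(\<lambda>n. norm (D n \<xi> - partial_deriv j g \<xi>)) \<longlonglongrightarrow> 0"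
    proof (rule Lim_transform_eventually[OF _ always_eventually, rule_format])
      fix n
      have "D n \<xi> - partial_deriv j g \<xi> = (g (\<xi> + s n *\<^sub>R e) - g \<xi> - s n *\<^sub>R partial_deriv j g \<xi>) /\<^sub>R s n"
        using s_pos[of n] by (simp add: D_def scaleR_diff_right)
      then show "norm (g (\<xi> + s n *\<^sub>R e) - g \<xi> - s n *\<^sub>R partial_deriv j g \<xi>) / norm (s n)
          = norm (D n \<xi> - partial_deriv j g \<xi>)"
        using s_pos[of n] by (simp add: divide_inverse)
    qed
    then show ?thesis
      by (simp add: tendsto_norm_zero_iff LIM_zero_iff)
  qed
  \<comment> \<open>Mean value inequality along a segment of length at most 1, on which
    \<open>envelope_shift\<close> compares the envelope with its value at \<xi>.\<close>
  have D_bound: "norm (D n \<xi>) \<le> (A * 4 ^ CARD('d)) * envelope \<xi>" for n \<xi>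
  proof -
    have "norm (g (\<xi> + s n *\<^sub>R e) - g (\<xi> + 0 *\<^sub>R e)) \<le> (A * 4 ^ CARD('d)) * envelope \<xi> * norm (s n - 0)"
    proof (rule differentiable_bound[where S="{0..s n}"])
      fix t assume t: "t \<in> {0..s n}"
      show "((\<lambda>t. g (\<xi> + t *\<^sub>R e)) has_derivative (\<lambda>h. h *\<^sub>R partial_deriv j g (\<xi> + t *\<^sub>R e))) (at t within {0..s n})"
        using line by (simp add: has_vector_derivative_def)
      have "norm (t *\<^sub>R e) \<le> 1"
        using t s_le[of n] by (simp add: e_def)
      then have "norm (partial_deriv j g (\<xi> + t *\<^sub>R e)) \<le> (A * 4 ^ CARD('d)) * envelope \<xi>"
        using mult_left_mono[OF envelope_shift[of "t *\<^sub>R e" \<xi>] A] dg[of "\<xi> + t *\<^sub>R e"] by simp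
      then show "onorm (\<lambda>h. h *\<^sub>R partial_deriv j g (\<xi> + t *\<^sub>R e)) \<le> (A * 4 ^ CARD('d)) * envelope \<xi>"
        by (intro onorm_le) (simp add: mult_left_mono mult.commute)
    qed (use s_pos[of n] in auto)
    then show ?thesis using s_pos[of n] by (simp add: D_def divide_simps)
  qed
  have lim1: "(\<lambda>n. fourier_integral (D n) x) \<longlonglongrightarrow> fourier_integral (partial_deriv j g) x"
    unfolding fourier_integral_def
  proof (rule integral_dominated_convergence[where w="\<lambda>\<xi>. (A * 4 ^ CARD('d)) * envelope \<xi>"])
    \<comment> \<open>The partial derivative is measurable as the pointwise limit of difference
      quotients.\<close>
    have [measurable]: "partial_deriv j g \<in> borel_measurable borel"
      by (rule borel_measurable_LIMSEQ_metric[of D, OF _ D_lim]) measurable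
    show "(\<lambda>\<xi>. exp (\<i> * complex_of_real (x \<bullet> \<xi>)) * partial_deriv j g \<xi>) \<in> borel_measurable lborel"
      by measurable
    show "integrable lborel (\<lambda>\<xi>::real^'d. A * 4 ^ CARD('d) * envelope \<xi>)"
      by (intro integrable_mult_right envelope_integrable)
    show "AE \<xi> in lborel. (\<lambda>n. exp (\<i> * complex_of_real (x \<bullet> \<xi>)) * D n \<xi>)
        \<longlonglongrightarrow> exp (\<i> * complex_of_real (x \<bullet> \<xi>)) * partial_deriv j g \<xi>"
      by (intro AE_I2 tendsto_intros D_lim)
    show "AE \<xi> in lborel. norm (exp (\<i> * complex_of_real (x \<bullet> \<xi>)) * D n \<xi>) \<le> A * 4 ^ CARD('d) * envelope \<xi>" for n
      by (intro AE_I2) (simp add: D_bound)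
  qed measurable
  have int_g: "integrable lborel (\<lambda>\<xi>. exp (\<i> * complex_of_real (x \<bullet> \<xi>)) * g \<xi>)"
    by (rule integrable_envelope_bound[of _ A]) (simp_all add: g)
  have eq: "fourier_integral (D n) x = (exp (- \<i> * of_real (s n * x $ j)) - 1) /\<^sub>R s n * fourier_integral g x" for n
  proof -
    have xe: "x \<bullet> e = x $ j" by (simp add: e_def inner_axis)
    have shift: "exp (\<i> * complex_of_real (x \<bullet> \<xi>)) * g (\<xi> + s n *\<^sub>R e) =
        exp (- \<i> * of_real (s n * x $ j)) * (exp (\<i> * complex_of_real (x \<bullet> (s n *\<^sub>R e + 1 *\<^sub>R \<xi>))) * g (s n *\<^sub>R e + 1 *\<^sub>R \<xi>))" for \<xi>
    proof -
      have "- \<i> * of_real (s n * x $ j) + \<i> * complex_of_real (x \<bullet> (s n *\<^sub>R e + 1 *\<^sub>R \<xi>)) = \<i> * complex_of_real (x \<bullet> \<xi>)"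
        by (simp add: inner_add_right xe algebra_simps)
      then have "exp (\<i> * complex_of_real (x \<bullet> \<xi>)) =
          exp (- \<i> * of_real (s n * x $ j)) * exp (\<i> * complex_of_real (x \<bullet> (s n *\<^sub>R e + 1 *\<^sub>R \<xi>)))"
        by (simp only: exp_add[symmetric])
      moreover have "g (\<xi> + s n *\<^sub>R e) = g (s n *\<^sub>R e + 1 *\<^sub>R \<xi>)"
        by (simp add: add.commute)
      ultimately show ?thesis by (simp only: mult.assoc)
    qed
    have "integrable lborel (\<lambda>\<xi>. exp (\<i> * complex_of_real (x \<bullet> \<xi>)) * g (\<xi> + s n *\<^sub>R e))"
      unfolding shift by (intro integrable_mult_right lborel_integrable_affine[OF _ int_g]) simp
    then have "fourier_integral (D n) x = ((LINT \<xi>|lborel. exp (\<i> * complex_of_real (x \<bullet> \<xi>)) * g (\<xi> + s n *\<^sub>R e)) - fourier_integral g x) /\<^sub>R s n"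
      unfolding fourier_integral_def D_def
      by (simp only: Bochner_Integration.integral_diff[OF _ int_g, symmetric] integral_scaleR_right[symmetric]
          right_diff_distrib[symmetric] mult_scaleR_right)
    also have "(LINT \<xi>|lborel. exp (\<i> * complex_of_real (x \<bullet> \<xi>)) * g (\<xi> + s n *\<^sub>R e)) = exp (- \<i> * of_real (s n * x $ j)) * fourier_integral g x"
      unfolding shift fourier_integral_def
      using lborel_integral_affine[of 1 "\<lambda>\<xi>. exp (\<i> * complex_of_real (x \<bullet> \<xi>)) * g \<xi>" "s n *\<^sub>R e"] by simp
    finally show ?thesis by (simp add: algebra_simps)
  qed
  have "((\<lambda>h. exp (- \<i> * of_real (h * x $ j))) has_vector_derivative - \<i> * of_real (x $ j)) (at 0)"
    using exp_scaleR_has_vector_derivative_right[of "- \<i> * of_real (x $ j)" 0 UNIV]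
    by (simp add: scaleR_conv_of_real mult_ac)
  then have "((\<lambda>h. norm (exp (- \<i> * of_real (h * x $ j)) - 1 - h *\<^sub>R (- \<i> * of_real (x $ j))) / norm h) \<longlongrightarrow> 0) (at 0)"
    by (simp add: has_vector_derivative_def has_derivative_at)
  from filterlim_compose[OF this s_at]
  have "(\<lambda>n. norm ((exp (- \<i> * of_real (s n * x $ j)) - 1) /\<^sub>R s n - (- \<i> * of_real (x $ j)))) \<longlonglongrightarrow> 0"
  proof (rule Lim_transform_eventually[OF _ always_eventually, rule_format])
    fix n
    have "(exp (- \<i> * of_real (s n * x $ j)) - 1) /\<^sub>R s n - (- \<i> * of_real (x $ j))
      = (exp (- \<i> * of_real (s n * x $ j)) - 1 - s n *\<^sub>R (- \<i> * of_real (x $ j))) /\<^sub>R s n"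
      using s_pos[of n] by (simp add: scaleR_diff_right scaleR_add_right)
    then show "norm (exp (- \<i> * of_real (s n * x $ j)) - 1 - s n *\<^sub>R (- \<i> * of_real (x $ j))) / norm (s n)
      = norm ((exp (- \<i> * of_real (s n * x $ j)) - 1) /\<^sub>R s n - (- \<i> * of_real (x $ j)))"
      using s_pos[of n] by (simp add: divide_inverse)
  qed
  then have "(\<lambda>n. (exp (- \<i> * of_real (s n * x $ j)) - 1) /\<^sub>R s n) \<longlonglongrightarrow> - \<i> * of_real (x $ j)"
    by (simp only: tendsto_norm_zero_iff LIM_zero_iff)
  then have "(\<lambda>n. fourier_integral (D n) x) \<longlonglongrightarrow> - \<i> * of_real (x $ j) * fourier_integral g x"
    unfolding eq by (intro tendsto_intros)
  with lim1 show ?thesis by (rule LIMSEQ_unique)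
qed

lemma norm_exp_i_taylor: "norm (exp (\<i> * of_real t) - 1 - \<i> * of_real t) \<le> t\<^sup>2"
proof -
  define z where "z = \<i> * complex_of_real t"
  have "norm (exp z - (\<Sum>i\<le>1. z ^ i / fact i)) \<le> exp \<bar>Re z\<bar> * norm z ^ Suc 1 / fact 1"
    by (rule Taylor_exp)
  then show ?thesis by (simp add: z_def norm_mult power2_eq_square algebra_simps)
qed

text \<open>Differentiation under the integral sign: the Taylor remainder of the exponential is at
  most |h|^2 |\<xi>|^2, and the factor 1 + |\<xi>|^2 in the hypothesis pays for it.\<close>

lemma fourier_integral_has_derivative:
  fixes g :: "real^'d::finite \<Rightarrow> complex"
  assumes [measurable]: "g \<in> borel_measurable borel"
    and g: "\<And>\<xi>. (1 + (norm \<xi>)\<^sup>2) * norm (g \<xi>) \<le> A * envelope \<xi>"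
  shows "(fourier_integral g has_derivative
      (\<lambda>h. \<Sum>j\<in>UNIV. of_real (h $ j) * fourier_integral (\<lambda>\<xi>. \<i> * of_real (\<xi> $ j) * g \<xi>) x)) (at x)"
proof -
  have le1: "norm \<xi> \<le> 1 + (norm \<xi>)\<^sup>2" for \<xi> :: "real^'d"
  proof -
    have "0 \<le> (norm \<xi> - 1 / 2)\<^sup>2" by simp
    then show ?thesis by (simp add: power2_eq_square algebra_simps)
  qed
  have b0: "norm (g \<xi>) \<le> A * envelope \<xi>" and b1: "norm \<xi> * norm (g \<xi>) \<le> A * envelope \<xi>"
    and b2: "(norm \<xi>)\<^sup>2 * norm (g \<xi>) \<le> A * envelope \<xi>" for \<xi>
  proof -
    have "1 * norm (g \<xi>) \<le> (1 + (norm \<xi>)\<^sup>2) * norm (g \<xi>)" "norm \<xi> * norm (g \<xi>) \<le> (1 + (norm \<xi>)\<^sup>2) * norm (g \<xi>)"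
      "(norm \<xi>)\<^sup>2 * norm (g \<xi>) \<le> (1 + (norm \<xi>)\<^sup>2) * norm (g \<xi>)"
      by (intro mult_right_mono; use le1 in simp)+
    with g[of \<xi>] show "norm (g \<xi>) \<le> A * envelope \<xi>" "norm \<xi> * norm (g \<xi>) \<le> A * envelope \<xi>"
      "(norm \<xi>)\<^sup>2 * norm (g \<xi>) \<le> A * envelope \<xi>" by auto
  qed
  have int0: "integrable lborel (\<lambda>\<xi>. exp (\<i> * complex_of_real (y \<bullet> \<xi>)) * g \<xi>)" for y
    by (rule integrable_envelope_bound[of _ A]) (simp_all add: b0)
  have int1: "integrable lborel (\<lambda>\<xi>. exp (\<i> * complex_of_real (x \<bullet> \<xi>)) * (\<i> * of_real (\<xi> $ j) * g \<xi>))" for j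
  proof (rule integrable_envelope_bound[of _ A])
    fix \<xi> :: "real^'d"
    have "norm (exp (\<i> * complex_of_real (x \<bullet> \<xi>)) * (\<i> * of_real (\<xi> $ j) * g \<xi>)) = \<bar>\<xi> $ j\<bar> * norm (g \<xi>)"
      by (simp add: norm_mult)
    also have "\<dots> \<le> norm \<xi> * norm (g \<xi>)"
      by (intro mult_right_mono component_le_norm_cart) simp
    finally show "norm (exp (\<i> * complex_of_real (x \<bullet> \<xi>)) * (\<i> * of_real (\<xi> $ j) * g \<xi>)) \<le> A * envelope \<xi>"
      using b1[of \<xi>] by simp
  qed measurable
  define L where "L h = (\<Sum>j\<in>UNIV. of_real (h $ j) * fourier_integral (\<lambda>\<xi>. \<i> * of_real (\<xi> $ j) * g \<xi>) x)" for h
  have bl: "bounded_linear L"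
    unfolding L_def[abs_def]
    by (intro bounded_linear_sum bounded_linear_mult_const bounded_linear_compose[OF bounded_linear_of_real] bounded_linear_vec_nth)
  have sum_eq: "(\<Sum>j\<in>UNIV. of_real (h $ j) * (c * (\<i> * of_real (\<xi> $ j) * z))) = c * (\<i> * of_real (h \<bullet> \<xi>) * z)"
    for h \<xi> :: "real^'d" and c z :: complex
  proof -
    have "of_real (h $ j) * (c * (\<i> * of_real (\<xi> $ j) * z)) = c * (\<i> * of_real (h $ j * \<xi> $ j) * z)" for j
      by simp
    then show ?thesis
      by (simp only: inner_vec_def inner_real_def of_real_sum sum_distrib_left sum_distrib_right)
  qed
  have L_eq: "L h = (LINT \<xi>|lborel. exp (\<i> * complex_of_real (x \<bullet> \<xi>)) * (\<i> * of_real (h \<bullet> \<xi>) * g \<xi>))" for h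
  proof -
    have "L h = (\<Sum>j\<in>UNIV. LINT \<xi>|lborel. of_real (h $ j) * (exp (\<i> * complex_of_real (x \<bullet> \<xi>)) * (\<i> * of_real (\<xi> $ j) * g \<xi>)))"
      unfolding L_def fourier_integral_def by simp
    also have "\<dots> = (LINT \<xi>|lborel. (\<Sum>j\<in>UNIV. of_real (h $ j) * (exp (\<i> * complex_of_real (x \<bullet> \<xi>)) * (\<i> * of_real (\<xi> $ j) * g \<xi>))))"
      by (subst Bochner_Integration.integral_sum) (auto intro!: integrable_mult_right int1)
    also have "\<dots> = (LINT \<xi>|lborel. exp (\<i> * complex_of_real (x \<bullet> \<xi>)) * (\<i> * of_real (h \<bullet> \<xi>) * g \<xi>))"
      by (simp only: sum_eq)
    finally show ?thesis .
  qed
  have int2: "integrable lborel (\<lambda>\<xi>. exp (\<i> * complex_of_real (x \<bullet> \<xi>)) * (\<i> * of_real (h \<bullet> \<xi>) * g \<xi>))" for h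
  proof -
    have "integrable lborel (\<lambda>\<xi>. \<Sum>j\<in>UNIV. of_real (h $ j) * (exp (\<i> * complex_of_real (x \<bullet> \<xi>)) * (\<i> * of_real (\<xi> $ j) * g \<xi>)))"
      by (intro Bochner_Integration.integrable_sum integrable_mult_right int1)
    then show ?thesis
      by (simp only: sum_eq)
  qed
  have rem: "norm (fourier_integral g (x + h) - fourier_integral g x - L h) \<le> (norm h)\<^sup>2 * (A * envelope_mass TYPE('d))" for h
  proof -
    have "fourier_integral g (x + h) - fourier_integral g x - L h =
      (LINT \<xi>|lborel. exp (\<i> * complex_of_real (x \<bullet> \<xi>)) * ((exp (\<i> * of_real (h \<bullet> \<xi>)) - 1 - \<i> * of_real (h \<bullet> \<xi>)) * g \<xi>))"
    proof -
      have "exp (\<i> * complex_of_real ((x + h) \<bullet> \<xi>)) = exp (\<i> * complex_of_real (x \<bullet> \<xi>)) * exp (\<i> * of_real (h \<bullet> \<xi>))" for \<xi>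
        by (simp only: exp_add[symmetric] distrib_left[symmetric] of_real_add[symmetric] inner_add_left)
      then have "exp (\<i> * complex_of_real (x \<bullet> \<xi>)) * ((exp (\<i> * of_real (h \<bullet> \<xi>)) - 1 - \<i> * of_real (h \<bullet> \<xi>)) * g \<xi>)
        = exp (\<i> * complex_of_real ((x + h) \<bullet> \<xi>)) * g \<xi> - exp (\<i> * complex_of_real (x \<bullet> \<xi>)) * g \<xi>
          - exp (\<i> * complex_of_real (x \<bullet> \<xi>)) * (\<i> * of_real (h \<bullet> \<xi>) * g \<xi>)" for \<xi>
        by (simp only: ring_distribs mult_1_left mult_1_right mult.assoc)
      then show ?thesis
        unfolding L_eq fourier_integral_def
        by (simp only: Bochner_Integration.integral_diff[OF Bochner_Integration.integrable_diff[OF int0 int0] int2]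
          Bochner_Integration.integral_diff[OF int0 int0])
    qed
    also have "norm \<dots> \<le> ((norm h)\<^sup>2 * A) * envelope_mass TYPE('d)"
    proof (rule norm_integral_envelope_le)
      fix \<xi> :: "real^'d"
      have "norm (exp (\<i> * complex_of_real (x \<bullet> \<xi>)) * ((exp (\<i> * of_real (h \<bullet> \<xi>)) - 1 - \<i> * of_real (h \<bullet> \<xi>)) * g \<xi>))
        = norm (exp (\<i> * of_real (h \<bullet> \<xi>)) - 1 - \<i> * of_real (h \<bullet> \<xi>)) * norm (g \<xi>)"
        by (simp add: norm_mult)
      also have "\<dots> \<le> (h \<bullet> \<xi>)\<^sup>2 * norm (g \<xi>)"
        by (intro mult_right_mono norm_exp_i_taylor) simp
      also have "\<dots> \<le> (norm h * norm \<xi>)\<^sup>2 * norm (g \<xi>)"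
        using Cauchy_Schwarz_ineq2[of h \<xi>] by (intro mult_right_mono) (auto simp: abs_le_square_iff[symmetric])
      also have "\<dots> = (norm h)\<^sup>2 * ((norm \<xi>)\<^sup>2 * norm (g \<xi>))"
        by (simp add: power_mult_distrib)
      also have "\<dots> \<le> (norm h)\<^sup>2 * (A * envelope \<xi>)"
        by (intro mult_left_mono b2) simp
      finally show "norm (exp (\<i> * complex_of_real (x \<bullet> \<xi>)) * ((exp (\<i> * of_real (h \<bullet> \<xi>)) - 1 - \<i> * of_real (h \<bullet> \<xi>)) * g \<xi>))
        \<le> (norm h)\<^sup>2 * A * envelope \<xi>" by simp
    qed
    finally show ?thesis by (simp add: mult_ac)
  qed
  show ?thesis
    unfolding L_def[symmetric]
    by (rule has_derivative_of_square_remainder[OF bl zero_less_one rem])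
qed

text \<open>Records a vanishing order a at the origin and a decay order b at infinity. Both
  exponents add under multiplication, so the orders can be spent one after the other.\<close>

definition split_weight :: "nat \<Rightarrow> nat \<Rightarrow> real^'d::finite \<Rightarrow> real" where
  "split_weight a b \<xi> = (if norm \<xi> \<le> 1 then norm \<xi> ^ a else 1 / norm \<xi> ^ b)"

lemma split_weight_nonneg: "0 \<le> split_weight a b \<xi>"
  by (simp add: split_weight_def)

lemma split_weight_pos: "\<xi> \<noteq> 0 \<Longrightarrow> 0 < split_weight a b \<xi>"
  by (simp add: split_weight_def)

lemma split_weight_mult: "split_weight a b \<xi> * split_weight a' b' \<xi> = split_weight (a + a') (b + b') \<xi>"
  by (simp add: split_weight_def power_add)

lemma split_weight_antimono: "a' \<le> a \<Longrightarrow> b' \<le> b \<Longrightarrow> split_weight a b \<xi> \<le> split_weight a' b' \<xi>"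
proof (cases "norm \<xi> \<le> 1")
  case True
  assume "a' \<le> a" "b' \<le> b"
  with True show ?thesis by (simp add: split_weight_def power_decreasing)
next
  case False
  assume *: "a' \<le> a" "b' \<le> b"
  with False have "norm \<xi> ^ b' \<le> norm \<xi> ^ b" by (intro power_increasing) auto
  moreover have "0 < norm \<xi> ^ b'" using False by (intro zero_less_power) auto
  ultimately show ?thesis using False by (simp add: split_weight_def frac_le)
qed

text \<open>A derivative uses up one order of vanishing at the origin; the decay that it gains at
  infinity is dropped.\<close>

lemma split_weight_divide_norm:
  assumes "\<xi> \<noteq> 0"
  shows "split_weight (Suc a) b \<xi> / norm \<xi> \<le> split_weight a b \<xi>"
proof (cases "norm \<xi> \<le> 1")
  case True
  then show ?thesis using assms by (simp add: split_weight_def)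
next
  case False
  then have "1 / norm \<xi> ^ b / norm \<xi> \<le> 1 / norm \<xi> ^ b / 1"
    by (intro divide_left_mono) auto
  then show ?thesis using False by (simp add: split_weight_def)
qed

lemma split_weight_le:
  assumes "2 * m \<le> b"
  shows "split_weight a b \<xi> \<le> 2 ^ m / (1 + (norm \<xi>)\<^sup>2) ^ m"
proof (cases "norm \<xi> \<le> 1")
  case True
  then have "(1 + (norm \<xi>)\<^sup>2) ^ m \<le> 2 ^ m"
    by (intro power_mono) (auto simp: power_le_one)
  moreover have "norm \<xi> ^ a \<le> 1" using True by (simp add: power_le_one)
  moreover have "0 < (1 + (norm \<xi>)\<^sup>2) ^ m" by (simp add: add_pos_nonneg)
  ultimately show ?thesis
    using True mult_mono[of "norm \<xi> ^ a" 1 "(1 + (norm \<xi>)\<^sup>2) ^ m" "2 ^ m"]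
    by (simp add: split_weight_def le_divide_eq)
next
  case False
  have "split_weight a b \<xi> \<le> split_weight a (2 * m) \<xi>"
    by (rule split_weight_antimono) (use assms in auto)
  also have "\<dots> = 1 / ((norm \<xi>)\<^sup>2) ^ m"
    using False by (simp add: split_weight_def power_mult)
  also have "\<dots> \<le> 2 ^ m / (1 + (norm \<xi>)\<^sup>2) ^ m"
  proof -
    have "1 \<le> (norm \<xi>)\<^sup>2" using False by (simp add: one_le_power)
    then have "(1 + (norm \<xi>)\<^sup>2) ^ m \<le> (2 * (norm \<xi>)\<^sup>2) ^ m"
      by (intro power_mono) auto
    moreover have "0 < (1 + (norm \<xi>)\<^sup>2) ^ m" "0 < ((norm \<xi>)\<^sup>2) ^ m"
      using False by (auto intro!: zero_less_power add_pos_nonneg)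
    ultimately show ?thesis
      by (simp add: divide_simps power_mult_distrib mult.commute)
  qed
  finally show ?thesis .
qed

lemma split_weight_le_envelope:
  "2 * CARD('d) \<le> b \<Longrightarrow> split_weight a b (\<xi>::real^'d::finite) \<le> 2 ^ CARD('d) * envelope \<xi>"
  using split_weight_le[of "CARD('d)" b a \<xi>] by (simp add: envelope_def)

text \<open>A symbol estimate says nothing at the origin itself. Vanishing of order at least 2 fills
  this gap: f is O(|h|^2) there, so its derivative at the origin exists and is zero.\<close>

lemma symbol_bound_differentiable:
  assumes f: "symbol_bound (Suc n) (\<lambda>\<xi>. A * split_weight (k + 2) b \<xi>) f" and f0: "f 0 = 0"
  shows "f differentiable (at \<xi>)" and "partial_deriv j f 0 = 0"
proof -
  have "(f has_derivative (\<lambda>_. 0)) (at 0)"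
  proof (rule has_derivative_of_square_remainder[where r = 1 and K = A])
    fix h :: "real^'a" assume h: "norm h < 1"
    show "norm (f (0 + h) - f 0 - 0) \<le> (norm h)\<^sup>2 * A"
    proof (cases "h = 0")
      case False
      have fh: "norm (f h) \<le> A * split_weight (k + 2) b h"
        using symbol_bound_norm[OF f False] .
      then have "0 \<le> A"
        using split_weight_pos[OF False, of "k+2" b] by (meson norm_ge_zero order_trans zero_le_mult_iff not_less)
      have "norm h ^ (k + 2) \<le> norm h ^ 2"
        using h by (intro power_decreasing) auto
      then have "split_weight (k + 2) b h \<le> (norm h)\<^sup>2"
        using h by (simp add: split_weight_def)
      from mult_left_mono[OF this \<open>0 \<le> A\<close>] fh show ?thesis by (simp add: f0 mult.commute)
    qed (simp add: f0)
  qed auto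
  then show "partial_deriv j f 0 = 0" "f differentiable (at \<xi>)"
    using f by (auto simp: partial_deriv_eq differentiable_def, metis)
qed

lemma symbol_bound_split_weight_nonneg:
  "symbol_bound n (\<lambda>\<xi>. A * split_weight a b \<xi>) (f :: real^'d::finite \<Rightarrow> complex) \<Longrightarrow> 0 \<le> A"
  using symbol_bound_nonneg[of n "\<lambda>\<xi>. A * split_weight a b \<xi>" f "axis undefined 1"]
    split_weight_pos[of "axis undefined 1 :: real^'d" a b]
  by (auto simp: zero_le_mult_iff axis_eq_0_iff)

lemma symbol_bound_envelope:
  assumes f: "symbol_bound n (\<lambda>\<xi>. A * split_weight (Suc a) (2 * CARD('d)) \<xi>) f" and f0: "f 0 = 0"
  shows "norm (f (\<xi>::real^'d::finite)) \<le> A * 2 ^ CARD('d) * envelope \<xi>"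
proof (cases "\<xi> = 0")
  case True
  have "0 \<le> A" using symbol_bound_split_weight_nonneg[OF f] .
  then show ?thesis using True f0 by (simp add: envelope_pos less_imp_le)
next
  case False
  have "0 \<le> A" using symbol_bound_split_weight_nonneg[OF f] .
  then show ?thesis
    using symbol_bound_norm[OF f False]
      mult_left_mono[OF split_weight_le_envelope[of "2 * CARD('d)" "Suc a" \<xi>], of A]
    by simp
qed

text \<open>The n orders of vanishing pay for n integrations by parts in one coordinate direction.
  The two spare orders give, at every stage, differentiability at the origin by
  \<open>symbol_bound_differentiable\<close>.\<close>

lemma fourier_integral_decay_coordinate:
  fixes f :: "real^'d::finite \<Rightarrow> complex"
  assumes "symbol_bound (Suc n) (\<lambda>\<xi>. A * split_weight (n + 2) (2 * CARD('d)) \<xi>) f" "f 0 = 0"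
  shows "\<bar>x $ j\<bar> ^ n * norm (fourier_integral f x) \<le> A * 2 ^ CARD('d) * envelope_mass TYPE('d)"
  using assms
proof (induction n arbitrary: f)
  case (0 f)
  have "norm (f \<xi>) \<le> A * 2 ^ CARD('d) * envelope \<xi>" for \<xi>
    by (rule symbol_bound_envelope[of "Suc 0" _ 1]) (use 0 in \<open>simp_all add: numeral_2_eq_2\<close>)
  from norm_fourier_integral_le[OF this] show ?case by simp
next
  case (Suc n f)
  have A: "0 \<le> A" using symbol_bound_split_weight_nonneg[OF Suc.prems(1)] .
  have "symbol_bound (Suc n) (\<lambda>\<xi>. A * split_weight (Suc n + 2) (2 * CARD('d)) \<xi> / norm \<xi>) (partial_deriv j f)"
    using Suc.prems(1) by (subst (asm) symbol_bound.simps(2)) blast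
  then have df: "symbol_bound (Suc n) (\<lambda>\<xi>. A * split_weight (n + 2) (2 * CARD('d)) \<xi>) (partial_deriv j f)"
  proof (rule symbol_bound_mono)
    fix \<xi> :: "real^'d" assume "\<xi> \<noteq> 0"
    from mult_left_mono[OF split_weight_divide_norm[OF this, of "n + 2"] A]
    show "A * split_weight (Suc n + 2) (2 * CARD('d)) \<xi> / norm \<xi> \<le> A * split_weight (n + 2) (2 * CARD('d)) \<xi>"
      by simp
  qed
  note diff = symbol_bound_differentiable[OF Suc.prems]
  have "fourier_integral (partial_deriv j f) x = - \<i> * of_real (x $ j) * fourier_integral f x"
  proof (rule fourier_integral_partial_deriv[OF diff(1)])
    show "norm (f \<xi>) \<le> A * 2 ^ CARD('d) * envelope \<xi>" for \<xi>
      by (rule symbol_bound_envelope[of "Suc (Suc n)" _ "Suc n + 1"]) (use Suc.prems in simp_all)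
    show "norm (partial_deriv j f \<xi>) \<le> A * 2 ^ CARD('d) * envelope \<xi>" for \<xi>
      by (rule symbol_bound_envelope[of "Suc n" _ "n + 1"]) (use df diff in simp_all)
  qed
  then have "norm (fourier_integral (partial_deriv j f) x) = \<bar>x $ j\<bar> * norm (fourier_integral f x)"
    by (simp add: norm_mult)
  with Suc.IH[OF df diff(2)] show ?case by (simp add: mult_ac)
qed

text \<open>Turns decay along coordinates into radial decay: |x|^2 is at most d times the square of
  the largest coordinate, and that coordinate occurs in the sum.\<close>

lemma one_plus_norm_square_power_le:
  fixes x :: "real^'d::finite"
  shows "(1 + (norm x)\<^sup>2) ^ m \<le> 2 ^ m * (1 + real CARD('d) ^ m * (\<Sum>j\<in>UNIV. \<bar>x $ j\<bar> ^ (2 * m)))"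
proof -
  obtain j where j: "\<And>i. \<bar>x $ i\<bar> \<le> \<bar>x $ j\<bar>"
  proof -
    have "Max (range (\<lambda>i. \<bar>x $ i\<bar>)) \<in> range (\<lambda>i. \<bar>x $ i\<bar>)"
      by (rule Max_in) auto
    then obtain j where "Max (range (\<lambda>i. \<bar>x $ i\<bar>)) = \<bar>x $ j\<bar>" by (rule rangeE)
    then have "\<bar>x $ i\<bar> \<le> \<bar>x $ j\<bar>" for i
      using Max_ge[of "range (\<lambda>i. \<bar>x $ i\<bar>)" "\<bar>x $ i\<bar>"] by auto
    then show ?thesis by (rule that)
  qed
  define t where "t = real CARD('d) * \<bar>x $ j\<bar>\<^sup>2"
  have "(norm x)\<^sup>2 \<le> (\<Sum>i\<in>(UNIV::'d set). \<bar>x $ j\<bar>\<^sup>2)"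
    unfolding norm_vec_squared by (rule sum_mono) (use j in \<open>simp add: abs_le_square_iff\<close>)
  then have "1 + (norm x)\<^sup>2 \<le> 1 + t" by (simp add: t_def)
  then have "(1 + (norm x)\<^sup>2) ^ m \<le> (1 + t) ^ m" by (intro power_mono) (auto simp: add_nonneg_nonneg)
  also have "\<dots> \<le> 2 ^ m * (1 + t ^ m)"
  proof -
    have t0: "0 \<le> t" by (simp add: t_def)
    then have "(1 + t) ^ m \<le> (2 * max 1 t) ^ m" by (intro power_mono) auto
    also have "\<dots> = 2 ^ m * max 1 t ^ m" by (simp add: power_mult_distrib)
    also have "\<dots> \<le> 2 ^ m * (1 + t ^ m)"
      using t0 by (intro mult_left_mono) (auto simp: max_def)
    finally show ?thesis .
  qed
  also have "t ^ m = real CARD('d) ^ m * \<bar>x $ j\<bar> ^ (2 * m)"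
    unfolding t_def power_mult_distrib power_mult ..
  also have "2 ^ m * (1 + real CARD('d) ^ m * \<bar>x $ j\<bar> ^ (2 * m))
      \<le> 2 ^ m * (1 + real CARD('d) ^ m * (\<Sum>j\<in>UNIV. \<bar>x $ j\<bar> ^ (2 * m)))"
    by (intro mult_left_mono add_left_mono member_le_sum) auto
  finally show ?thesis .
qed

definition decay_const :: "'d::finite itself \<Rightarrow> nat \<Rightarrow> real" where
  "decay_const _ m = 2 ^ m * (1 + real CARD('d) ^ m * real CARD('d)) * 2 ^ CARD('d) * envelope_mass TYPE('d)"

lemma decay_const_nonneg: "0 \<le> decay_const TYPE('d::finite) m"
  by (simp add: decay_const_def envelope_mass_nonneg)

text \<open>For \<open>m = CARD('d)\<close> the factor on the left is the reciprocal of
  \<open>envelope\<close>, so the kernel obtains an integrable majorant that is linear in A.\<close>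

lemma fourier_integral_decay:
  fixes f :: "real^'d::finite \<Rightarrow> complex"
  assumes f: "symbol_bound (Suc (2 * m)) (\<lambda>\<xi>. A * split_weight (2 * m + 2) (2 * CARD('d)) \<xi>) f" and "f 0 = 0"
  shows "(1 + (norm x)\<^sup>2) ^ m * norm (fourier_integral f x) \<le> A * decay_const TYPE('d) m"
proof -
  have A: "0 \<le> A" using symbol_bound_split_weight_nonneg[OF f] .
  define K where "K = A * 2 ^ CARD('d) * envelope_mass TYPE('d)"
  have c: "\<bar>x $ j\<bar> ^ (2 * m) * norm (fourier_integral f x) \<le> K" for j
    unfolding K_def by (rule fourier_integral_decay_coordinate) fact+
  have z: "norm (fourier_integral f x) \<le> K"
    unfolding K_def
    by (rule norm_fourier_integral_le, rule symbol_bound_envelope[of "Suc (2 * m)" _ "2 * m + 1"]) (use assms in simp_all)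
  have "(1 + (norm x)\<^sup>2) ^ m * norm (fourier_integral f x) \<le>
      2 ^ m * (1 + real CARD('d) ^ m * (\<Sum>j\<in>UNIV. \<bar>x $ j\<bar> ^ (2 * m))) * norm (fourier_integral f x)"
    by (intro mult_right_mono one_plus_norm_square_power_le) simp
  also have "\<dots> = 2 ^ m * (norm (fourier_integral f x) + real CARD('d) ^ m * (\<Sum>j\<in>UNIV. \<bar>x $ j\<bar> ^ (2 * m) * norm (fourier_integral f x)))"
    by (simp add: algebra_simps sum_distrib_left)
  also have "\<dots> \<le> 2 ^ m * (K + real CARD('d) ^ m * (\<Sum>j\<in>(UNIV::'d set). K))"
    by (intro mult_left_mono add_mono z sum_mono c) auto
  also have "\<dots> = A * decay_const TYPE('d) m"
    by (simp add: decay_const_def K_def algebra_simps)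
  finally show ?thesis .
qed

section \<open>Gaussians and Fourier inversion\<close>

lemma exp_minus_le_inverse_power:
  fixes c :: real
  assumes "0 < c"
  shows "\<exists>A\<ge>0. \<forall>t\<ge>0. exp (- c * t) \<le> A / (1 + t) ^ m"
proof (intro exI conjI allI impI)
  show "0 \<le> exp c * fact m / c ^ m" using assms by simp
  fix t :: real assume "0 \<le> t"
  then have "exp (- (c * (1 + t))) \<le> fact m * (1 / (c * (1 + t)) ^ m)"
    using assms by (intro power_times_exp_minus_le) auto
  then have "exp c * exp (- (c * (1 + t))) \<le> exp c * (fact m * (1 / (c * (1 + t)) ^ m))"
    by (intro mult_left_mono) auto
  moreover have "exp c * exp (- (c * (1 + t))) = exp (- c * t)"
    by (simp add: exp_add[symmetric] algebra_simps)
  ultimately show "exp (- c * t) \<le> exp c * fact m / c ^ m / (1 + t) ^ m"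
    by (simp add: power_mult_distrib)
qed

text \<open>The parameter is not restricted to positive values: c = 0 gives the constant 1, and a
  negative c gives the growing inverse that is used to compute the Fourier integral.\<close>

definition gaussian :: "real \<Rightarrow> real^'d::finite \<Rightarrow> complex" where
  "gaussian c \<xi> = of_real (exp (- c * (norm \<xi>)\<^sup>2))"

lemma gaussian_measurable [measurable]: "gaussian c \<in> borel_measurable borel"
  unfolding gaussian_def[abs_def] by measurable

lemma gaussian_bound:
  assumes "0 < c"
  shows "\<exists>A. \<forall>\<xi>::real^'d::finite. (1 + (norm \<xi>)\<^sup>2) ^ k * norm (gaussian c \<xi>) \<le> A * envelope \<xi>"
proof -
  obtain A where A: "0 \<le> A" "\<And>t. 0 \<le> t \<Longrightarrow> exp (- c * t) \<le> A / (1 + t) ^ (k + CARD('d))"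
    using exp_minus_le_inverse_power[OF assms, of "k + CARD('d)"] by auto
  have "(1 + (norm \<xi>)\<^sup>2) ^ k * norm (gaussian c \<xi>) \<le> A * envelope \<xi>" for \<xi> :: "real^'d"
  proof -
    have pos: "0 < 1 + (norm \<xi>)\<^sup>2" by (simp add: add_pos_nonneg)
    have "(1 + (norm \<xi>)\<^sup>2) ^ k * norm (gaussian c \<xi>) \<le> (1 + (norm \<xi>)\<^sup>2) ^ k * (A / (1 + (norm \<xi>)\<^sup>2) ^ (k + CARD('d)))"
      using A(2)[of "(norm \<xi>)\<^sup>2"] pos by (intro mult_left_mono) (auto simp: gaussian_def simp del: of_real_exp)
    also have "\<dots> = A * envelope \<xi>"
      using pos by (simp add: envelope_def power_add)
    finally show ?thesis .
  qed
  then show ?thesis by blast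
qed

lemma gaussian_has_derivative:
  "(gaussian c has_derivative (\<lambda>v. of_real (- 2 * c * (\<xi> \<bullet> v)) * gaussian c \<xi>)) (at (\<xi>::real^'d::finite))"
proof -
  have "((\<lambda>\<xi>::real^'d. exp (- c * (\<xi> \<bullet> \<xi>))) has_derivative (\<lambda>v. exp (- c * (\<xi> \<bullet> \<xi>)) * (- c * (\<xi> \<bullet> v + v \<bullet> \<xi>)))) (at \<xi>)"
    by (auto intro!: derivative_eq_intros)
  from has_derivative_of_real[OF this, where 'a=complex]
  have "((\<lambda>\<xi>::real^'d. complex_of_real (exp (- c * (\<xi> \<bullet> \<xi>)))) has_derivative
    (\<lambda>v. of_real (exp (- c * (\<xi> \<bullet> \<xi>)) * (- c * (\<xi> \<bullet> v + v \<bullet> \<xi>))))) (at \<xi>)" .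
  then show ?thesis
    unfolding gaussian_def[abs_def] power2_norm_eq_inner
    by (simp add: inner_commute mult_ac)
qed

text \<open>The derivative of a Gaussian is a multiple of its product with a coordinate. Through
  integration by parts, the Fourier integral H then satisfies dH(x) h = -(x \<bullet> h) / (2 c)
  H(x). Multiplied by exp(|x|^2 / (4 c)) it becomes constant, and the Gaussian integral gives its
  value at 0.\<close>

lemma fourier_integral_gaussian:
  assumes c: "0 < c"
  shows "fourier_integral (gaussian c) (x::real^'d::finite)
    = of_real (sqrt (pi / c) ^ CARD('d)) * gaussian (1 / (4 * c)) x"
proof -
  define H where "H = fourier_integral (gaussian c :: real^'d \<Rightarrow> complex)"
  obtain A where A: "\<And>\<xi>::real^'d. (1 + (norm \<xi>)\<^sup>2) ^ 1 * norm (gaussian c \<xi>) \<le> A * envelope \<xi>"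
    using gaussian_bound[OF c] by blast
  have pd: "partial_deriv j (gaussian c) \<xi> = of_real (- 2 * c) * (of_real (\<xi> $ j) * gaussian c \<xi>)" for j and \<xi> :: "real^'d"
    by (subst partial_deriv_eq[OF gaussian_has_derivative]) (simp add: inner_axis)
  have le: "norm (gaussian c \<xi>) \<le> A * envelope \<xi>" "\<bar>\<xi> $ j\<bar> * norm (gaussian c \<xi>) \<le> A * envelope \<xi>" for j and \<xi> :: "real^'d"
  proof -
    have "1 * norm (gaussian c \<xi>) \<le> (1 + (norm \<xi>)\<^sup>2) * norm (gaussian c \<xi>)"
      by (intro mult_right_mono) auto
    with A[of \<xi>] show "norm (gaussian c \<xi>) \<le> A * envelope \<xi>" by simp
    have "0 \<le> (norm \<xi> - 1 / 2)\<^sup>2" by simp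
    then have "norm \<xi> \<le> 1 + (norm \<xi>)\<^sup>2" by (simp add: power2_eq_square algebra_simps)
    then have "\<bar>\<xi> $ j\<bar> * norm (gaussian c \<xi>) \<le> (1 + (norm \<xi>)\<^sup>2) * norm (gaussian c \<xi>)"
      using component_le_norm_cart[of \<xi> j] by (intro mult_right_mono) auto
    with A[of \<xi>] show "\<bar>\<xi> $ j\<bar> * norm (gaussian c \<xi>) \<le> A * envelope \<xi>" by simp
  qed
  have "0 \<le> A"
    using order_trans[OF norm_ge_zero le(1)[of 0]] envelope_pos[of "0::real^'d"] by (simp add: zero_le_mult_iff)
  have coord: "fourier_integral (\<lambda>\<xi>. of_real (\<xi> $ j) * gaussian c \<xi>) x = \<i> * of_real (x $ j) * H x / of_real (2 * c)" for j and x :: "real^'d"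
  proof -
    \<comment> \<open>One constant that bounds both the Gaussian and its partial
      derivatives.\<close>
    define B where "B = max 1 (2 * c) * A"
    have AB: "A \<le> B" "2 * c * A \<le> B"
      using \<open>0 \<le> A\<close> mult_right_mono[of 1 "max 1 (2 * c)" A] mult_right_mono[of "2 * c" "max 1 (2 * c)" A] by (auto simp: B_def)
    have "fourier_integral (partial_deriv j (gaussian c)) x = - \<i> * of_real (x $ j) * fourier_integral (gaussian c) x"
    proof (rule fourier_integral_partial_deriv)
      show "gaussian c differentiable (at \<xi>)" for \<xi> :: "real^'d"
        using gaussian_has_derivative by (auto simp: differentiable_def)
      show "norm (gaussian c \<xi>) \<le> B * envelope \<xi>" for \<xi> :: "real^'d"
        using le(1)[of \<xi>] mult_right_mono[OF AB(1), of "envelope \<xi>"] less_imp_le[OF envelope_pos[of \<xi>]] by simp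
      have "norm (partial_deriv j (gaussian c) \<xi>) = 2 * c * (\<bar>\<xi> $ j\<bar> * norm (gaussian c \<xi>))" for \<xi> :: "real^'d"
        using c by (simp add: pd norm_mult)
      also have "\<dots> \<xi> \<le> 2 * c * (A * envelope \<xi>)" for \<xi> :: "real^'d"
        using c by (intro mult_left_mono le(2)) auto
      also have "\<dots> \<xi> \<le> B * envelope \<xi>" for \<xi> :: "real^'d"
        using mult_right_mono[OF AB(2), of "envelope \<xi>"] less_imp_le[OF envelope_pos[of \<xi>]] by simp
      finally show "norm (partial_deriv j (gaussian c) \<xi>) \<le> B * envelope \<xi>" for \<xi> :: "real^'d" .
    qed
    moreover have "partial_deriv j (gaussian c) = (\<lambda>\<xi>. of_real (- 2 * c) * (of_real (\<xi> $ j) * gaussian c \<xi>))"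
      using pd by blast
    ultimately have "of_real (- 2 * c) * fourier_integral (\<lambda>\<xi>. of_real (\<xi> $ j) * gaussian c \<xi>) x = - \<i> * of_real (x $ j) * H x"
      by (simp only: fourier_integral_cmult H_def)
    then show ?thesis using c by (simp add: field_simps)
  qed
  have dH: "(H has_derivative (\<lambda>h. - of_real ((x \<bullet> h) / (2 * c)) * H x)) (at x)" for x
  proof -
    have "(H has_derivative (\<lambda>h. \<Sum>j\<in>UNIV. of_real (h $ j) * fourier_integral (\<lambda>\<xi>. \<i> * of_real (\<xi> $ j) * gaussian c \<xi>) x)) (at x)"
      unfolding H_def by (rule fourier_integral_has_derivative) (use A in auto)
    moreover have "(\<Sum>j\<in>UNIV. of_real (h $ j) * fourier_integral (\<lambda>\<xi>. \<i> * of_real (\<xi> $ j) * gaussian c \<xi>) x)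
      = - of_real ((x \<bullet> h) / (2 * c)) * H x" for h
    proof -
      have "of_real (h $ j) * fourier_integral (\<lambda>\<xi>. \<i> * of_real (\<xi> $ j) * gaussian c \<xi>) x
        = of_real (x $ j * h $ j) * (- H x / of_real (2 * c))" for j
        by (simp only: mult.assoc fourier_integral_cmult coord) simp
      then have "(\<Sum>j\<in>UNIV. of_real (h $ j) * fourier_integral (\<lambda>\<xi>. \<i> * of_real (\<xi> $ j) * gaussian c \<xi>) x)
        = of_real (\<Sum>j\<in>UNIV. x $ j * h $ j) * (- H x / of_real (2 * c))"
        by (simp only: of_real_sum sum_distrib_right)
      then show ?thesis by (simp add: inner_vec_def)
    qed
    ultimately show ?thesis by simp
  qed
  define P where "P x = H x * gaussian (- 1 / (4 * c)) x" for x
  have dP: "(P has_derivative (\<lambda>_. 0)) (at x)" for x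
  proof -
    have "(P has_derivative (\<lambda>h. H x * (of_real (- 2 * (- 1 / (4 * c)) * (x \<bullet> h)) * gaussian (- 1 / (4 * c)) x)
        + (- of_real ((x \<bullet> h) / (2 * c)) * H x) * gaussian (- 1 / (4 * c)) x)) (at x)"
      unfolding P_def[abs_def] by (rule has_derivative_mult[OF dH gaussian_has_derivative])
    then show ?thesis by (simp add: field_simps)
  qed
  then have "P x = P 0"
    using has_derivative_zero_constant[of UNIV P] by force
  moreover have "P 0 = of_real (sqrt (pi / c) ^ CARD('d))"
  proof -
    have "H 0 = (LINT \<xi>::real^'d|lborel. of_real (exp (- c * (norm \<xi>)\<^sup>2)))"
      by (simp add: H_def fourier_integral_def gaussian_def)
    also have "\<dots> = of_real (sqrt (pi / c) ^ CARD('d))"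
      by (subst integral_of_real) (simp_all only: gaussian_integral[OF c])
    finally show ?thesis by (simp add: P_def gaussian_def)
  qed
  moreover have "H x = P x * gaussian (1 / (4 * c)) x"
    unfolding P_def gaussian_def by (simp add: exp_of_real[symmetric] mult.assoc exp_add[symmetric])
  ultimately show ?thesis by (simp add: H_def)
qed

text \<open>The Fourier integrals of these symbols are Schwartz functions, and they are stable under
  multiplication by symbols that are singular at the origin.\<close>

definition flat_symbol :: "(real^'d::finite \<Rightarrow> complex) \<Rightarrow> bool" where
  "flat_symbol f \<longleftrightarrow> f 0 = 0 \<and> (\<forall>a b. symbol_family {()} (\<lambda>_. split_weight a b) (\<lambda>_. f))"

lemma flat_symbolE:
  assumes "flat_symbol f"
  obtains C where "0 \<le> C" "symbol_bound n (\<lambda>\<xi>. C * split_weight a b \<xi>) f"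
proof -
  have "symbol_family {()} (\<lambda>_. split_weight a b) (\<lambda>_. f)"
    using assms by (simp add: flat_symbol_def)
  then obtain C where "0 \<le> C" "\<And>u. u \<in> {()} \<Longrightarrow> symbol_bound n (\<lambda>\<xi>. C * split_weight a b \<xi>) f"
    using symbol_familyE[where n=n] by blast
  then show ?thesis using that by blast
qed

lemma flat_symbolI:
  assumes "f 0 = 0"
    and zero: "\<And>a. symbol_family {()} (\<lambda>_ \<xi>. norm \<xi> ^ a) (\<lambda>_. f)"
    and infinity: "\<And>b. symbol_family {()} (\<lambda>_ \<xi>. 1 / norm \<xi> ^ b) (\<lambda>_. f)"
  shows "flat_symbol f"
  unfolding flat_symbol_def
proof (intro conjI allI)
  fix a b
  have "symbol_family {()} (\<lambda>_ \<xi>. min (norm \<xi> ^ a) (1 / norm \<xi> ^ b)) (\<lambda>_. f)"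
    by (rule symbol_family_min[OF zero infinity]) auto
  then show "symbol_family {()} (\<lambda>_. split_weight a b) (\<lambda>_. f)"
    by (rule symbol_family_mono[of _ _ _ 1]) (auto simp: split_weight_def)
qed fact

text \<open>The multiplier may be singular of order k at the origin and grow of order l at infinity.
  A flat symbol has both to spare, as its estimates hold for all exponents.\<close>

lemma flat_symbol_mult:
  assumes f: "flat_symbol f" and q: "\<And>n. \<exists>C k l. symbol_bound n (\<lambda>\<xi>. C / split_weight k l \<xi>) q"
  shows "flat_symbol (\<lambda>\<xi>. q \<xi> * f \<xi>)"
  unfolding flat_symbol_def
proof (intro conjI allI symbol_familyI ballI)
  show "q 0 * f 0 = 0" using f by (simp add: flat_symbol_def)
  fix a b n
  obtain C k l where q': "symbol_bound n (\<lambda>\<xi>. C / split_weight k l \<xi>) q" using q by blast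
  obtain D where D: "0 \<le> D" "symbol_bound n (\<lambda>\<xi>. D * split_weight (a + k) (b + l) \<xi>) f"
    using flat_symbolE[OF f] by blast
  have "symbol_bound n (\<lambda>\<xi>. (2 ^ n * \<bar>C\<bar> * D) * split_weight a b \<xi>) (\<lambda>\<xi>. q \<xi> * f \<xi>)"
    using symbol_bound_mult[OF q' D(2)]
  proof (rule symbol_bound_mono)
    fix \<xi> :: "real^'a" assume "\<xi> \<noteq> 0"
    then have "split_weight k l \<xi> \<noteq> 0" using split_weight_pos[of \<xi> k l] by simp
    then have "2 ^ n * (C / split_weight k l \<xi> * (D * split_weight (a + k) (b + l) \<xi>)) = (2 ^ n * C * D) * split_weight a b \<xi>"
      by (simp add: split_weight_mult[symmetric])
    also have "\<dots> \<le> (2 ^ n * \<bar>C\<bar> * D) * split_weight a b \<xi>"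
      using D(1) by (intro mult_right_mono mult_left_mono) (auto simp: split_weight_nonneg)
    finally show "2 ^ n * (C / split_weight k l \<xi> * (D * split_weight (a + k) (b + l) \<xi>)) \<le> (2 ^ n * \<bar>C\<bar> * D) * split_weight a b \<xi>" .
  qed
  with D(1) show "\<exists>C\<ge>0. \<forall>aa\<in>{()}. symbol_bound n (\<lambda>\<xi>. C * split_weight a b \<xi>) (\<lambda>\<xi>. q \<xi> * f \<xi>)"
    by (intro exI[of _ "2 ^ n * \<bar>C\<bar> * D"]) auto
qed

lemma flat_symbol_cmult: "flat_symbol f \<Longrightarrow> flat_symbol (\<lambda>\<xi>. c * f \<xi>)"
  by (auto simp: flat_symbol_def intro: symbol_family_cmult)

lemma flat_symbol_coordinate:
  assumes "flat_symbol f"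
  shows "flat_symbol (\<lambda>\<xi>. \<i> * of_real (\<xi> $ j) * f \<xi>)"
proof -
  have "\<exists>C k l. symbol_bound n (\<lambda>\<xi>::real^'a. C / split_weight k l \<xi>) (\<lambda>\<xi>. of_real (\<xi> $ j))" for n
    by (intro exI[of _ 1] exI[of _ 0] symbol_bound_mono[OF symbol_bound_coordinate]) (auto simp: split_weight_def)
  from flat_symbol_cmult[OF flat_symbol_mult[OF assms this]] show ?thesis
    by (simp add: mult.assoc)
qed

lemma flat_symbol_bound:
  assumes "flat_symbol f"
  shows "\<exists>A. \<forall>\<xi>::real^'d::finite. (1 + (norm \<xi>)\<^sup>2) * norm (f \<xi>) \<le> A * envelope \<xi>"
proof -
  obtain C where C: "0 \<le> C" "symbol_bound 0 (\<lambda>\<xi>. C * split_weight 1 (2 * (CARD('d) + 1)) \<xi>) f"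
    using flat_symbolE[OF assms] by blast
  have "(1 + (norm \<xi>)\<^sup>2) * norm (f \<xi>) \<le> (C * 2 ^ (CARD('d) + 1)) * envelope \<xi>" for \<xi>
  proof -
    have pos: "0 < 1 + (norm \<xi>)\<^sup>2" by (simp add: add_pos_nonneg)
    have "norm (f \<xi>) \<le> C * (2 ^ (CARD('d) + 1) / (1 + (norm \<xi>)\<^sup>2) ^ (CARD('d) + 1))"
    proof (cases "\<xi> = 0")
      case False
      then show ?thesis
        by (intro order_trans[OF symbol_bound_norm[OF C(2) False]] mult_left_mono split_weight_le C(1)) auto
    next
      case True
      then show ?thesis using assms C(1) by (simp add: flat_symbol_def)
    qed
    then have "(1 + (norm \<xi>)\<^sup>2) * norm (f \<xi>) \<le> (1 + (norm \<xi>)\<^sup>2) * (C * (2 ^ (CARD('d) + 1) / (1 + (norm \<xi>)\<^sup>2) ^ (CARD('d) + 1)))"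
      using pos by (intro mult_left_mono) auto
    also have "\<dots> = (C * 2 ^ (CARD('d) + 1)) * envelope \<xi>"
      using pos by (simp add: envelope_def)
    finally show ?thesis .
  qed
  then show ?thesis by blast
qed

lemma flat_symbol_continuous:
  assumes "flat_symbol f"
  shows "continuous_on UNIV f"
proof -
  obtain C where "symbol_bound (Suc 0) (\<lambda>\<xi>. C * split_weight (0 + 2) 0 \<xi>) f"
    using flat_symbolE[OF assms] by blast
  then have "f differentiable (at \<xi>)" for \<xi>
    by (rule symbol_bound_differentiable(1)) (use assms in \<open>simp add: flat_symbol_def\<close>)
  then show ?thesis
    by (simp add: differentiable_imp_continuous_on differentiable_on_def)
qed

lemma flat_symbol_measurable: "flat_symbol f \<Longrightarrow> f \<in> borel_measurable borel"
  by (rule borel_measurable_continuous_onI[OF flat_symbol_continuous])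

lemma partial_deriv_fourier_integral:
  assumes "flat_symbol f"
  shows "fourier_integral f differentiable (at x)"
    and "partial_deriv j (fourier_integral f) x = fourier_integral (\<lambda>\<xi>. \<i> * of_real (\<xi> $ j) * f \<xi>) x"
proof -
  obtain A where A: "\<And>\<xi>. (1 + (norm \<xi>)\<^sup>2) * norm (f \<xi>) \<le> A * envelope \<xi>"
    using flat_symbol_bound[OF assms] by blast
  note D = fourier_integral_has_derivative[OF flat_symbol_measurable[OF assms] A]
  show "fourier_integral f differentiable (at x)"
    using D by (auto simp: differentiable_def)
  show "partial_deriv j (fourier_integral f) x = fourier_integral (\<lambda>\<xi>. \<i> * of_real (\<xi> $ j) * f \<xi>) x"
    unfolding partial_deriv_eq[OF D] by (subst sum.remove[of _ j]) (auto simp: axis_def intro!: sum.neutral)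
qed

lemma iterated_partial_fourier_integral:
  "flat_symbol f \<Longrightarrow> \<exists>g. flat_symbol g \<and> iterated_partial is (fourier_integral f) = fourier_integral g"
proof (induction "is")
  case (Cons j js)
  then obtain g where g: "flat_symbol g" "iterated_partial js (fourier_integral f) = fourier_integral g"
    by blast
  have "iterated_partial (j # js) (fourier_integral f) = partial_deriv j (fourier_integral g)"
    using g(2) by (simp add: iterated_partial_def)
  also have "\<dots> = fourier_integral (\<lambda>\<xi>. \<i> * of_real (\<xi> $ j) * g \<xi>)"
    by (rule ext) (rule partial_deriv_fourier_integral(2)[OF g(1)])
  finally show ?case
    using flat_symbol_coordinate[OF g(1)] by blast
qed (auto simp: iterated_partial_def)

text \<open>Derivatives only multiply the symbol by coordinates, under which flat symbols are
  stable, and each of the resulting integrals decays to every order.\<close>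

lemma schwartz_fourier_integral:
  assumes "flat_symbol (f :: real^'d::finite \<Rightarrow> complex)"
  shows "schwartz (fourier_integral f)"
  unfolding schwartz_def smooth_on_def
proof (intro conjI allI ballI)
  fix "is" :: "'d list" and x :: "real^'d"
  show "iterated_partial is (fourier_integral f) differentiable (at x)"
    using iterated_partial_fourier_integral[OF assms, of "is"] partial_deriv_fourier_integral(1) by metis
next
  fix k and "is" :: "'d list"
  obtain g where g: "flat_symbol g" "iterated_partial is (fourier_integral f) = fourier_integral g"
    using iterated_partial_fourier_integral[OF assms] by blast
  obtain C where C: "symbol_bound (Suc (2 * k)) (\<lambda>\<xi>. C * split_weight (2 * k + 2) (2 * CARD('d)) \<xi>) g"
    using flat_symbolE[OF g(1)] by blast
  have "japanese_bracket x ^ k * norm (fourier_integral g x) \<le> C * decay_const TYPE('d) k" for x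
  proof -
    \<comment> \<open>The decay estimate is stated for even powers; since the bracket is at least 1,
      doubling the exponent is harmless.\<close>
    have "japanese_bracket x ^ k \<le> (japanese_bracket x)\<^sup>2 ^ k"
    proof (rule power_mono)
      have "1 \<le> japanese_bracket x" by (simp add: japanese_bracket_def)
      from mult_left_mono[OF this, of "japanese_bracket x"] this
      show "japanese_bracket x \<le> (japanese_bracket x)\<^sup>2" by (simp add: power2_eq_square)
    qed (simp add: japanese_bracket_def add_nonneg_nonneg)
    also have "\<dots> = (1 + (norm x)\<^sup>2) ^ k" by (simp add: japanese_bracket_def add_nonneg_nonneg)
    finally have "japanese_bracket x ^ k * norm (fourier_integral g x) \<le> (1 + (norm x)\<^sup>2) ^ k * norm (fourier_integral g x)"
      by (rule mult_right_mono) simp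
    also have "\<dots> \<le> C * decay_const TYPE('d) k"
      by (rule fourier_integral_decay[OF C]) (use g(1) in \<open>simp add: flat_symbol_def\<close>)
    finally show ?thesis .
  qed
  then show "\<exists>K. \<forall>x. japanese_bracket x ^ k * norm (iterated_partial is (fourier_integral f) x) \<le> K"
    unfolding g(2) by blast
qed

lemma inverse_fourier_flat:
  assumes "flat_symbol (f :: real^'d::finite \<Rightarrow> complex)"
  shows "inverse_fourier f = fourier_integral (\<lambda>\<xi>. of_real (1 / (2 * pi) ^ CARD('d)) * f \<xi>)"
  by (rule ext) (simp only: inverse_fourier_eq[OF flat_symbol_measurable[OF assms]] fourier_integral_cmult)

lemma schwartz_inverse_fourier: "flat_symbol f \<Longrightarrow> schwartz (inverse_fourier f)"
  by (simp only: inverse_fourier_flat schwartz_fourier_integral flat_symbol_cmult)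

text \<open>An approximate identity, written after the substitution that fixes the Gaussian; the
  dominating function is then the same for all n.\<close>

lemma gaussian_convolution_tendsto:
  fixes f :: "real^'d::finite \<Rightarrow> complex"
  assumes cont: "continuous_on UNIV f" and bounded: "\<And>x. norm (f x) \<le> B" and s: "s \<longlonglongrightarrow> 0"
  shows "(\<lambda>n. LINT z|lborel. f (\<xi> + s n *\<^sub>R z) * gaussian 1 z) \<longlonglongrightarrow> f \<xi> * of_real (sqrt pi ^ CARD('d))"
proof -
  have [measurable]: "f \<in> borel_measurable borel"
    by (rule borel_measurable_continuous_onI[OF cont])
  have "(\<lambda>n. LINT z|lborel. f (\<xi> + s n *\<^sub>R z) * gaussian 1 z) \<longlonglongrightarrow> (LINT z|lborel. f \<xi> * gaussian 1 (z::real^'d))"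
  proof (rule integral_dominated_convergence[where w="\<lambda>z. B * exp (- (norm z)\<^sup>2)"])
    show "integrable lborel (\<lambda>z::real^'d. B * exp (- (norm z)\<^sup>2))"
      by (intro integrable_mult_right exp_minus_norm_square)
    have "(\<lambda>n. f (\<xi> + s n *\<^sub>R z)) \<longlonglongrightarrow> f (\<xi> + 0 *\<^sub>R z)" for z
    proof (rule continuous_on_tendsto_compose[OF cont])
      show "(\<lambda>n. \<xi> + s n *\<^sub>R z) \<longlonglongrightarrow> \<xi> + 0 *\<^sub>R z" by (intro tendsto_intros s)
    qed auto
    then show "AE z in lborel. (\<lambda>n. f (\<xi> + s n *\<^sub>R z) * gaussian 1 z) \<longlonglongrightarrow> f \<xi> * gaussian 1 z"
      by (intro AE_I2 tendsto_intros) simp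
    show "AE z in lborel. norm (f (\<xi> + s n *\<^sub>R z) * gaussian 1 z) \<le> B * exp (- (norm z)\<^sup>2)" for n
      by (intro AE_I2) (auto simp: norm_mult gaussian_def bounded simp del: of_real_exp intro!: mult_right_mono)
  qed measurable
  also have "(LINT z|lborel. f \<xi> * gaussian 1 (z::real^'d)) = f \<xi> * of_real (LINT z::real^'d|lborel. exp (- (norm z)\<^sup>2))"
    by (simp add: gaussian_def integral_of_real[OF exp_minus_norm_square(1)] del: of_real_exp)
  finally show ?thesis by (simp only: exp_minus_norm_square(2))
qed

text \<open>Fourier inversion by Gaussian damping. The damped integral J tends to the transform by
  dominated convergence; by Fubini it is also a convolution of f with a narrowing Gaussian, which
  tends to f \<xi>.\<close>

lemma fourier_inverse_fourier:
  fixes f :: "real^'d::finite \<Rightarrow> complex"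
  assumes f: "flat_symbol f"
  shows "fourier (inverse_fourier f) \<xi> = f \<xi>"
proof -
  define \<phi> where "\<phi> = inverse_fourier f"
  define K :: complex where "K = of_real ((2 * pi) ^ CARD('d))"
  have K0: "K \<noteq> 0" by (simp add: K_def)
  have [measurable]: "f \<in> borel_measurable borel" by (rule flat_symbol_measurable[OF f])
  have \<phi>_eq: "\<phi> x = fourier_integral f x / K" for x
    by (simp add: \<phi>_def inverse_fourier_eq K_def)
  have \<phi>_cont: "continuous_on UNIV \<phi>"
    unfolding \<phi>_def inverse_fourier_flat[OF f]
    by (rule differentiable_imp_continuous_on)
      (simp only: differentiable_on_def partial_deriv_fourier_integral(1)[OF flat_symbol_cmult[OF f]] ball_simps simp_thms)
  then have [measurable]: "\<phi> \<in> borel_measurable borel"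
    by (rule borel_measurable_continuous_onI)
  obtain C where C: "0 \<le> C" "symbol_bound (Suc (2 * CARD('d))) (\<lambda>\<xi>. C * split_weight (2 * CARD('d) + 2) (2 * CARD('d)) \<xi>) f"
    using flat_symbolE[OF f] by blast
  have f0: "f 0 = 0" using f by (simp add: flat_symbol_def)
  define B where "B = C * decay_const TYPE('d) CARD('d) / norm K"
  have \<phi>_le: "norm (\<phi> x) \<le> B * envelope x" for x
  proof -
    have "(1 + (norm x)\<^sup>2) ^ CARD('d) * norm (fourier_integral f x) \<le> C * decay_const TYPE('d) CARD('d)"
      by (rule fourier_integral_decay[OF C(2) f0])
    moreover have "0 < (1 + (norm x)\<^sup>2) ^ CARD('d)" by (simp add: add_pos_nonneg)
    ultimately have "norm (fourier_integral f x) \<le> C * decay_const TYPE('d) CARD('d) * envelope x"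
      by (simp add: envelope_def field_simps)
    from divide_right_mono[OF this, of "norm K"] show ?thesis
      by (simp add: \<phi>_eq B_def norm_divide)
  qed
  have f_le: "norm (f \<eta>) \<le> C * 2 ^ CARD('d) * envelope \<eta>" for \<eta>
    by (rule symbol_bound_envelope[of "Suc (2 * CARD('d))" _ "2 * CARD('d) + 1"])
      (use C(2) f0 in \<open>simp_all del: symbol_bound.simps\<close>)
  have int_f: "integrable lborel f"
    by (rule integrable_envelope_bound[OF _ f_le]) measurable
  define s :: "nat \<Rightarrow> real" where "s n = 1 / real (Suc n)" for n
  have s_pos: "0 < s n" and s_sq: "0 < (s n)\<^sup>2" for n by (auto simp: s_def)
  have s_lim: "s \<longlonglongrightarrow> 0" unfolding s_def by (rule LIMSEQ_Suc[OF lim_1_over_n])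
  define J where "J n = (LINT x|lborel. exp (\<i> * of_real (- \<xi> \<bullet> x)) * \<phi> x * gaussian ((s n)\<^sup>2) x)" for n
  have lim1: "J \<longlonglongrightarrow> (LINT x|lborel. exp (\<i> * of_real (- \<xi> \<bullet> x)) * \<phi> x * 1)"
    unfolding J_def
  proof (rule integral_dominated_convergence[where w="\<lambda>x. B * envelope x"])
    show "integrable lborel (\<lambda>x::real^'d. B * envelope x)"
      by (intro integrable_mult_right envelope_integrable)
    have "(\<lambda>n. gaussian ((s n)\<^sup>2) x) \<longlonglongrightarrow> complex_of_real (exp (- 0\<^sup>2 * (norm x)\<^sup>2))" for x :: "real^'d"
      unfolding gaussian_def by (intro tendsto_intros s_lim)
    then show "AE x in lborel. (\<lambda>n. exp (\<i> * of_real (- \<xi> \<bullet> x)) * \<phi> x * gaussian ((s n)\<^sup>2) x) \<longlonglongrightarrow> exp (\<i> * of_real (- \<xi> \<bullet> x)) * \<phi> x * 1"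
      by (intro AE_I2 tendsto_intros) simp
    show "AE x in lborel. norm (exp (\<i> * of_real (- \<xi> \<bullet> x)) * \<phi> x * gaussian ((s n)\<^sup>2) x) \<le> B * envelope x" for n
    proof (intro AE_I2)
      fix x :: "real^'d"
      have "norm (exp (\<i> * of_real (- \<xi> \<bullet> x)) * \<phi> x * gaussian ((s n)\<^sup>2) x) = norm (\<phi> x) * exp (- (s n)\<^sup>2 * (norm x)\<^sup>2)"
        by (simp add: norm_mult gaussian_def mult.assoc del: of_real_exp)
      also have "\<dots> \<le> norm (\<phi> x) * 1" by (intro mult_left_mono) auto
      finally show "norm (exp (\<i> * of_real (- \<xi> \<bullet> x)) * \<phi> x * gaussian ((s n)\<^sup>2) x) \<le> B * envelope x"
        using \<phi>_le[of x] by simp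
    qed
  qed measurable
  have J_eq: "J n = (LINT z|lborel. f (\<xi> + (2 * s n) *\<^sub>R z) * gaussian 1 z) * of_real (2 * sqrt pi) ^ CARD('d) / K" for n
  proof -
    define G where "G = (\<lambda>(x, \<eta>). exp (\<i> * of_real ((\<eta> - \<xi>) \<bullet> x)) * gaussian ((s n)\<^sup>2) x * f \<eta>)"
    have G_meas [measurable]: "G \<in> borel_measurable (lborel \<Otimes>\<^sub>M lborel)"
      unfolding G_def by measurable
    have normG: "norm (G (x, \<eta>)) = exp (- (s n)\<^sup>2 * (norm x)\<^sup>2) * norm (f \<eta>)" for x \<eta>
      by (simp add: G_def norm_mult gaussian_def mult.assoc del: of_real_exp)
    \<comment> \<open>The damping makes the double integral absolutely convergent: in modulus the
      integrand is a Gaussian in x times the integrable |f \<eta>|.\<close>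
    have G_int: "integrable (lborel \<Otimes>\<^sub>M lborel) G"
    proof (rule lborel_pair.Fubini_integrable)
      show "integrable lborel (\<lambda>x. LINT \<eta>|lborel. norm (G (x, \<eta>)))"
        unfolding normG using gaussian_integral(1)[OF s_sq[of n], where 'd='d] by simp
      have "integrable lborel (\<lambda>\<eta>. G (x, \<eta>))" for x
        unfolding G_def prod.case
        by (rule Bochner_Integration.integrable_bound[OF int_f])
          (auto simp: norm_mult gaussian_def mult.assoc mult_left_le_one_le simp del: of_real_exp)
      then show "AE x in lborel. integrable lborel (\<lambda>\<eta>. G (x, \<eta>))" by simp
    qed fact
    have "J n = (LINT x|lborel. (LINT \<eta>|lborel. G (x, \<eta>)) / K)"
      unfolding J_def
    proof (rule Bochner_Integration.integral_cong[OF refl])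
      fix x
      have "exp (\<i> * of_real (- \<xi> \<bullet> x)) * fourier_integral f x * gaussian ((s n)\<^sup>2) x = (LINT \<eta>|lborel. G (x, \<eta>))"
      proof -
        have "exp (\<i> * of_real (- \<xi> \<bullet> x)) * gaussian ((s n)\<^sup>2) x * (exp (\<i> * of_real (x \<bullet> \<eta>)) * f \<eta>) = G (x, \<eta>)" for \<eta>
        proof -
          have "exp (\<i> * of_real (- \<xi> \<bullet> x)) * exp (\<i> * complex_of_real (x \<bullet> \<eta>)) = exp (\<i> * of_real ((\<eta> - \<xi>) \<bullet> x))"
            by (simp add: exp_add[symmetric] inner_diff_left inner_commute algebra_simps)
          then show ?thesis by (simp add: G_def mult_ac)
        qed
        then have "(LINT \<eta>|lborel. G (x, \<eta>)) = exp (\<i> * of_real (- \<xi> \<bullet> x)) * gaussian ((s n)\<^sup>2) x * fourier_integral f x"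
          by (simp only: fourier_integral_def integral_mult_right_zero[symmetric])
        then show ?thesis by (simp only: mult_ac)
      qed
      then show "exp (\<i> * of_real (- \<xi> \<bullet> x)) * \<phi> x * gaussian ((s n)\<^sup>2) x = (LINT \<eta>|lborel. G (x, \<eta>)) / K"
        by (simp add: \<phi>_eq)
    qed
    also have "\<dots> = (LINT x|lborel. (LINT \<eta>|lborel. G (x, \<eta>))) / K" by simp
    also have "(LINT x|lborel. (LINT \<eta>|lborel. G (x, \<eta>))) = (LINT \<eta>|lborel. (LINT x|lborel. G (x, \<eta>)))"
      using lborel_pair.Fubini_integral[of "\<lambda>x \<eta>. G (x, \<eta>)"] G_int by (simp add: case_prod_unfold)
    also have "\<dots> = (LINT \<eta>|lborel. of_real (sqrt (pi / (s n)\<^sup>2) ^ CARD('d)) * (gaussian (1 / (4 * (s n)\<^sup>2)) (\<eta> - \<xi>) * f \<eta>))"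
    proof (rule Bochner_Integration.integral_cong[OF refl])
      fix \<eta>
      have "(LINT x|lborel. G (x, \<eta>)) = fourier_integral (gaussian ((s n)\<^sup>2)) (\<eta> - \<xi>) * f \<eta>"
        unfolding fourier_integral_def G_def by simp
      then show "(LINT x|lborel. G (x, \<eta>)) = of_real (sqrt (pi / (s n)\<^sup>2) ^ CARD('d)) * (gaussian (1 / (4 * (s n)\<^sup>2)) (\<eta> - \<xi>) * f \<eta>)"
        by (simp only: fourier_integral_gaussian[OF s_sq] mult.assoc)
    qed
    also have "\<dots> = of_real (sqrt (pi / (s n)\<^sup>2) ^ CARD('d)) * (LINT \<eta>|lborel. gaussian (1 / (4 * (s n)\<^sup>2)) (\<eta> - \<xi>) * f \<eta>)"
      by (rule integral_mult_right_zero)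
    \<comment> \<open>Substitution \<eta> = \<xi> + 2 s z, which normalises the Gaussian.\<close>
    also have "(LINT \<eta>|lborel. gaussian (1 / (4 * (s n)\<^sup>2)) (\<eta> - \<xi>) * f \<eta>)
        = (2 * s n) ^ CARD('d) *\<^sub>R (LINT z|lborel. f (\<xi> + (2 * s n) *\<^sub>R z) * gaussian 1 z)"
    proof -
      have "gaussian (1 / (4 * (s n)\<^sup>2)) ((2 * s n) *\<^sub>R z) = gaussian 1 z" for z :: "real^'d"
        using s_pos[of n] by (simp add: gaussian_def power_mult_distrib del: of_real_exp)
      then show ?thesis
        using s_pos[of n] by (subst lborel_integral_affine[of "2 * s n" _ \<xi>]) (simp_all add: mult.commute)
    qed
    also have "of_real (sqrt (pi / (s n)\<^sup>2) ^ CARD('d)) * ((2 * s n) ^ CARD('d) *\<^sub>R (LINT z|lborel. f (\<xi> + (2 * s n) *\<^sub>R z) * gaussian 1 z))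
      = (LINT z|lborel. f (\<xi> + (2 * s n) *\<^sub>R z) * gaussian 1 z) * of_real (2 * sqrt pi) ^ CARD('d)"
    proof -
      have "sqrt (pi / (s n)\<^sup>2) * (2 * s n) = 2 * sqrt pi"
        using s_pos[of n] by (simp add: real_sqrt_divide)
      then have 1: "sqrt (pi / (s n)\<^sup>2) ^ CARD('d) * (2 * s n) ^ CARD('d) = (2 * sqrt pi) ^ CARD('d)"
        by (simp only: power_mult_distrib[symmetric])
      have 2: "of_real a * (b *\<^sub>R z) = of_real (a * b) * z" for a b and z :: complex
        by (simp add: scaleR_conv_of_real)
      show ?thesis unfolding 2 1 by (simp only: of_real_power mult.commute)
    qed
    finally show ?thesis .
  qed
  have "(\<lambda>n. LINT z|lborel. f (\<xi> + (2 * s n) *\<^sub>R z) * gaussian 1 z) \<longlonglongrightarrow> f \<xi> * of_real (sqrt pi ^ CARD('d))"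
  proof (rule gaussian_convolution_tendsto[OF flat_symbol_continuous[OF f]])
    show "norm (f \<eta>) \<le> C * 2 ^ CARD('d) * 1" for \<eta>
      using C(1) by (intro order_trans[OF f_le] mult_left_mono) (auto simp: envelope_def divide_le_eq_1 add_pos_nonneg one_le_power)
    show "(\<lambda>n. 2 * s n) \<longlonglongrightarrow> 0" using tendsto_mult_right_zero[OF s_lim] by simp
  qed
  then have "J \<longlonglongrightarrow> f \<xi> * of_real (sqrt pi ^ CARD('d)) * of_real (2 * sqrt pi) ^ CARD('d) / K"
    unfolding J_eq by (intro tendsto_intros K0)
  also have "f \<xi> * of_real (sqrt pi ^ CARD('d)) * of_real (2 * sqrt pi) ^ CARD('d) / K = f \<xi>"
  proof -
    have "sqrt pi * (2 * sqrt pi) = 2 * pi" by simp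
    then have "sqrt pi ^ CARD('d) * (2 * sqrt pi) ^ CARD('d) = (2 * pi) ^ CARD('d)"
      by (simp only: power_mult_distrib[symmetric])
    then have "of_real (sqrt pi ^ CARD('d)) * of_real (2 * sqrt pi) ^ CARD('d) = K"
      by (simp only: K_def of_real_power[symmetric] of_real_mult[symmetric])
    then show ?thesis using K0 by (simp add: mult.assoc)
  qed
  finally have lim2: "J \<longlonglongrightarrow> f \<xi>" .
  have "fourier \<phi> \<xi> = (LINT x|lborel. exp (\<i> * of_real (- \<xi> \<bullet> x)) * \<phi> x * 1)"
    by (simp add: fourier_eq fourier_integral_def)
  with LIMSEQ_unique[OF lim1 lim2] show ?thesis by (simp add: \<phi>_def)
qed

text \<open>Test functions are prescribed on the Fourier side; this evaluates a multiplier on them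
  by multiplying symbols.\<close>

lemma fourier_multiplier_inverse_fourier:
  "flat_symbol f \<Longrightarrow> fourier_multiplier q (inverse_fourier f) = inverse_fourier (\<lambda>\<xi>. q \<xi> * f \<xi>)"
  by (simp add: fourier_multiplier_def fourier_inverse_fourier)

section \<open>Frequency localisation\<close>

lemma symbol_family_param: "symbol_family A (\<lambda>a _. norm (\<kappa> a)) (\<lambda>a _. \<kappa> a)"
  by (auto simp: symbol_family_def intro!: exI[of _ 1] symbol_bound_const)

lemma symbol_family_reparam:
  assumes "symbol_family A w f" "\<And>b. b \<in> B \<Longrightarrow> \<sigma> b \<in> A"
  shows "symbol_family B (\<lambda>b. w (\<sigma> b)) (\<lambda>b. f (\<sigma> b))"
proof (rule symbol_familyI)
  fix n
  obtain C where "0 \<le> C" "\<And>a. a \<in> A \<Longrightarrow> symbol_bound n (\<lambda>\<xi>. C * w a \<xi>) (f a)"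
    using symbol_familyE[OF assms(1), where n=n] by blast
  then show "\<exists>C\<ge>0. \<forall>b\<in>B. symbol_bound n (\<lambda>\<xi>. C * w (\<sigma> b) \<xi>) (f (\<sigma> b))"
    using assms(2) by blast
qed

lemma symbol_family_norm_square:
  "symbol_family {0<..} (\<lambda>c \<xi>. c * (norm \<xi>)\<^sup>2) (\<lambda>c \<xi>::real^'d::finite. of_real (c * (norm \<xi>)\<^sup>2))"
proof -
  have "symbol_family {0<..} (\<lambda>_ \<xi>. norm \<xi> * norm \<xi>) (\<lambda>(c::real) \<xi>::real^'d. \<Sum>i\<in>UNIV. of_real (\<xi> $ i) * of_real (\<xi> $ i))"
    by (intro symbol_family_sum symbol_family_mult symbol_family_coordinate)
  from symbol_family_mult[OF symbol_family_param[of "{0<..}" "\<lambda>c. of_real c"] this]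
  have "symbol_family {0<..} (\<lambda>c \<xi>. norm (complex_of_real c) * (norm \<xi> * norm \<xi>))
      (\<lambda>c \<xi>::real^'d. of_real c * (\<Sum>i\<in>UNIV. of_real (\<xi> $ i) * of_real (\<xi> $ i)))" .
  then have "symbol_family {0<..} (\<lambda>c \<xi>. c * (norm \<xi>)\<^sup>2)
      (\<lambda>c \<xi>::real^'d. of_real c * (\<Sum>i\<in>UNIV. of_real (\<xi> $ i) * of_real (\<xi> $ i)))"
    by (rule symbol_family_mono[of _ _ _ 1]) (auto simp: power2_eq_square)
  moreover have "of_real ((norm \<xi>)\<^sup>2) = (\<Sum>i\<in>UNIV. complex_of_real (\<xi> $ i) * of_real (\<xi> $ i))" for \<xi> :: "real^'d"
    unfolding norm_vec_squared by (simp add: power2_eq_square)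
  ultimately show ?thesis
    by (simp only: of_real_mult)
qed

lemma symbol_family_gaussian:
  shows "symbol_family {0<..} (\<lambda>c \<xi>. 1 / (c * (norm \<xi>)\<^sup>2) ^ m) (gaussian :: real \<Rightarrow> real^'d::finite \<Rightarrow> complex)"
    and "symbol_family {0<..} (\<lambda>c \<xi>. c * (norm \<xi>)\<^sup>2) (\<lambda>c (\<xi>::real^'d). 1 - gaussian c \<xi>)"
proof -
  note * = symbol_family_exp_minus[OF symbol_family_norm_square]
  have eq: "exp (- of_real (c * (norm \<xi>)\<^sup>2)) = gaussian c \<xi>" for c and \<xi> :: "real^'d"
    by (simp add: gaussian_def exp_of_real[symmetric])
  show "symbol_family {0<..} (\<lambda>c \<xi>. 1 / (c * (norm \<xi>)\<^sup>2) ^ m) (gaussian :: real \<Rightarrow> real^'d \<Rightarrow> complex)"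
    by (rule symbol_family_cong[OF *(1)]) (auto simp only: eq greaterThan_iff zero_less_mult_iff zero_less_power2 norm_eq_zero)
  show "symbol_family {0<..} (\<lambda>c \<xi>. c * (norm \<xi>)\<^sup>2) (\<lambda>c (\<xi>::real^'d). 1 - gaussian c \<xi>)"
    by (rule symbol_family_cong[OF *(2)]) (auto simp only: eq greaterThan_iff zero_less_mult_iff zero_less_power2 norm_eq_zero)
qed

text \<open>The power makes 1 - \<open>lowpass\<close> vanish to order 2 L at the origin, while the
  binomial theorem still writes \<open>lowpass\<close> as a finite combination of Gaussians.\<close>

definition lowpass :: "nat \<Rightarrow> real^'d::finite \<Rightarrow> complex" where
  "lowpass L \<xi> = 1 - (1 - gaussian 1 \<xi>) ^ L"

text \<open>Evaluated at r \<xi> this is the difference of the low-pass symbols of scales r/2 and r,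
  so the bands of scales r, r/2, r/4, ... telescope.\<close>

definition bandpass :: "nat \<Rightarrow> real^'d::finite \<Rightarrow> complex" where
  "bandpass L \<xi> = lowpass L ((1 / 2) *\<^sub>R \<xi>) - lowpass L \<xi>"

lemma gaussian_scale: "gaussian c (r *\<^sub>R \<xi>) = gaussian (c * r\<^sup>2) \<xi>"
  by (simp add: gaussian_def power_mult_distrib mult.assoc)

lemma lowpass_measurable [measurable]: "lowpass L \<in> borel_measurable borel"
  unfolding lowpass_def[abs_def] by measurable

lemma bandpass_measurable [measurable]: "bandpass L \<in> borel_measurable borel"
  unfolding bandpass_def[abs_def] by measurable

lemma bandpass_zero: "0 < L \<Longrightarrow> bandpass L 0 = 0"
  by (simp add: bandpass_def)

lemma bandpass_minus: "bandpass L (- \<xi>) = bandpass L \<xi>"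
  by (simp add: bandpass_def lowpass_def gaussian_def)

lemma symbol_family_bandpass:
  shows "symbol_family {()} (\<lambda>_ \<xi>. norm \<xi> ^ (2 * L)) (\<lambda>_. bandpass L :: real^'d::finite \<Rightarrow> complex)"
    and "symbol_family {()} (\<lambda>_ \<xi>. 1 / norm \<xi> ^ (2 * m)) (\<lambda>_. bandpass L :: real^'d \<Rightarrow> complex)"
proof -
  have low: "symbol_family {()} (\<lambda>_ \<xi>. norm \<xi> ^ (2 * L)) (\<lambda>_ \<xi>::real^'d. (1 - gaussian c \<xi>) ^ L)"
    and high: "symbol_family {()} (\<lambda>_ \<xi>. 1 / norm \<xi> ^ (2 * m)) (\<lambda>_ \<xi>::real^'d. 1 - (1 - gaussian c \<xi>) ^ L)"
    \<comment> \<open>The two values needed are c = 1 and c = 1/4, from the two dilates in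
      \<open>bandpass\<close>.\<close>
    if c: "0 < c" "c \<le> 1" "1 \<le> 4 * c" for c :: real
  proof -
    note reparam = symbol_family_reparam[where \<sigma>="\<lambda>_. c" and A="{0<..}" and B="{()}"]
    have "symbol_family {()} (\<lambda>_ \<xi>. c * (norm \<xi>)\<^sup>2) (\<lambda>_ \<xi>::real^'d. 1 - gaussian c \<xi>)"
      by (rule reparam[OF symbol_family_gaussian(2)]) (use c in simp)
    then have "symbol_family {()} (\<lambda>_ \<xi>. (norm \<xi>)\<^sup>2) (\<lambda>_ \<xi>::real^'d. 1 - gaussian c \<xi>)"
      by (rule symbol_family_mono[of _ _ _ 1]) (use c in \<open>auto simp: mult_left_le_one_le\<close>)
    from symbol_family_power[OF this, of L]
    show "symbol_family {()} (\<lambda>_ \<xi>. norm \<xi> ^ (2 * L)) (\<lambda>_ \<xi>::real^'d. (1 - gaussian c \<xi>) ^ L)"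
      by (simp only: power_mult)
    have g: "symbol_family {()} (\<lambda>_ \<xi>. 1 / norm \<xi> ^ (2 * k)) (\<lambda>_. gaussian c :: real^'d \<Rightarrow> complex)" for k
    proof (rule symbol_family_mono[OF reparam[OF symbol_family_gaussian(1)[of k]], of "4 ^ k"])
      fix \<xi> :: "real^'d" assume "\<xi> \<noteq> 0"
      have "1 / (c * (norm \<xi>)\<^sup>2) ^ k = (1 / c) ^ k * (1 / norm \<xi> ^ (2 * k))"
        by (simp add: power_mult_distrib power_mult[symmetric] power_one_over)
      also have "\<dots> \<le> 4 ^ k * (1 / norm \<xi> ^ (2 * k))"
        using c by (intro mult_right_mono power_mono) (auto simp: field_simps)
      finally show "1 / (c * (norm \<xi>)\<^sup>2) ^ k \<le> 4 ^ k * (1 / norm \<xi> ^ (2 * k))" .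
    qed (use c in auto)
    have one: "symbol_family {()} (\<lambda>_ _. 1) (\<lambda>_ \<xi>::real^'d. 1 - gaussian c \<xi>)"
      using g[of 0] by (intro symbol_family_diff symbol_family_const) auto
    have pow: "symbol_family {()} (\<lambda>_ _. 1) (\<lambda>_ \<xi>::real^'d. (1 - gaussian c \<xi>) ^ i)" for i
      using symbol_family_power[OF one, of i] by simp
    \<comment> \<open>The factorisation 1 - t^L = (1 - t) (1 + t + ... + t^(L-1)) with t = 1 -
      \<open>gaussian\<close> c splits off a Gaussian, which supplies the decay.\<close>
    have "symbol_family {()} (\<lambda>_ \<xi>. 1 / norm \<xi> ^ (2 * m) * 1) (\<lambda>_ \<xi>::real^'d. gaussian c \<xi> * (\<Sum>i<L. (1 - gaussian c \<xi>) ^ i))"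
      by (intro symbol_family_mult g symbol_family_sum pow)
    then show "symbol_family {()} (\<lambda>_ \<xi>. 1 / norm \<xi> ^ (2 * m)) (\<lambda>_ \<xi>::real^'d. 1 - (1 - gaussian c \<xi>) ^ L)"
      by (simp add: one_diff_power_eq)
  qed
  have half: "gaussian 1 ((1 / 2) *\<^sub>R \<xi>) = gaussian (1 / 4) \<xi>" for \<xi> :: "real^'d"
    by (simp add: gaussian_scale power2_eq_square)
  have eq: "bandpass L = (\<lambda>\<xi>::real^'d. (1 - gaussian 1 \<xi>) ^ L - (1 - gaussian (1 / 4) \<xi>) ^ L)"
    "bandpass L = (\<lambda>\<xi>::real^'d. (1 - (1 - gaussian (1 / 4) \<xi>) ^ L) - (1 - (1 - gaussian 1 \<xi>) ^ L))"
    by (auto simp: bandpass_def lowpass_def half)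
  show "symbol_family {()} (\<lambda>_ \<xi>. norm \<xi> ^ (2 * L)) (\<lambda>_. bandpass L :: real^'d \<Rightarrow> complex)"
    unfolding eq(1) by (intro symbol_family_diff low) auto
  show "symbol_family {()} (\<lambda>_ \<xi>. 1 / norm \<xi> ^ (2 * m)) (\<lambda>_. bandpass L :: real^'d \<Rightarrow> complex)"
    unfolding eq(2) by (intro symbol_family_diff high) auto
qed

lemma symbol_family_bandpass_split:
  "symbol_family {()} (\<lambda>_. split_weight (2 * L) (2 * m)) (\<lambda>_. bandpass L :: real^'d::finite \<Rightarrow> complex)"
proof -
  have "symbol_family {()} (\<lambda>_ \<xi>. min (norm \<xi> ^ (2 * L)) (1 / norm \<xi> ^ (2 * m))) (\<lambda>_. bandpass L :: real^'d \<Rightarrow> complex)"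
    by (rule symbol_family_min[OF symbol_family_bandpass]) auto
  then show ?thesis
    by (rule symbol_family_mono[of _ _ _ 1]) (auto simp: split_weight_def)
qed

text \<open>Multiplication by this factor makes test functions out of symbols that are singular at the
  origin.\<close>

definition flat_cutoff :: "real \<Rightarrow> real^'d::finite \<Rightarrow> complex" where
  "flat_cutoff \<epsilon> \<xi> = (if \<xi> = 0 then 0 else exp (- of_real (\<epsilon> / (norm \<xi>)\<^sup>2)))"

lemma flat_cutoff_measurable [measurable]: "flat_cutoff \<epsilon> \<in> borel_measurable borel"
  unfolding flat_cutoff_def[abs_def] by measurable

lemma flat_cutoff_minus: "flat_cutoff \<epsilon> (- \<xi>) = flat_cutoff \<epsilon> \<xi>"
  by (simp add: flat_cutoff_def)

lemma symbol_family_flat_cutoff: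
  shows "symbol_family {0<..} (\<lambda>\<epsilon> \<xi>. 1 / (\<epsilon> / (norm \<xi>)\<^sup>2) ^ m) (flat_cutoff :: real \<Rightarrow> real^'d::finite \<Rightarrow> complex)"
    and "symbol_family {0<..} (\<lambda>\<epsilon> \<xi>. \<epsilon> / (norm \<xi>)\<^sup>2) (\<lambda>\<epsilon> (\<xi>::real^'d). 1 - flat_cutoff \<epsilon> \<xi>)"
proof -
  have "symbol_family {0<..} (\<lambda>c \<xi>. 1 / (c * (norm \<xi>)\<^sup>2)) (\<lambda>c \<xi>::real^'d. 1 / of_real (c * (norm \<xi>)\<^sup>2))"
    by (rule symbol_family_inverse[OF symbol_family_norm_square zero_less_one]) (auto simp: norm_mult norm_power)
  \<comment> \<open>With c = 1/\<epsilon> the reciprocal family becomes \<epsilon> / |\<xi>|^2, the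
    exponent in the cutoff.\<close>
  from symbol_family_reparam[OF this, of "{0<..}" "\<lambda>a. 1 / a"]
  have "symbol_family {0<..} (\<lambda>\<epsilon> \<xi>. \<epsilon> / (norm \<xi>)\<^sup>2) (\<lambda>\<epsilon> \<xi>::real^'d. of_real (\<epsilon> / (norm \<xi>)\<^sup>2))"
    by simp
  note * = symbol_family_exp_minus[OF this]
  show "symbol_family {0<..} (\<lambda>\<epsilon> \<xi>. 1 / (\<epsilon> / (norm \<xi>)\<^sup>2) ^ m) (flat_cutoff :: real \<Rightarrow> real^'d \<Rightarrow> complex)"
    by (rule symbol_family_cong[OF *(1)]) (auto simp: flat_cutoff_def)
  show "symbol_family {0<..} (\<lambda>\<epsilon> \<xi>. \<epsilon> / (norm \<xi>)\<^sup>2) (\<lambda>\<epsilon> (\<xi>::real^'d). 1 - flat_cutoff \<epsilon> \<xi>)"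
    by (rule symbol_family_cong[OF *(2)]) (auto simp: flat_cutoff_def)
qed

text \<open>The cutoff supplies every order of vanishing at the origin, the band-pass symbol every
  order of decay at infinity.\<close>

lemma flat_symbol_cutoff_bandpass:
  assumes \<epsilon>: "0 < \<epsilon>" and r: "0 < r"
  shows "flat_symbol (\<lambda>\<xi>::real^'d::finite. flat_cutoff \<epsilon> (r *\<^sub>R \<xi>) * bandpass L (r *\<^sub>R \<xi>))"
proof -
  define f where "f = (\<lambda>\<xi>::real^'d. flat_cutoff \<epsilon> \<xi> * bandpass L \<xi>)"
  have cut: "symbol_family {()} (\<lambda>_ \<xi>. norm \<xi> ^ (2 * m)) (\<lambda>_. flat_cutoff \<epsilon> :: real^'d \<Rightarrow> complex)" for m
  proof -
    have "symbol_family {()} (\<lambda>_ \<xi>. 1 / (\<epsilon> / (norm \<xi>)\<^sup>2) ^ m) (\<lambda>_. flat_cutoff \<epsilon> :: real^'d \<Rightarrow> complex)"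
      by (rule symbol_family_reparam[OF symbol_family_flat_cutoff(1), of _ "\<lambda>_. \<epsilon>"]) (use \<epsilon> in simp)
    then show ?thesis
      by (rule symbol_family_mono[of _ _ _ "1 / \<epsilon> ^ m"]) (use \<epsilon> in \<open>auto simp: power_divide power_mult\<close>)
  qed
  have band: "symbol_family {()} (\<lambda>_ \<xi>. 1 / norm \<xi> ^ (2 * m)) (\<lambda>_. bandpass L :: real^'d \<Rightarrow> complex)" for m
    by (rule symbol_family_bandpass(2))
  have prod: "symbol_family {()} (\<lambda>_ \<xi>. norm \<xi> ^ (2 * k) * (1 / norm \<xi> ^ (2 * m))) (\<lambda>_. f)" for k m
    unfolding f_def by (rule symbol_family_mult[OF cut band])
  \<comment> \<open>The factors have estimates with even exponents. An arbitrary exponent comes from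
    min(t^2, 1) \<le> t with t = |\<xi>|^a; at infinity the same is done with t = 1 /
    |\<xi>|^b.\<close>
  have zero: "symbol_family {()} (\<lambda>_ \<xi>. norm \<xi> ^ a) (\<lambda>_. f)" for a
  proof (rule symbol_family_mono[OF symbol_family_min[OF prod[of a 0] prod[of 0 0]], of 1])
    fix \<xi> :: "real^'d"
    show "min (norm \<xi> ^ (2 * a) * (1 / norm \<xi> ^ (2 * 0))) (norm \<xi> ^ (2 * 0) * (1 / norm \<xi> ^ (2 * 0))) \<le> 1 * norm \<xi> ^ a"
    proof (cases "norm \<xi> \<le> 1")
      case True
      then have "norm \<xi> ^ (2 * a) \<le> norm \<xi> ^ a" by (intro power_decreasing) auto
      then show ?thesis by simp
    next
      case False
      then have "1 \<le> norm \<xi> ^ a" by (intro one_le_power) auto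
      then show ?thesis by simp
    qed
  qed auto
  have infinity: "symbol_family {()} (\<lambda>_ \<xi>. 1 / norm \<xi> ^ b) (\<lambda>_. f)" for b
  proof (rule symbol_family_mono[OF symbol_family_min[OF prod[of 0 b] prod[of 0 0]], of 1])
    fix \<xi> :: "real^'d" assume "\<xi> \<noteq> 0"
    show "min (norm \<xi> ^ (2 * 0) * (1 / norm \<xi> ^ (2 * b))) (norm \<xi> ^ (2 * 0) * (1 / norm \<xi> ^ (2 * 0))) \<le> 1 * (1 / norm \<xi> ^ b)"
    proof (cases "norm \<xi> \<le> 1")
      case True
      then have "norm \<xi> ^ b \<le> 1" by (simp add: power_le_one)
      then show ?thesis using \<open>\<xi> \<noteq> 0\<close> by (simp add: min_le_iff_disj)
    next
      case False
      then have "norm \<xi> ^ b \<le> norm \<xi> ^ (2 * b)" by (intro power_increasing) auto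
      then show ?thesis using \<open>\<xi> \<noteq> 0\<close> by (simp add: min_le_iff_disj frac_le)
    qed
  qed auto
  have scale: "symbol_family {()} (\<lambda>_ \<xi>. w (r *\<^sub>R \<xi>)) (\<lambda>_ \<xi>. f (r *\<^sub>R \<xi>))" if "symbol_family {()} (\<lambda>_. w) (\<lambda>_. f)" for w
    by (rule symbol_family_reparam[OF symbol_family_scale[OF that], of _ "\<lambda>_. r"]) (use r in simp)
  have "flat_symbol (\<lambda>\<xi>. f (r *\<^sub>R \<xi>))"
  proof (rule flat_symbolI)
    show "f (r *\<^sub>R 0) = 0" by (simp add: f_def flat_cutoff_def)
    show "symbol_family {()} (\<lambda>_ \<xi>. norm \<xi> ^ a) (\<lambda>_ \<xi>. f (r *\<^sub>R \<xi>))" for a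
      by (rule symbol_family_mono[OF scale[OF zero[of a]], of "r ^ a"]) (use r in \<open>auto simp: power_mult_distrib\<close>)
    show "symbol_family {()} (\<lambda>_ \<xi>. 1 / norm \<xi> ^ b) (\<lambda>_ \<xi>. f (r *\<^sub>R \<xi>))" for b
      by (rule symbol_family_mono[OF scale[OF infinity[of b]], of "1 / r ^ b"]) (use r in \<open>auto simp: power_mult_distrib\<close>)
  qed
  then show ?thesis by (simp add: f_def)
qed

text \<open>Derivatives of an exponential gain no factor 1 / |\<xi>|, so measured as a symbol it
  appears to grow like |\<xi>|^n. This loss is harmless for flat symbols.\<close>

lemma symbol_bound_exp_inner:
  "\<exists>C\<ge>0. symbol_bound n (\<lambda>\<xi>. C / split_weight 0 n \<xi>) (\<lambda>\<xi>::real^'d::finite. exp (- \<i> * of_real (x \<bullet> \<xi>)))"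
proof (induction n)
  case 0
  then show ?case by (intro exI[of _ 1]) (auto simp: split_weight_def exp_minus norm_inverse)
next
  case (Suc n)
  then obtain C where C: "0 \<le> C" "symbol_bound n (\<lambda>\<xi>. C / split_weight 0 n \<xi>) (\<lambda>\<xi>. exp (- \<i> * of_real (x \<bullet> \<xi>)))"
    by blast
  define K where "K = max 1 (norm x * C)"
  have K0: "0 \<le> K" by (simp add: K_def le_max_iff_disj)
  have der: "((\<lambda>\<xi>. exp (- \<i> * of_real (x \<bullet> \<xi>))) has_derivative
      (\<lambda>v. (- \<i> * of_real (x \<bullet> v)) * exp (- \<i> * of_real (x \<bullet> \<xi>)))) (at \<xi>)" for \<xi>
  proof -
    have "((\<lambda>\<xi>. - \<i> * complex_of_real (x \<bullet> \<xi>)) has_derivative (\<lambda>v. - \<i> * of_real (x \<bullet> v))) (at \<xi>)"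
      by (auto intro!: derivative_eq_intros)
    from has_derivative_compose[OF this DERIV_exp[unfolded has_field_derivative_def]] show ?thesis
      by (simp add: mult.commute)
  qed
  have "symbol_bound (Suc n) (\<lambda>\<xi>. K / split_weight 0 (Suc n) \<xi>) (\<lambda>\<xi>. exp (- \<i> * of_real (x \<bullet> \<xi>)))"
    unfolding symbol_bound.simps(2)
  proof (intro conjI allI impI)
    fix \<xi> :: "real^'d" assume "\<xi> \<noteq> 0"
    have "1 * 1 \<le> K * (1 / split_weight 0 (Suc n) \<xi>)"
    proof (rule mult_mono)
      show "1 \<le> 1 / split_weight 0 (Suc n) \<xi>"
        by (auto simp: split_weight_def intro: one_le_power[of "norm \<xi>" "Suc n", simplified])
    qed (auto simp: K_def)
    then show "norm (exp (- \<i> * of_real (x \<bullet> \<xi>))) \<le> K / split_weight 0 (Suc n) \<xi>"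
      by (simp add: exp_minus norm_inverse)
    show "(\<lambda>\<xi>. exp (- \<i> * of_real (x \<bullet> \<xi>))) differentiable at \<xi>"
      using der by (auto simp: differentiable_def)
  next
    fix i :: 'd
    have "symbol_bound n (\<lambda>\<xi>. norm (- \<i> * of_real (x $ i)) * (C / split_weight 0 n \<xi>))
        (\<lambda>\<xi>. (- \<i> * of_real (x $ i)) * exp (- \<i> * of_real (x \<bullet> \<xi>)))"
      by (rule symbol_bound_cmult[OF C(2)])
    then have "symbol_bound n (\<lambda>\<xi>. K / split_weight 0 (Suc n) \<xi> / norm \<xi>)
        (\<lambda>\<xi>. (- \<i> * of_real (x $ i)) * exp (- \<i> * of_real (x \<bullet> \<xi>)))"
    proof (rule symbol_bound_mono)
      fix \<xi> :: "real^'d" assume "\<xi> \<noteq> 0"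
      have "norm (- \<i> * of_real (x $ i)) * C \<le> norm x * C"
        using component_le_norm_cart[of x i] C(1) by (intro mult_right_mono) (auto simp: norm_mult)
      also have "\<dots> \<le> K" by (simp add: K_def)
      finally have "norm (- \<i> * of_real (x $ i)) * C * (1 / split_weight 0 n \<xi>) \<le> K * (1 / split_weight 0 (Suc n) \<xi> / norm \<xi>)"
      proof (rule mult_mono)
        show "1 / split_weight 0 n \<xi> \<le> 1 / split_weight 0 (Suc n) \<xi> / norm \<xi>"
          using \<open>\<xi> \<noteq> 0\<close> by (auto simp: split_weight_def)
      qed (auto simp: K0 split_weight_nonneg)
      then show "norm (- \<i> * of_real (x $ i)) * (C / split_weight 0 n \<xi>) \<le> K / split_weight 0 (Suc n) \<xi> / norm \<xi>"
        by simp
    qed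
    then show "symbol_bound n (\<lambda>\<xi>. K / split_weight 0 (Suc n) \<xi> / norm \<xi>) (partial_deriv i (\<lambda>\<xi>. exp (- \<i> * of_real (x \<bullet> \<xi>))))"
      by (rule symbol_bound_cong) (simp only: partial_deriv_eq[OF der] inner_axis, simp)
  qed
  with K0 show ?case by blast
qed

section \<open>Convolution form of the equation on a frequency band\<close>

lemma fourier_integral_measurable [measurable]:
  fixes g :: "real^'d::finite \<Rightarrow> complex"
  assumes [measurable]: "g \<in> borel_measurable borel"
  shows "fourier_integral g \<in> borel_measurable borel"
  unfolding fourier_integral_def[abs_def] by measurable

lemma inverse_fourier_measurable [measurable]:
  fixes g :: "real^'d::finite \<Rightarrow> complex"
  assumes [measurable]: "g \<in> borel_measurable borel"
  shows "inverse_fourier g \<in> borel_measurable borel"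
proof -
  have "inverse_fourier g = (\<lambda>x. of_real (1 / (2 * pi) ^ CARD('d)) * fourier_integral g x)"
    by (rule ext) (rule inverse_fourier_eq[OF assms])
  then show ?thesis by simp
qed

lemma fourier_integral_scale:
  assumes "0 < r"
  shows "fourier_integral (\<lambda>\<xi>. f (r *\<^sub>R \<xi>)) (x::real^'d::finite)
    = (1 / r ^ CARD('d)) *\<^sub>R fourier_integral f ((1 / r) *\<^sub>R x)"
  unfolding fourier_integral_def
  by (subst lborel_integral_affine[of r "\<lambda>\<xi>. exp (\<i> * complex_of_real ((1 / r) *\<^sub>R x \<bullet> \<xi>)) * f \<xi>" 0])
    (use assms in \<open>auto simp: inverse_eq_divide\<close>)

text \<open>Modulating and reflecting the symbol yields the function y -> k(x - y), the test
  function that turns the distributional equation into a convolution identity at the point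
  x.\<close>

lemma fourier_integral_modulate:
  "fourier_integral (\<lambda>\<xi>. exp (- \<i> * of_real (x \<bullet> \<xi>)) * f (- \<xi>)) y = fourier_integral f (x - y)"
proof -
  have "fourier_integral f (x - y) = (LINT \<xi>|lborel. exp (\<i> * of_real ((x - y) \<bullet> (- \<xi>))) * f (- \<xi>))"
    unfolding fourier_integral_def
    by (subst lborel_integral_affine[of "-1" _ 0]) auto
  moreover have "exp (\<i> * complex_of_real ((x - y) \<bullet> (- \<xi>))) = exp (\<i> * of_real (y \<bullet> \<xi>)) * exp (- \<i> * of_real (x \<bullet> \<xi>))" for \<xi>
    by (simp add: exp_add[symmetric] inner_diff_left algebra_simps)
  ultimately show ?thesis
    by (simp add: fourier_integral_def mult.assoc)
qed

text \<open>The exponents are those of \<open>fourier_integral_decay\<close> with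
  \<open>m = CARD('d)\<close>. The parameter enters the kernel bound only through the factor w
  a.\<close>

lemma symbol_family_fourier_integral:
  fixes f :: "'a \<Rightarrow> real^'d::finite \<Rightarrow> complex"
  assumes f: "symbol_family A (\<lambda>a \<xi>. w a * split_weight (2 * CARD('d) + 2) (2 * CARD('d)) \<xi>) f"
    and zero: "\<And>a. a \<in> A \<Longrightarrow> f a 0 = 0"
  shows "\<exists>C\<ge>0. \<forall>a\<in>A. \<forall>x. norm (fourier_integral (f a) x) \<le> C * w a * envelope x"
proof -
  obtain C where C: "0 \<le> C" "\<And>a. a \<in> A \<Longrightarrow>
      symbol_bound (Suc (2 * CARD('d))) (\<lambda>\<xi>. C * (w a * split_weight (2 * CARD('d) + 2) (2 * CARD('d)) \<xi>)) (f a)"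
    using symbol_familyE[OF f, where n="Suc (2 * CARD('d))"] by blast
  have "norm (fourier_integral (f a) x) \<le> (C * decay_const TYPE('d) CARD('d)) * w a * envelope x" if a: "a \<in> A" for a x
  proof -
    have "symbol_bound (Suc (2 * CARD('d))) (\<lambda>\<xi>. C * w a * split_weight (2 * CARD('d) + 2) (2 * CARD('d)) \<xi>) (f a)"
      using C(2)[OF a] by (simp only: mult.assoc)
    from fourier_integral_decay[OF this zero[OF a], of x]
    have "(1 + (norm x)\<^sup>2) ^ CARD('d) * norm (fourier_integral (f a) x) \<le> C * w a * decay_const TYPE('d) CARD('d)" .
    moreover have "0 < (1 + (norm x)\<^sup>2) ^ CARD('d)" by (simp add: add_pos_nonneg)
    ultimately show ?thesis by (simp add: envelope_def field_simps)
  qed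
  then show ?thesis
    using C(1) by (intro exI[of _ "C * decay_const TYPE('d) CARD('d)"]) (auto simp: decay_const_nonneg)
qed

lemma scaled_envelope:
  assumes "0 < r"
  shows "integrable lborel (\<lambda>x::real^'d::finite. envelope ((1 / r) *\<^sub>R x))"
    and "(LINT x::real^'d|lborel. envelope ((1 / r) *\<^sub>R x)) = r ^ CARD('d) * envelope_mass TYPE('d)"
proof -
  show "integrable lborel (\<lambda>x::real^'d. envelope ((1 / r) *\<^sub>R x))"
    using lborel_integrable_affine[OF _ envelope_integrable, of "1 / r" 0] assms by simp
  show "(LINT x::real^'d|lborel. envelope ((1 / r) *\<^sub>R x)) = r ^ CARD('d) * envelope_mass TYPE('d)"
    using lborel_integral_affine[of "1 / r" "envelope :: real^'d \<Rightarrow> real" 0] assms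
    by (simp add: envelope_mass_def field_simps power_one_over)
qed

text \<open>Dilating the symbol rescales the kernel without changing its L^1 norm, so the last bound
  is free of r.\<close>

lemma inverse_fourier_scaled_bound:
  fixes g :: "real^'d::finite \<Rightarrow> complex"
  assumes g [measurable]: "g \<in> borel_measurable borel" and r: "0 < r"
    and bound: "\<And>x. norm (fourier_integral g x) \<le> D * envelope x"
  defines "k \<equiv> inverse_fourier (\<lambda>\<xi>. g (r *\<^sub>R \<xi>))"
  shows "norm (k x) \<le> D / (2 * pi * r) ^ CARD('d) * envelope ((1 / r) *\<^sub>R x)"
    and "integrable lborel k"
    and "(LINT x|lborel. norm (k x)) \<le> D * envelope_mass TYPE('d) / (2 * pi) ^ CARD('d)"
proof -
  have k_meas [measurable]: "k \<in> borel_measurable borel"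
    unfolding k_def by measurable
  have k_eq: "k x = of_real (1 / (2 * pi) ^ CARD('d)) * ((1 / r ^ CARD('d)) *\<^sub>R fourier_integral g ((1 / r) *\<^sub>R x))" for x
    unfolding k_def by (subst inverse_fourier_eq) (simp_all only: fourier_integral_scale[OF r], measurable)
  show k_le: "norm (k x) \<le> D / (2 * pi * r) ^ CARD('d) * envelope ((1 / r) *\<^sub>R x)" for x
  proof -
    have "norm (k x) = norm (fourier_integral g ((1 / r) *\<^sub>R x)) * (1 / (2 * pi * r) ^ CARD('d))"
      unfolding k_eq norm_mult norm_scaleR norm_of_real using r by (simp add: power_mult_distrib)
    also have "\<dots> \<le> D * envelope ((1 / r) *\<^sub>R x) * (1 / (2 * pi * r) ^ CARD('d))"
      by (intro mult_right_mono bound) (use r in simp)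
    finally show ?thesis by simp
  qed
  show int: "integrable lborel k"
  proof (rule Bochner_Integration.integrable_bound)
    show "integrable lborel (\<lambda>x::real^'d. D / (2 * pi * r) ^ CARD('d) * envelope ((1 / r) *\<^sub>R x))"
      by (rule integrable_mult_right) (rule scaled_envelope(1)[OF r])
    show "AE x in lborel. norm (k x) \<le> norm (D / (2 * pi * r) ^ CARD('d) * envelope ((1 / r) *\<^sub>R x))"
      by (intro AE_I2 order_trans[OF k_le]) (simp only: real_norm_def abs_ge_self)
  qed measurable
  have "(LINT x|lborel. norm (k x)) \<le> (LINT x::real^'d|lborel. D / (2 * pi * r) ^ CARD('d) * envelope ((1 / r) *\<^sub>R x))"
  proof (rule Bochner_Integration.integral_mono)
    show "integrable lborel (\<lambda>x. norm (k x))" using int by simp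
    show "integrable lborel (\<lambda>x::real^'d. D / (2 * pi * r) ^ CARD('d) * envelope ((1 / r) *\<^sub>R x))"
      by (rule integrable_mult_right) (rule scaled_envelope(1)[OF r])
  qed (rule k_le)
  also have "\<dots> = D * envelope_mass TYPE('d) / (2 * pi) ^ CARD('d)"
    using r by (simp add: scaled_envelope(2)[OF r] power_mult_distrib)
  finally show "(LINT x|lborel. norm (k x)) \<le> D * envelope_mass TYPE('d) / (2 * pi) ^ CARD('d)" .
qed

lemma integrable_reflect:
  fixes k :: "'a::euclidean_space \<Rightarrow> 'b::{banach, second_countable_topology}"
  shows "integrable lborel k \<Longrightarrow> integrable lborel (\<lambda>y. k (x - y))"
  using lborel_integrable_affine[of "-1" k x] by simp

lemma integral_reflect:
  fixes k :: "'a::euclidean_space \<Rightarrow> 'b::{banach, second_countable_topology}"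
  shows "(LINT y|lborel. k (x - y)) = (LINT y|lborel. k y)"
  using lborel_integral_affine[of "-1" k x] by simp

lemma integrable_bounded_mult:
  fixes u k :: "'a \<Rightarrow> complex"
  assumes [measurable]: "u \<in> borel_measurable M" and "\<And>y. norm (u y) \<le> B" and k: "integrable M k"
  shows "integrable M (\<lambda>y. u y * k y)"
proof (rule Bochner_Integration.integrable_bound)
  show "integrable M (\<lambda>y. B * norm (k y))" using k by simp
  show "(\<lambda>y. u y * k y) \<in> borel_measurable M" using k by measurable
  show "AE y in M. norm (u y * k y) \<le> norm (B * norm (k y))"
  proof (rule AE_I2)
    fix y
    have "norm (u y * k y) \<le> B * norm (k y)"
      unfolding norm_mult using assms(2) by (intro mult_right_mono) auto
    then show "norm (u y * k y) \<le> norm (B * norm (k y))" by simp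
  qed
qed

text \<open>Removal of the cutoff. Since 1 - \<open>flat_cutoff\<close> \<epsilon> is of size
  \<epsilon> / |\<xi>|^2, two orders of vanishing beyond those required for an integrable kernel
  make the difference of the kernels at most \<epsilon> times a fixed integrable function.\<close>

lemma cutoff_convolution_tendsto:
  fixes g u :: "real^'d::finite \<Rightarrow> complex"
  assumes g_meas [measurable]: "g \<in> borel_measurable borel" and g0: "g 0 = 0"
    and g: "symbol_family {()} (\<lambda>_. split_weight (2 * CARD('d) + 4) (2 * CARD('d))) (\<lambda>_. g)"
    and r: "0 < r" and u_meas [measurable]: "u \<in> borel_measurable borel" and u: "\<And>x. norm (u x) \<le> B"
  shows "(\<lambda>n. LINT y|lborel. u y * inverse_fourier (\<lambda>\<xi>. flat_cutoff (1 / real (Suc n)) (r *\<^sub>R \<xi>) * g (r *\<^sub>R \<xi>)) (x - y))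
    \<longlonglongrightarrow> (LINT y|lborel. u y * inverse_fourier (\<lambda>\<xi>. g (r *\<^sub>R \<xi>)) (x - y))"
proof -
  define \<epsilon> :: "nat \<Rightarrow> real" where "\<epsilon> n = 1 / real (Suc n)" for n
  have \<epsilon>_pos: "0 < \<epsilon> n" and \<epsilon>_le: "\<epsilon> n \<le> 1" for n by (auto simp: \<epsilon>_def)
  have \<epsilon>_lim: "\<epsilon> \<longlonglongrightarrow> 0" unfolding \<epsilon>_def by (rule LIMSEQ_Suc[OF lim_1_over_n])
  obtain G where G: "\<And>\<xi>. norm (g \<xi>) \<le> G * envelope \<xi>"
  proof -
    obtain C where "\<And>u. u \<in> {()} \<Longrightarrow> symbol_bound 0 (\<lambda>\<xi>. C * split_weight (2 * CARD('d) + 4) (2 * CARD('d)) \<xi>) g"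
      using symbol_familyE[OF g, where n=0] by blast
    then have "symbol_bound 0 (\<lambda>\<xi>. C * split_weight (Suc (2 * CARD('d) + 3)) (2 * CARD('d)) \<xi>) g"
      by (simp add: eval_nat_numeral)
    from symbol_bound_envelope[OF this g0] show ?thesis by (rule that)
  qed
  have cut_le: "norm (flat_cutoff (\<epsilon> n) \<xi>) \<le> 1" for n and \<xi> :: "real^'d"
    using \<epsilon>_pos[of n] by (simp add: flat_cutoff_def)
  have int_g: "integrable lborel g" by (rule integrable_envelope_bound[OF g_meas G])
  have "symbol_family {0<..} (\<lambda>\<epsilon> \<xi>. \<epsilon> / (norm \<xi>)\<^sup>2 * split_weight (2 * CARD('d) + 4) (2 * CARD('d)) \<xi>)
      (\<lambda>\<epsilon> \<xi>. (1 - flat_cutoff \<epsilon> \<xi>) * g \<xi>)"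
    by (intro symbol_family_mult symbol_family_flat_cutoff(2) symbol_family_reparam[OF g]) simp
  then have "symbol_family {0<..} (\<lambda>\<epsilon> \<xi>. \<epsilon> * split_weight (2 * CARD('d) + 2) (2 * CARD('d)) \<xi>)
      (\<lambda>\<epsilon> \<xi>. (1 - flat_cutoff \<epsilon> \<xi>) * g \<xi>)"
  proof (rule symbol_family_mono[of _ _ _ 1])
    fix \<epsilon> :: real and \<xi> :: "real^'d" assume "\<epsilon> \<in> {0<..}" "\<xi> \<noteq> 0"
    have "split_weight 2 0 \<xi> \<le> (norm \<xi>)\<^sup>2"
      by (auto simp: split_weight_def intro: one_le_power)
    then have "\<epsilon> / (norm \<xi>)\<^sup>2 \<le> \<epsilon> / split_weight 2 0 \<xi>"
      using split_weight_pos[OF \<open>\<xi> \<noteq> 0\<close>, of 2 0] \<open>\<epsilon> \<in> {0<..}\<close> \<open>\<xi> \<noteq> 0\<close>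
      by (intro divide_left_mono) auto
    from mult_right_mono[OF this split_weight_nonneg]
    have "\<epsilon> / (norm \<xi>)\<^sup>2 * split_weight (2 * CARD('d) + 4) (2 * CARD('d)) \<xi>
        \<le> \<epsilon> / split_weight 2 0 \<xi> * split_weight (2 * CARD('d) + 4) (2 * CARD('d)) \<xi>" .
    also have "\<dots> = 1 * (\<epsilon> * split_weight (2 * CARD('d) + 2) (2 * CARD('d)) \<xi>)"
    proof -
      have "2 + (2 * CARD('d) + 2) = 2 * CARD('d) + 4" by simp
      then have "split_weight (2 * CARD('d) + 4) (2 * CARD('d)) \<xi> = split_weight 2 0 \<xi> * split_weight (2 * CARD('d) + 2) (2 * CARD('d)) \<xi>"
        by (simp only: split_weight_mult add_0)
      with split_weight_pos[OF \<open>\<xi> \<noteq> 0\<close>, of 2 0] show ?thesis by simp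
    qed
    finally show "\<epsilon> / (norm \<xi>)\<^sup>2 * split_weight (2 * CARD('d) + 4) (2 * CARD('d)) \<xi>
        \<le> 1 * (\<epsilon> * split_weight (2 * CARD('d) + 2) (2 * CARD('d)) \<xi>)" .
  qed auto
  from symbol_family_fourier_integral[OF this] g0
  obtain C where C: "0 \<le> C" "\<And>\<epsilon> x. 0 < \<epsilon> \<Longrightarrow> norm (fourier_integral (\<lambda>\<xi>. (1 - flat_cutoff \<epsilon> \<xi>) * g \<xi>) x) \<le> C * \<epsilon> * envelope x"
    by auto
  have "symbol_family {()} (\<lambda>_ \<xi>. 1 * split_weight (2 * CARD('d) + 2) (2 * CARD('d)) \<xi>) (\<lambda>_. g)"
    by (rule symbol_family_mono[OF g, of 1]) (simp_all add: split_weight_antimono)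
  from symbol_family_fourier_integral[OF this] g0
  obtain D where D: "0 \<le> D" "\<And>x. norm (fourier_integral g x) \<le> D * envelope x"
    by auto
  define k where "k = inverse_fourier (\<lambda>\<xi>. g (r *\<^sub>R \<xi>))"
  define kn where "kn n = inverse_fourier (\<lambda>\<xi>. flat_cutoff (\<epsilon> n) (r *\<^sub>R \<xi>) * g (r *\<^sub>R \<xi>))" for n
  define E where "E y = C / (2 * pi * r) ^ CARD('d) * envelope ((1 / r) *\<^sub>R y)" for y :: "real^'d"
  have int_k: "integrable lborel k"
    unfolding k_def by (rule inverse_fourier_scaled_bound(2)[OF g_meas r D(2)])
  have int_E: "integrable lborel E"
    unfolding E_def by (intro integrable_mult_right scaled_envelope(1)[OF r])
  have diff: "norm (k y - kn n y) \<le> \<epsilon> n * E y" for n y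
  proof -
    have int_gr: "integrable lborel (\<lambda>\<xi>. exp (\<i> * of_real (y \<bullet> \<xi>)) * g (r *\<^sub>R \<xi>))"
      using lborel_integrable_affine[OF _ int_g, of r 0] r
      by (intro integrable_bounded_mult[of _ _ 1]) auto
    have int_cgr: "integrable lborel (\<lambda>\<xi>. exp (\<i> * of_real (y \<bullet> \<xi>)) * (flat_cutoff (\<epsilon> n) (r *\<^sub>R \<xi>) * g (r *\<^sub>R \<xi>)))"
      using lborel_integrable_affine[OF _ int_g, of r 0] r
      by (intro integrable_bounded_mult[of _ _ 1] integrable_bounded_mult[of "\<lambda>\<xi>. flat_cutoff (\<epsilon> n) (r *\<^sub>R \<xi>)" _ 1] cut_le) auto
    have "k y - kn n y = inverse_fourier (\<lambda>\<xi>. (\<lambda>\<xi>. (1 - flat_cutoff (\<epsilon> n) \<xi>) * g \<xi>) (r *\<^sub>R \<xi>)) y"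
    proof -
      have m: "(\<lambda>\<xi>. g (r *\<^sub>R \<xi>)) \<in> borel_measurable borel"
        "(\<lambda>\<xi>. flat_cutoff (\<epsilon> n) (r *\<^sub>R \<xi>) * g (r *\<^sub>R \<xi>)) \<in> borel_measurable borel"
        "(\<lambda>\<xi>. (1 - flat_cutoff (\<epsilon> n) (r *\<^sub>R \<xi>)) * g (r *\<^sub>R \<xi>)) \<in> borel_measurable borel"
        by measurable
      have eq: "exp (\<i> * of_real (y \<bullet> \<xi>)) * ((1 - flat_cutoff (\<epsilon> n) (r *\<^sub>R \<xi>)) * g (r *\<^sub>R \<xi>))
          = exp (\<i> * of_real (y \<bullet> \<xi>)) * g (r *\<^sub>R \<xi>)
            - exp (\<i> * of_real (y \<bullet> \<xi>)) * (flat_cutoff (\<epsilon> n) (r *\<^sub>R \<xi>) * g (r *\<^sub>R \<xi>))" for \<xi>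
        by (simp only: left_diff_distrib right_diff_distrib mult_1_left)
      show ?thesis
        unfolding k_def kn_def inverse_fourier_eq[OF m(1)] inverse_fourier_eq[OF m(2)] inverse_fourier_eq[OF m(3)]
          fourier_integral_def eq Bochner_Integration.integral_diff[OF int_gr int_cgr]
        by (rule right_diff_distrib[symmetric])
    qed
    also have "norm \<dots> \<le> C * \<epsilon> n / (2 * pi * r) ^ CARD('d) * envelope ((1 / r) *\<^sub>R y)"
      by (rule inverse_fourier_scaled_bound(1)[OF _ r C(2)[OF \<epsilon>_pos]]) measurable
    finally show ?thesis by (simp add: E_def mult_ac)
  qed
  have "(\<lambda>n. LINT y|lborel. u y * kn n (x - y)) \<longlonglongrightarrow> (LINT y|lborel. u y * k (x - y))"
  proof (rule integral_dominated_convergence[where w="\<lambda>y. B * (norm (k (x - y)) + E (x - y))"])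
    have km [measurable]: "k \<in> borel_measurable borel" "kn n \<in> borel_measurable borel" for n
      unfolding k_def kn_def by measurable
    show "(\<lambda>y. u y * k (x - y)) \<in> borel_measurable lborel" "(\<lambda>y. u y * kn n (x - y)) \<in> borel_measurable lborel" for n
      by measurable
    show "integrable lborel (\<lambda>y. B * (norm (k (x - y)) + E (x - y)))"
      using int_k int_E by (intro integrable_mult_right Bochner_Integration.integrable_add integrable_norm integrable_reflect)
    show "AE y in lborel. (\<lambda>n. u y * kn n (x - y)) \<longlonglongrightarrow> u y * k (x - y)"
    proof (intro AE_I2 tendsto_intros)
      fix y
      have "(\<lambda>n. \<epsilon> n * E (x - y)) \<longlonglongrightarrow> 0"
        using tendsto_mult_left_zero[OF \<epsilon>_lim] by simp
      then have "(\<lambda>n. kn n (x - y) - k (x - y)) \<longlonglongrightarrow> 0"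
        by (rule Lim_null_comparison[rotated]) (use diff in \<open>auto simp: norm_minus_commute\<close>)
      then show "(\<lambda>n. kn n (x - y)) \<longlonglongrightarrow> k (x - y)"
        by (simp only: LIM_zero_iff)
    qed
    show "AE y in lborel. norm (u y * kn n (x - y)) \<le> B * (norm (k (x - y)) + E (x - y))" for n
    proof (rule AE_I2)
      fix y
      have "0 \<le> E (x - y)" using C(1) r by (simp add: E_def less_imp_le[OF envelope_pos])
      then have "\<epsilon> n * E (x - y) \<le> E (x - y)" using \<epsilon>_le[of n] \<epsilon>_pos[of n] by (simp add: mult_left_le_one_le)
      then have "norm (kn n (x - y)) \<le> norm (k (x - y)) + E (x - y)"
        using diff[of "x - y" n] norm_triangle_ineq2[of "kn n (x - y)" "k (x - y)"] by (simp add: norm_minus_commute)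
      then show "norm (u y * kn n (x - y)) \<le> B * (norm (k (x - y)) + E (x - y))"
        unfolding norm_mult using u[of y] order_trans[OF norm_ge_zero u[of y]] by (intro mult_mono) auto
    qed
  qed
  then show ?thesis by (simp only: k_def kn_def \<epsilon>_def)
qed

section \<open>The inverse multiplier on one frequency band\<close>

lemma japanese_bracket_ge: "1 \<le> japanese_bracket x" "norm x \<le> japanese_bracket x"
  by (simp_all add: japanese_bracket_def real_le_rsqrt)

text \<open>With \<theta> = min M 1 the bracket of \<xi>/r to the power -M is at most r^\<theta>
  |\<xi>|^(-\<theta>). The first factor is the gain for small r. As \<theta> \<le> 1, the second
  costs at most one order of vanishing at the origin and is bounded at infinity.\<close>

lemma symbol_family_scaled_multiplier:
  fixes q :: "real^'d::finite \<Rightarrow> complex"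
  assumes q: "symbol_family {()} (\<lambda>_ \<xi>. japanese_bracket \<xi> powr (- M)) (\<lambda>_. q)" and M: "0 < M"
  shows "symbol_family {0<..1} (\<lambda>r \<xi>. r powr min M 1 * (1 / split_weight 1 0 \<xi>)) (\<lambda>r \<xi>. q ((1 / r) *\<^sub>R \<xi>))"
proof (rule symbol_family_mono[OF symbol_family_reparam[OF symbol_family_scale[OF q], of "{0<..1}" "\<lambda>r. 1 / r"], of 1])
  fix r :: real and \<xi> :: "real^'d" assume r: "r \<in> {0<..1}" and \<xi>: "\<xi> \<noteq> 0"
  define \<theta> where "\<theta> = min M 1"
  have \<theta>: "0 < \<theta>" "\<theta> \<le> M" "\<theta> \<le> 1" using M by (auto simp: \<theta>_def)
  define \<eta> where "\<eta> = (1 / r) *\<^sub>R \<xi>"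
  have norm_\<eta>: "norm \<eta> = norm \<xi> / r" "0 < norm \<eta>" using r \<xi> by (auto simp: \<eta>_def)
  have "japanese_bracket \<eta> powr (- M) \<le> japanese_bracket \<eta> powr (- \<theta>)"
    using \<theta> japanese_bracket_ge(1)[of \<eta>] by (intro powr_mono) auto
  also have "\<dots> \<le> norm \<eta> powr (- \<theta>)"
    using \<theta> japanese_bracket_ge(2)[of \<eta>] norm_\<eta>(2) by (intro powr_mono2') auto
  also have "\<dots> = r powr \<theta> * norm \<xi> powr (- \<theta>)"
    using r \<xi> by (simp add: norm_\<eta> powr_divide powr_minus field_simps)
  also have "\<dots> \<le> r powr \<theta> * (1 / split_weight 1 0 \<xi>)"
  proof (rule mult_left_mono)
    show "norm \<xi> powr (- \<theta>) \<le> 1 / split_weight 1 0 \<xi>"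
    proof (cases "norm \<xi> \<le> 1")
      case True
      then have "norm \<xi> powr (- \<theta>) \<le> norm \<xi> powr (- 1)"
        using \<theta> by (intro powr_mono') auto
      then show ?thesis using True \<xi> by (simp add: split_weight_def powr_minus inverse_eq_divide)
    next
      case False
      then have "norm \<xi> powr (- \<theta>) \<le> norm \<xi> powr 0"
        using \<theta> by (intro powr_mono) auto
      then show ?thesis using False \<xi> by (simp add: split_weight_def)
    qed
  qed simp
  finally show "japanese_bracket ((1 / r) *\<^sub>R \<xi>) powr (- M) \<le> 1 * (r powr min M 1 * (1 / split_weight 1 0 \<xi>))"
    by (simp add: \<eta>_def \<theta>_def)
qed auto

text \<open>The equation is tested with the function whose transform is exp(-i x \<bullet> \<xi>)
  q(-\<xi>) h(\<xi>). Applying p(-D) cancels q, so one side convolves u with the kernel of h and the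
  other convolves F(u) with the kernel of q h.\<close>

lemma band_identity_cutoff:
  fixes p q u :: "real^'d::finite \<Rightarrow> complex" and F :: "complex \<Rightarrow> complex" and L :: nat
  assumes q: "symbol_family {()} (\<lambda>_ \<xi>. japanese_bracket \<xi> powr (- M)) (\<lambda>_. q)" and M: "0 < M"
    and q_meas [measurable]: "q \<in> borel_measurable borel" and pq: "\<And>\<xi>. p \<xi> * q \<xi> = 1"
    and u_meas [measurable]: "u \<in> borel_measurable borel"
    and Fu_meas [measurable]: "(\<lambda>x. F (u x)) \<in> borel_measurable borel"
    and sol: "distribution_solution p F u"
    and r: "0 < r" and \<epsilon>: "0 < \<epsilon>"
  defines "h \<equiv> \<lambda>\<xi>. flat_cutoff \<epsilon> (r *\<^sub>R \<xi>) * bandpass L (r *\<^sub>R \<xi>)"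
  shows "(LINT y|lborel. u y * inverse_fourier h (x - y)) = (LINT y|lborel. F (u y) * inverse_fourier (\<lambda>\<xi>. q \<xi> * h \<xi>) (x - y))"
proof -
  have h_meas [measurable]: "h \<in> borel_measurable borel"
    unfolding h_def by measurable
  \<comment> \<open>Evenness allows h(\<xi>) to be read as h(-\<xi>), the form required by
    \<open>fourier_integral_modulate\<close>.\<close>
  have h_even: "h (- \<xi>) = h \<xi>" for \<xi>
    using flat_cutoff_minus[of \<epsilon> "r *\<^sub>R \<xi>"] bandpass_minus[of L "r *\<^sub>R \<xi>"] by (simp add: h_def)
  define f where "f \<xi> = exp (- \<i> * of_real (x \<bullet> \<xi>)) * (q (- \<xi>) * h \<xi>)" for \<xi>
  have q_bound: "\<exists>C k l. symbol_bound n (\<lambda>\<xi>. C / split_weight k l \<xi>) (\<lambda>\<xi>. q (- \<xi>))" for n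
  proof -
    obtain C where C: "0 \<le> C" "\<And>a. a \<in> {()} \<Longrightarrow> symbol_bound n (\<lambda>\<xi>. C * japanese_bracket \<xi> powr (- M)) q"
      using symbol_familyE[OF q, where n=n] by blast
    \<comment> \<open>Reflection is the dilation by -1.\<close>
    have "symbol_bound n (\<lambda>\<xi>. C * japanese_bracket ((- 1) *\<^sub>R \<xi>) powr (- M)) (\<lambda>\<xi>. q ((- 1) *\<^sub>R \<xi>))"
      by (rule symbol_bound_scale[OF _ C(2)]) auto
    then have "symbol_bound n (\<lambda>\<xi>. C / split_weight 0 0 \<xi>) (\<lambda>\<xi>. q ((- 1) *\<^sub>R \<xi>))"
    proof (rule symbol_bound_mono)
      fix \<xi> :: "real^'d"
      have "japanese_bracket ((- 1) *\<^sub>R \<xi>) powr (- M) \<le> japanese_bracket ((- 1) *\<^sub>R \<xi>) powr 0"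
        using japanese_bracket_ge(1)[of "(- 1) *\<^sub>R \<xi>"] M by (intro powr_mono) auto
      also have "\<dots> \<le> 1" using japanese_bracket_ge(1)[of "(- 1) *\<^sub>R \<xi>"] by simp
      finally show "C * japanese_bracket ((- 1) *\<^sub>R \<xi>) powr (- M) \<le> C / split_weight 0 0 \<xi>"
        using C(1) by (simp add: split_weight_def mult_left_le)
    qed
    then show ?thesis by auto
  qed
  have exp_bound: "\<exists>C k l. symbol_bound n (\<lambda>\<xi>. C / split_weight k l \<xi>) (\<lambda>\<xi>. exp (- \<i> * of_real (x \<bullet> \<xi>)))" for n
    using symbol_bound_exp_inner[of n x] by blast
  have "flat_symbol h"
    unfolding h_def by (rule flat_symbol_cutoff_bandpass[OF \<epsilon> r])
  then have flat: "flat_symbol f"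
    unfolding f_def by (intro flat_symbol_mult q_bound exp_bound)
  have 1: "inverse_fourier f y = inverse_fourier (\<lambda>\<xi>. q \<xi> * h \<xi>) (x - y)" for y
  proof -
    have "f = (\<lambda>\<xi>. exp (- \<i> * of_real (x \<bullet> \<xi>)) * (\<lambda>\<xi>. q \<xi> * h \<xi>) (- \<xi>))"
      by (rule ext) (simp add: f_def h_even)
    then have "fourier_integral f y = fourier_integral (\<lambda>\<xi>. q \<xi> * h \<xi>) (x - y)"
      using fourier_integral_modulate[of x "\<lambda>\<xi>. q \<xi> * h \<xi>" y] by simp
    moreover have "f \<in> borel_measurable borel" unfolding f_def by measurable
    ultimately show ?thesis by (simp add: inverse_fourier_eq)
  qed
  have 2: "inverse_fourier (\<lambda>\<xi>. p (- \<xi>) * f \<xi>) y = inverse_fourier h (x - y)" for y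
  proof -
    have "p (- \<xi>) * f \<xi> = (p (- \<xi>) * q (- \<xi>)) * (exp (- \<i> * of_real (x \<bullet> \<xi>)) * h (- \<xi>))" for \<xi>
      by (simp only: f_def h_even mult_ac)
    then have eq: "(\<lambda>\<xi>. p (- \<xi>) * f \<xi>) = (\<lambda>\<xi>. exp (- \<i> * of_real (x \<bullet> \<xi>)) * h (- \<xi>))"
      by (simp only: pq mult_1_left)
    have "(\<lambda>\<xi>. exp (- \<i> * of_real (x \<bullet> \<xi>)) * h (- \<xi>)) \<in> borel_measurable borel" by measurable
    then show ?thesis
      unfolding eq by (simp only: inverse_fourier_eq h_meas fourier_integral_modulate)
  qed
  have "multiplier_distribution p u (inverse_fourier f) = (LINT y|lebesgue. F (u y) * inverse_fourier f y)"
    using sol schwartz_inverse_fourier[OF flat] by (simp add: distribution_solution_def)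
  then have "(LINT y|lebesgue. u y * inverse_fourier h (x - y)) = (LINT y|lebesgue. F (u y) * inverse_fourier (\<lambda>\<xi>. q \<xi> * h \<xi>) (x - y))"
    by (simp only: multiplier_distribution_def fourier_multiplier_inverse_fourier[OF flat] 1 2)
  then show ?thesis
    by (subst (asm) (1 2) integral_completion) auto
qed

text \<open>The kernel \<kappa> has the symbol \<open>bandpass\<close> L (r \<xi>) q(\<xi>). Its L^1
  norm is computed after rescaling the band to unit frequency, where q contributes the factor r^(min
  M 1); the identity with cutoff then passes to the limit on both sides.\<close>

lemma band_identity:
  fixes p q u :: "real^'d::finite \<Rightarrow> complex" and F :: "complex \<Rightarrow> complex" and L :: nat
  assumes q: "symbol_family {()} (\<lambda>_ \<xi>. japanese_bracket \<xi> powr (- M)) (\<lambda>_. q)" and M: "0 < M"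
    and q_meas [measurable]: "q \<in> borel_measurable borel" and pq: "\<And>\<xi>. p \<xi> * q \<xi> = 1"
    and u_meas [measurable]: "u \<in> borel_measurable borel" and u: "\<And>x. norm (u x) \<le> B"
    and Fu_meas [measurable]: "(\<lambda>x. F (u x)) \<in> borel_measurable borel" and Fu: "\<And>x. norm (F (u x)) \<le> B'"
    and sol: "distribution_solution p F u"
    and L: "CARD('d) + 3 \<le> L"
  shows "\<exists>C\<ge>0. \<forall>r. 0 < r \<and> r \<le> 1 \<longrightarrow> (\<exists>\<kappa>. integrable lborel \<kappa> \<and>
      (LINT x|lborel. norm (\<kappa> x)) \<le> C * r powr min M 1 \<and>
      (\<forall>x. (LINT y|lborel. u y * inverse_fourier (\<lambda>\<xi>. bandpass L (r *\<^sub>R \<xi>)) (x - y)) = (LINT y|lborel. F (u y) * \<kappa> (x - y))))"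
proof -
  define g where "g r \<eta> = bandpass L \<eta> * q ((1 / r) *\<^sub>R \<eta>)" for r \<eta>
  have g_meas [measurable]: "g r \<in> borel_measurable borel" for r
    unfolding g_def[abs_def] by measurable
  have g0: "g r 0 = 0" for r using L by (simp add: g_def bandpass_zero)
  have g_family: "symbol_family {0<..1} (\<lambda>r \<xi>. r powr min M 1 * split_weight (2 * CARD('d) + 4) (2 * CARD('d)) \<xi>) g"
    unfolding g_def[abs_def]
  proof (rule symbol_family_mono[OF symbol_family_mult[OF symbol_family_reparam[OF symbol_family_bandpass_split[of L "CARD('d)"]]
        symbol_family_scaled_multiplier[OF q M]], of _ 1])
    fix r :: real and \<xi> :: "real^'d" assume "r \<in> {0<..1}" "\<xi> \<noteq> 0"
    \<comment> \<open>One of the 2 L orders of vanishing cancels the singularity of q(\<eta>/r). The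
      remaining 2 L - 1 are at least 2 d + 4, as the removal of the cutoff demands.\<close>
    have "2 * L = (2 * L - 1) + 1" using L by simp
    then have "split_weight (2 * L) (2 * CARD('d)) \<xi> = split_weight (2 * L - 1) (2 * CARD('d)) \<xi> * split_weight 1 0 \<xi>"
      by (metis split_weight_mult add.right_neutral)
    then have "split_weight (2 * L) (2 * CARD('d)) \<xi> * (r powr min M 1 * (1 / split_weight 1 0 \<xi>))
      = r powr min M 1 * split_weight (2 * L - 1) (2 * CARD('d)) \<xi>"
      using split_weight_pos[OF \<open>\<xi> \<noteq> 0\<close>, of 1 0] by simp
    also have "\<dots> \<le> r powr min M 1 * split_weight (2 * CARD('d) + 4) (2 * CARD('d)) \<xi>"
      using L by (intro mult_left_mono split_weight_antimono) auto
    finally show "split_weight (2 * L) (2 * CARD('d)) \<xi> * (r powr min M 1 * (1 / split_weight 1 0 \<xi>))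
      \<le> 1 * (r powr min M 1 * split_weight (2 * CARD('d) + 4) (2 * CARD('d)) \<xi>)" by simp
  qed auto
  have "symbol_family {0<..1} (\<lambda>r \<xi>. r powr min M 1 * split_weight (2 * CARD('d) + 2) (2 * CARD('d)) \<xi>) g"
    by (rule symbol_family_mono[OF g_family, of 1]) (simp_all add: split_weight_antimono mult_left_mono)
  from symbol_family_fourier_integral[OF this g0]
  obtain C where C: "0 \<le> C" "\<And>r x. r \<in> {0<..1} \<Longrightarrow> norm (fourier_integral (g r) x) \<le> C * r powr min M 1 * envelope x"
    by blast
  define C' where "C' = C * envelope_mass TYPE('d) / (2 * pi) ^ CARD('d)"
  have "0 \<le> C'" using C(1) by (simp add: C'_def envelope_mass_nonneg)
  moreover have "\<exists>\<kappa>. integrable lborel \<kappa> \<and> (LINT x|lborel. norm (\<kappa> x)) \<le> C' * r powr min M 1 \<and>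
      (\<forall>x. (LINT y|lborel. u y * inverse_fourier (\<lambda>\<xi>. bandpass L (r *\<^sub>R \<xi>)) (x - y)) = (LINT y|lborel. F (u y) * \<kappa> (x - y)))"
    if r: "0 < r" "r \<le> 1" for r
  proof (intro exI conjI allI)
    define \<kappa> where "\<kappa> = inverse_fourier (\<lambda>\<xi>. g r (r *\<^sub>R \<xi>))"
    have bound: "norm (fourier_integral (g r) x) \<le> C * r powr min M 1 * envelope x" for x
      using C(2) r by simp
    show "integrable lborel \<kappa>"
      unfolding \<kappa>_def by (rule inverse_fourier_scaled_bound(2)[OF g_meas r(1) bound])
    show "(LINT x|lborel. norm (\<kappa> x)) \<le> C' * r powr min M 1"
      using inverse_fourier_scaled_bound(3)[OF g_meas r(1) bound] by (simp add: \<kappa>_def C'_def mult_ac)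
    fix x
    define \<epsilon> :: "nat \<Rightarrow> real" where "\<epsilon> n = 1 / real (Suc n)" for n
    have gr: "g r (r *\<^sub>R \<xi>) = bandpass L (r *\<^sub>R \<xi>) * q \<xi>" for \<xi>
      using r by (simp add: g_def)
    have "symbol_family {()} (\<lambda>_. split_weight (2 * CARD('d) + 4) (2 * CARD('d))) (\<lambda>_. g r)"
      by (rule symbol_family_mono[OF symbol_family_reparam[OF g_family, of "{()}" "\<lambda>_. r"], of "r powr min M 1"]) (use r in auto)
    from cutoff_convolution_tendsto[OF g_meas g0 this r(1) Fu_meas Fu]
    have "(\<lambda>n. LINT y|lborel. F (u y) * inverse_fourier (\<lambda>\<xi>. flat_cutoff (\<epsilon> n) (r *\<^sub>R \<xi>) * g r (r *\<^sub>R \<xi>)) (x - y))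
      \<longlonglongrightarrow> (LINT y|lborel. F (u y) * \<kappa> (x - y))" by (simp only: \<kappa>_def \<epsilon>_def)
    moreover have "symbol_family {()} (\<lambda>_. split_weight (2 * CARD('d) + 4) (2 * CARD('d))) (\<lambda>_. bandpass L :: real^'d \<Rightarrow> complex)"
      by (rule symbol_family_mono[OF symbol_family_bandpass_split[of L "CARD('d)"], of 1]) (use L in \<open>auto intro!: split_weight_antimono\<close>)
    from cutoff_convolution_tendsto[OF bandpass_measurable bandpass_zero this r(1) u_meas u] L
    have "(\<lambda>n. LINT y|lborel. u y * inverse_fourier (\<lambda>\<xi>. flat_cutoff (\<epsilon> n) (r *\<^sub>R \<xi>) * bandpass L (r *\<^sub>R \<xi>)) (x - y))
      \<longlonglongrightarrow> (LINT y|lborel. u y * inverse_fourier (\<lambda>\<xi>. bandpass L (r *\<^sub>R \<xi>)) (x - y))" by (simp add: \<epsilon>_def)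
    moreover have "(LINT y|lborel. u y * inverse_fourier (\<lambda>\<xi>. flat_cutoff (\<epsilon> n) (r *\<^sub>R \<xi>) * bandpass L (r *\<^sub>R \<xi>)) (x - y))
      = (LINT y|lborel. F (u y) * inverse_fourier (\<lambda>\<xi>. flat_cutoff (\<epsilon> n) (r *\<^sub>R \<xi>) * g r (r *\<^sub>R \<xi>)) (x - y))" for n
    proof -
      have "0 < \<epsilon> n" by (simp add: \<epsilon>_def)
      from band_identity_cutoff[OF q M q_meas pq u_meas Fu_meas sol r(1) this, of L x] show ?thesis
        by (simp add: gr mult_ac)
    qed
    ultimately show "(LINT y|lborel. u y * inverse_fourier (\<lambda>\<xi>. bandpass L (r *\<^sub>R \<xi>)) (x - y)) = (LINT y|lborel. F (u y) * \<kappa> (x - y))"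
      using LIMSEQ_unique by simp
  qed
  ultimately show ?thesis by blast
qed

text \<open>Absolute convergence in L^1. The sum k is fixed before f is given: a single kernel has
  to serve all functions s -> F(u(x - s)) at once.\<close>

lemma integrable_kernel_series:
  fixes \<kappa> :: "nat \<Rightarrow> 'a \<Rightarrow> complex"
  assumes int: "\<And>i. integrable M (\<kappa> i)" and sum: "summable (\<lambda>i. LINT x|M. norm (\<kappa> i x))"
  shows "\<exists>k. integrable M k \<and> (LINT x|M. norm (k x)) \<le> (\<Sum>i. LINT x|M. norm (\<kappa> i x)) \<and>
    (\<forall>f B. f \<in> borel_measurable M \<longrightarrow> (\<forall>x. norm (f x) \<le> B) \<longrightarrow>
      (\<lambda>i. LINT x|M. f x * \<kappa> i x) sums (LINT x|M. f x * k x))"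
proof -
  have [measurable]: "\<kappa> i \<in> borel_measurable M" for i using int by auto
  have nn: "(\<integral>\<^sup>+x. (\<Sum>i. ennreal (norm (\<kappa> i x))) \<partial>M) = (\<Sum>i. ennreal (LINT x|M. norm (\<kappa> i x)))"
    by (subst nn_integral_suminf) (auto intro!: suminf_cong nn_integral_eq_integral int)
  also have "\<dots> \<noteq> \<infinity>"
    by (subst suminf_ennreal_eq[OF _ summable_sums[OF sum]]) auto
  finally have "AE x in M. (\<Sum>i. ennreal (norm (\<kappa> i x))) \<noteq> \<infinity>"
    by (intro nn_integral_PInf_AE) auto
  then have AE: "AE x in M. summable (\<lambda>i. norm (\<kappa> i x))"
    by eventually_elim (auto intro: summable_suminf_not_top)
  define k where "k x = (\<Sum>i. \<kappa> i x)" for x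
  have "integrable M k"
    unfolding k_def by (rule integrable_suminf[OF int AE sum])
  moreover have "(LINT x|M. norm (k x)) \<le> (\<Sum>i. LINT x|M. norm (\<kappa> i x))"
  proof -
    have AE': "AE x in M. summable (\<lambda>i. norm (norm (\<kappa> i x)))" using AE by simp
    have sum': "summable (\<lambda>i. LINT x|M. norm (norm (\<kappa> i x)))" using sum by simp
    have "(LINT x|M. norm (k x)) \<le> (LINT x|M. (\<Sum>i. norm (\<kappa> i x)))"
    proof (rule integral_mono_AE)
      show "integrable M (\<lambda>x. norm (k x))" using \<open>integrable M k\<close> by simp
      show "integrable M (\<lambda>x. \<Sum>i. norm (\<kappa> i x))"
        by (rule integrable_suminf[OF integrable_norm[OF int] AE' sum'])
      show "AE x in M. norm (k x) \<le> (\<Sum>i. norm (\<kappa> i x))"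
        using AE by eventually_elim (simp add: k_def summable_norm)
    qed
    also have "\<dots> = (\<Sum>i. LINT x|M. norm (\<kappa> i x))"
      by (rule integral_suminf[OF integrable_norm[OF int] AE' sum'])
    finally show ?thesis .
  qed
  moreover have "(\<lambda>i. LINT x|M. f x * \<kappa> i x) sums (LINT x|M. f x * k x)"
    if [measurable]: "f \<in> borel_measurable M" and f: "\<And>x. norm (f x) \<le> B" for f B
  proof -
    have le: "norm (f x * \<kappa> i x) \<le> B * norm (\<kappa> i x)" for i x
      unfolding norm_mult by (intro mult_right_mono f) simp
    have int': "integrable M (\<lambda>x. f x * \<kappa> i x)" for i
      by (rule integrable_bounded_mult[OF _ f int]) measurable
    have "(\<lambda>i. LINT x|M. f x * \<kappa> i x) sums (LINT x|M. (\<Sum>i. f x * \<kappa> i x))"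
    proof (rule sums_integral[OF int'])
      show "AE x in M. summable (\<lambda>i. norm (f x * \<kappa> i x))"
        using AE
      proof eventually_elim
        case (elim x)
        show ?case by (rule summable_comparison_test'[OF summable_mult[OF elim, of B]]) (use le in simp)
      qed
      show "summable (\<lambda>i. LINT x|M. norm (f x * \<kappa> i x))"
      proof (rule summable_comparison_test'[OF summable_mult[OF sum, of B]])
        fix i
        have "(LINT x|M. norm (f x * \<kappa> i x)) \<le> (LINT x|M. B * norm (\<kappa> i x))"
          by (intro Bochner_Integration.integral_mono integrable_norm int' integrable_mult_right int le)
        then show "norm (LINT x|M. norm (f x * \<kappa> i x)) \<le> B * (LINT x|M. norm (\<kappa> i x))"
          by (simp add: abs_of_nonneg)
      qed
    qed
    also have "(LINT x|M. (\<Sum>i. f x * \<kappa> i x)) = (LINT x|M. f x * k x)"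
    proof (rule integral_cong_AE)
      show "AE x in M. (\<Sum>i. f x * \<kappa> i x) = f x * k x"
        using AE
        by eventually_elim (auto simp: k_def intro!: suminf_mult summable_norm_cancel)
      show "(\<lambda>x. f x * k x) \<in> borel_measurable M" unfolding k_def by measurable
    qed measurable
    finally show ?thesis .
  qed
  ultimately show ?thesis by blast
qed

text \<open>The density 1 + f/B' is nonnegative and has the same box integrals as the density 1.
  Boxes determine Lebesgue measure, and densities are unique almost everywhere.\<close>

lemma AE_zero_of_box_integrals_real:
  fixes f :: "'a::euclidean_space \<Rightarrow> real"
  assumes f [measurable]: "f \<in> borel_measurable borel" and B: "\<And>x. \<bar>f x\<bar> \<le> B"
    and zero: "\<And>l u. (LINT x|lborel. indicator (box l u) x * f x) = 0"
  shows "AE x in lborel. f x = 0"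
proof -
  \<comment> \<open>Adding 1 keeps the divisor positive even for B = 0.\<close>
  define B' where "B' = B + 1"
  have B': "0 < B'" "\<And>x. \<bar>f x / B'\<bar> \<le> 1"
  proof -
    show "0 < B'" using B[of 0] by (simp add: B'_def)
    then show "\<bar>f x / B'\<bar> \<le> 1" for x using B[of x] by (simp add: B'_def)
  qed
  define w where "w x = 1 + f x / B'" for x
  have w: "0 \<le> w x" for x using B'(2)[of x] unfolding w_def by linarith
  have [measurable]: "w \<in> borel_measurable borel" unfolding w_def by measurable
  have "density lborel (\<lambda>x. ennreal (w x)) = lborel"
  proof (rule lborel_eqI[symmetric])
    fix l u :: 'a assume le: "\<And>b. b \<in> Basis \<Longrightarrow> l \<bullet> b \<le> u \<bullet> b"
    have int1: "integrable lborel (\<lambda>x::'a. indicator (box l u) x * (1::real))"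
      using emeasure_lborel_box_finite[of l u] by (auto simp: integrable_indicator_iff)
    have int2: "integrable lborel (\<lambda>x. indicator (box l u) x * f x)"
      by (rule Bochner_Integration.integrable_bound[OF integrable_mult_right[OF int1, of B]])
        (auto simp: indicator_def intro!: AE_I2 order_trans[OF B abs_ge_self])
    have int3: "integrable lborel (\<lambda>x. indicator (box l u) x * (1::real) + indicator (box l u) x * f x * (1 / B'))"
      by (intro Bochner_Integration.integrable_add integrable_mult_left int1 int2)
    have eq: "indicator (box l u) x * w x = indicator (box l u) x * (1::real) + indicator (box l u) x * f x * (1 / B')" for x
      by (simp add: w_def distrib_left)
    have "emeasure (density lborel (\<lambda>x. ennreal (w x))) (box l u) = (\<integral>\<^sup>+x. ennreal (w x) * indicator (box l u) x \<partial>lborel)"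
      by (rule emeasure_density) auto
    also have "\<dots> = (\<integral>\<^sup>+x. ennreal (indicator (box l u) x * w x) \<partial>lborel)"
      by (intro nn_integral_cong) (auto simp: indicator_def)
    also have "\<dots> = ennreal (LINT x|lborel. indicator (box l u) x * w x)"
    proof (rule nn_integral_eq_integral)
      show "integrable lborel (\<lambda>x. indicator (box l u) x * w x)"
        unfolding eq by (rule int3)
    qed (use w in auto)
    also have "(LINT x|lborel. indicator (box l u) x * w x) = (LINT x|lborel. indicator (box l u) x * (1::real)) + (LINT x|lborel. indicator (box l u) x * f x) * (1 / B')"
      unfolding eq by (subst Bochner_Integration.integral_add) (use int1 int2 in \<open>auto intro!: integrable_mult_left\<close>)
    also have "\<dots> = measure lborel (box l u)" by (simp add: zero)
    finally show "emeasure (density lborel (\<lambda>x. ennreal (w x))) (box l u) = (\<Prod>b\<in>Basis. (u - l) \<bullet> b)"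
      using le by (simp add: measure_lborel_box_eq)
  qed simp
  also have "lborel = density lborel (\<lambda>x::'a. 1)" by (simp add: density_1)
  finally have "AE x in lborel. ennreal (w x) = 1"
    by (subst (asm) sigma_finite_measure.density_unique_iff[OF sigma_finite_lborel]) auto
  then show ?thesis
  proof eventually_elim
    case (elim x)
    then have "w x = 1" using w[of x] by (metis ennreal_eq_1)
    then show ?case using B'(1) by (simp add: w_def)
  qed
qed

lemma integrable_indicator_box:
  fixes f :: "'a::euclidean_space \<Rightarrow> complex"
  assumes [measurable]: "f \<in> borel_measurable borel" and f: "\<And>x. norm (f x) \<le> B"
  shows "integrable lborel (\<lambda>x. indicator (box l u) x * f x)"
proof -
  have "integrable lborel (\<lambda>x. f x * indicator (box l u) x)"
  proof (rule integrable_bounded_mult[OF _ f])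
    have "integrable lborel (indicator (box l u) :: 'a \<Rightarrow> complex)"
      using emeasure_lborel_box_finite[of l u] by (intro integrable_real_indicator[THEN integrable_of_real, where 'a=complex, simplified of_real_indicator]) auto
    then show "integrable lborel (\<lambda>x. indicator (box l u) x :: complex)" by simp
  qed simp
  then show ?thesis by (simp add: mult.commute)
qed

lemma AE_zero_of_box_integrals:
  fixes f :: "'a::euclidean_space \<Rightarrow> complex"
  assumes f [measurable]: "f \<in> borel_measurable borel" and B: "\<And>x. norm (f x) \<le> B"
    and zero: "\<And>l u. (LINT x|lborel. indicator (box l u) x * f x) = 0"
  shows "AE x in lborel. f x = 0"
proof -
  have int: "integrable lborel (\<lambda>x. indicator (box l u) x * f x)" for l u
    by (rule integrable_indicator_box[OF f B])
  have "AE x in lborel. Re (f x) = 0"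
  proof (rule AE_zero_of_box_integrals_real)
    show "\<bar>Re (f x)\<bar> \<le> B" for x using abs_Re_le_cmod[of "f x"] B[of x] by linarith
    fix l u :: 'a
    have "(LINT x|lborel. indicator (box l u) x * Re (f x)) = (LINT x|lborel. Re (indicator (box l u) x * f x))"
      by (intro Bochner_Integration.integral_cong) (auto simp: indicator_def)
    then show "(LINT x|lborel. indicator (box l u) x * Re (f x)) = 0"
      by (simp only: integral_Re[OF int] zero zero_complex.sel)
  qed measurable
  moreover have "AE x in lborel. Im (f x) = 0"
  proof (rule AE_zero_of_box_integrals_real)
    show "\<bar>Im (f x)\<bar> \<le> B" for x using abs_Im_le_cmod[of "f x"] B[of x] by linarith
    fix l u :: 'a
    have "(LINT x|lborel. indicator (box l u) x * Im (f x)) = (LINT x|lborel. Im (indicator (box l u) x * f x))"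
      by (intro Bochner_Integration.integral_cong) (auto simp: indicator_def)
    then show "(LINT x|lborel. indicator (box l u) x * Im (f x)) = 0"
      by (simp only: integral_Im[OF int] zero zero_complex.sel)
  qed measurable
  ultimately show ?thesis
    by eventually_elim (simp add: complex_eq_iff)
qed

section \<open>Heat kernels and the low-frequency part\<close>

text \<open>The heat kernel at time c, of total mass 1 for c > 0; its Fourier symbol is
  \<open>gaussian\<close> c.\<close>

definition heat_kernel :: "real \<Rightarrow> real^'d::finite \<Rightarrow> complex" where
  "heat_kernel c x = of_real (1 / sqrt (4 * pi * c) ^ CARD('d)) * gaussian (1 / (4 * c)) x"

lemma heat_kernel_measurable [measurable]: "heat_kernel c \<in> borel_measurable borel"
  unfolding heat_kernel_def[abs_def] by measurable

lemma gaussian_integrable: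
  "0 < c \<Longrightarrow> integrable lborel (gaussian c :: real^'d::finite \<Rightarrow> complex)"
  unfolding gaussian_def[abs_def] by (intro integrable_of_real gaussian_integral(1))

lemma inverse_fourier_gaussian:
  assumes "0 < c"
  shows "inverse_fourier (gaussian c) (x::real^'d::finite) = heat_kernel c x"
proof -
  have "sqrt (4 * pi * c) * sqrt (pi / c) = sqrt ((2 * pi)\<^sup>2)"
    unfolding real_sqrt_mult[symmetric] using assms by (simp add: power2_eq_square)
  also have "\<dots> = \<bar>2 * pi\<bar>" by (rule real_sqrt_abs)
  finally have "sqrt (4 * pi * c) * sqrt (pi / c) = 2 * pi" by simp
  then have "sqrt (pi / c) / (2 * pi) = 1 / sqrt (4 * pi * c)"
    using assms by (simp add: field_simps)
  from arg_cong[OF this, of "\<lambda>t. t ^ CARD('d)"]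
  have "1 / (2 * pi) ^ CARD('d) * sqrt (pi / c) ^ CARD('d) = 1 / sqrt (4 * pi * c) ^ CARD('d)"
    by (simp add: power_divide)
  then show ?thesis
    by (simp only: inverse_fourier_eq gaussian_measurable fourier_integral_gaussian[OF assms]
        heat_kernel_def mult.assoc[symmetric] of_real_mult[symmetric])
qed

lemma heat_kernel_integral:
  assumes "0 < c"
  shows "integrable lborel (heat_kernel c :: real^'d::finite \<Rightarrow> complex)"
    and "(LINT x::real^'d|lborel. norm (heat_kernel c x)) = 1"
proof -
  have b: "0 < 1 / (4 * c)" using assms by simp
  show "integrable lborel (heat_kernel c :: real^'d \<Rightarrow> complex)"
    unfolding heat_kernel_def[abs_def] by (intro integrable_mult_right gaussian_integrable b)
  have "norm (heat_kernel c x) = 1 / sqrt (4 * pi * c) ^ CARD('d) * exp (- (1 / (4 * c)) * (norm x)\<^sup>2)" for x :: "real^'d"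
    using assms unfolding heat_kernel_def gaussian_def norm_mult norm_of_real by simp
  then have "(LINT x::real^'d|lborel. norm (heat_kernel c x)) = 1 / sqrt (4 * pi * c) ^ CARD('d) * sqrt (pi / (1 / (4 * c))) ^ CARD('d)"
    by (simp only: integral_mult_right_zero gaussian_integral(2)[OF b])
  also have "pi / (1 / (4 * c)) = 4 * pi * c" by simp
  finally show "(LINT x::real^'d|lborel. norm (heat_kernel c x)) = 1"
    using assms by simp
qed

text \<open>Minus the coefficients in the expansion of (1 - g)^L; the term j = 0 cancels the leading
  1 of \<open>lowpass\<close>, which is why later sums start at 1.\<close>

definition lowpass_coeff :: "nat \<Rightarrow> nat \<Rightarrow> complex" where
  "lowpass_coeff L j = - (of_nat (L choose j) * (- 1) ^ j)"

lemma lowpass_expansion: "lowpass L \<xi> = (\<Sum>j=1..L. lowpass_coeff L j * gaussian (real j) \<xi>)"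
proof -
  have "(1 - gaussian 1 \<xi>) ^ L = (\<Sum>j\<le>L. of_nat (L choose j) * (- gaussian 1 \<xi>) ^ j)"
    using binomial_ring[of "- gaussian 1 \<xi>" 1 L] by (simp add: add.commute)
  also have "\<dots> = (\<Sum>j\<le>L. - lowpass_coeff L j * gaussian (real j) \<xi>)"
  proof (rule sum.cong[OF refl])
    fix j
    have "gaussian 1 \<xi> ^ j = gaussian (real j) \<xi>"
      unfolding gaussian_def of_real_power[symmetric] exp_of_nat_mult[symmetric] by simp
    then show "of_nat (L choose j) * (- gaussian 1 \<xi>) ^ j = - lowpass_coeff L j * gaussian (real j) \<xi>"
      by (simp add: lowpass_coeff_def power_minus[of "gaussian 1 \<xi>"])
  qed
  also have "{..L} = insert 0 {1..L}" by auto
  finally show ?thesis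
    by (simp add: lowpass_def lowpass_coeff_def[of L 0] gaussian_def[of 0] sum_negf)
qed

text \<open>The expansion read at the origin, where all Gaussians equal 1; \<open>real^unit\<close>
  only supplies a space in which to evaluate it.\<close>

lemma sum_lowpass_coeff: "0 < L \<Longrightarrow> (\<Sum>j=1..L. lowpass_coeff L j) = 1"
  using lowpass_expansion[of L "0::real^unit"] by (simp add: lowpass_def gaussian_def zero_power)

definition lowpass_kernel :: "nat \<Rightarrow> real \<Rightarrow> real^'d::finite \<Rightarrow> complex" where
  "lowpass_kernel L r x = (\<Sum>j=1..L. lowpass_coeff L j * heat_kernel (real j * r\<^sup>2) x)"

lemma lowpass_kernel_measurable [measurable]: "lowpass_kernel L r \<in> borel_measurable borel"
  unfolding lowpass_kernel_def[abs_def] by measurable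

lemma lowpass_scaled:
  "lowpass L (r *\<^sub>R \<xi>) = (\<Sum>j=1..L. lowpass_coeff L j * gaussian (real j * r\<^sup>2) \<xi>)"
  by (simp add: lowpass_expansion gaussian_scale)

lemma lowpass_integrable:
  assumes "0 < r"
  shows "integrable lborel (\<lambda>\<xi>::real^'d::finite. lowpass L (r *\<^sub>R \<xi>))"
  unfolding lowpass_scaled
  by (intro Bochner_Integration.integrable_sum integrable_mult_right gaussian_integrable) (use assms in auto)

lemma inverse_fourier_lowpass:
  assumes "0 < r"
  shows "inverse_fourier (\<lambda>\<xi>. lowpass L (r *\<^sub>R \<xi>)) (x::real^'d::finite) = lowpass_kernel L r x"
proof -
  have int: "integrable lborel (\<lambda>\<xi>. exp (\<i> * of_real (x \<bullet> \<xi>)) * gaussian (real j * r\<^sup>2) \<xi>)" if "j \<in> {1..L}" for j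
    by (rule integrable_bounded_mult[of _ _ 1]) (use that assms in \<open>auto intro!: gaussian_integrable\<close>)
  have "fourier_integral (\<lambda>\<xi>. lowpass L (r *\<^sub>R \<xi>)) x
      = (LINT \<xi>|lborel. (\<Sum>j=1..L. lowpass_coeff L j * (exp (\<i> * of_real (x \<bullet> \<xi>)) * gaussian (real j * r\<^sup>2) \<xi>)))"
    unfolding fourier_integral_def lowpass_scaled by (simp add: sum_distrib_left mult_ac)
  also have "\<dots> = (\<Sum>j=1..L. lowpass_coeff L j * fourier_integral (gaussian (real j * r\<^sup>2)) x)"
    unfolding fourier_integral_def
    by (subst Bochner_Integration.integral_sum) (auto intro!: integrable_mult_right int)
  finally have "inverse_fourier (\<lambda>\<xi>. lowpass L (r *\<^sub>R \<xi>)) x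
      = (\<Sum>j=1..L. lowpass_coeff L j * inverse_fourier (gaussian (real j * r\<^sup>2)) x)"
    by (simp add: inverse_fourier_eq sum_distrib_left mult_ac)
  also have "\<dots> = lowpass_kernel L r x"
    unfolding lowpass_kernel_def using assms by (intro sum.cong) (auto simp: inverse_fourier_gaussian)
  finally show ?thesis .
qed

text \<open>The telescoping structure of the bands on the side of the kernels.\<close>

lemma inverse_fourier_bandpass:
  assumes "0 < r"
  shows "inverse_fourier (\<lambda>\<xi>. bandpass L (r *\<^sub>R \<xi>)) (x::real^'d::finite) = lowpass_kernel L (r / 2) x - lowpass_kernel L r x"
proof -
  have int: "integrable lborel (\<lambda>\<xi>::real^'d. exp (\<i> * of_real (x \<bullet> \<xi>)) * lowpass L (s *\<^sub>R \<xi>))" if "0 < s" for s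
    by (rule integrable_bounded_mult[of _ _ 1]) (use that in \<open>auto intro!: lowpass_integrable\<close>)
  have r2: "0 < r / 2" using assms by simp
  have "fourier_integral (\<lambda>\<xi>. bandpass L (r *\<^sub>R \<xi>)) x
    = fourier_integral (\<lambda>\<xi>. lowpass L ((r / 2) *\<^sub>R \<xi>)) x - fourier_integral (\<lambda>\<xi>. lowpass L (r *\<^sub>R \<xi>)) x"
    unfolding fourier_integral_def bandpass_def
    by (subst Bochner_Integration.integral_diff[OF int[OF r2] int[OF assms], symmetric]) (simp add: right_diff_distrib)
  then show ?thesis
    unfolding inverse_fourier_lowpass[OF assms, symmetric] inverse_fourier_lowpass[OF r2, symmetric]
    by (simp add: inverse_fourier_eq right_diff_distrib)
qed

text \<open>A merely bounded measurable u allows no pointwise argument along the kernels. Tested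
  against the indicator of a box, the translation can be moved by Fubini onto the indicator, which
  is continuous off the boundary of the box.\<close>

lemma heat_kernel_box_tendsto:
  fixes u :: "real^'d::finite \<Rightarrow> complex"
  assumes u_meas [measurable]: "u \<in> borel_measurable borel" and u: "\<And>x. norm (u x) \<le> B"
    and s: "s \<longlonglongrightarrow> 0" "\<And>n. 0 < s n"
  shows "(\<lambda>n. LINT x|lborel. indicator (box a b) x * (LINT y|lborel. u y * heat_kernel ((s n)\<^sup>2) (x - y)))
    \<longlonglongrightarrow> (LINT x|lborel. indicator (box a b) x * u x)"
proof -
  define K where "K = complex_of_real (1 / sqrt pi ^ CARD('d))"
  have B0: "0 \<le> B" using order_trans[OF norm_ge_zero u] .
  have conv: "(LINT y|lborel. u y * heat_kernel ((s n)\<^sup>2) (x - y)) = K * (LINT z|lborel. gaussian 1 z * u (x - (2 * s n) *\<^sub>R z))" for n x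
  proof -
    have heat: "(2 * s n) ^ CARD('d) *\<^sub>R heat_kernel ((s n)\<^sup>2) ((2 * s n) *\<^sub>R z) = K * gaussian 1 z" for z :: "real^'d"
    proof -
      have "sqrt (4 * pi * (s n)\<^sup>2) = 2 * s n * sqrt pi"
        using s(2)[of n] by (simp add: real_sqrt_mult)
      then have "(2 * s n) ^ CARD('d) * (1 / sqrt (4 * pi * (s n)\<^sup>2) ^ CARD('d)) = 1 / sqrt pi ^ CARD('d)"
        using s(2)[of n] by (simp add: power_mult_distrib)
      moreover have "gaussian (1 / (4 * (s n)\<^sup>2)) ((2 * s n) *\<^sub>R z) = gaussian 1 z"
        using s(2)[of n] by (simp add: gaussian_scale power_mult_distrib)
      ultimately show ?thesis
        by (simp only: heat_kernel_def K_def scaleR_conv_of_real mult.assoc[symmetric] of_real_mult[symmetric])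
    qed
    have "(LINT y|lborel. u y * heat_kernel ((s n)\<^sup>2) (x - y))
      = \<bar>- (2 * s n)\<bar> ^ DIM(real^'d) *\<^sub>R (LINT z|lborel. u (x + (- (2 * s n)) *\<^sub>R z) * heat_kernel ((s n)\<^sup>2) (x - (x + (- (2 * s n)) *\<^sub>R z)))"
      by (rule lborel_integral_affine) (use s(2)[of n] in simp)
    also have "\<dots> = (LINT z|lborel. u (x - (2 * s n) *\<^sub>R z) * ((2 * s n) ^ CARD('d) *\<^sub>R heat_kernel ((s n)\<^sup>2) ((2 * s n) *\<^sub>R z)))"
      using s(2)[of n] by simp
    also have "\<dots> = K * (LINT z|lborel. gaussian 1 z * u (x - (2 * s n) *\<^sub>R z))"
      unfolding heat by (subst integral_mult_right_zero[symmetric]) (simp add: mult_ac)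
    finally show ?thesis .
  qed
  define I :: "real^'d \<Rightarrow> complex" where "I = indicator (box a b)"
  have I_meas [measurable]: "I \<in> borel_measurable borel" unfolding I_def by measurable
  have I_le: "norm (I x) \<le> 1" for x by (simp add: I_def indicator_def)
  have I_int: "integrable lborel I"
    using integrable_indicator_box[of "\<lambda>_. 1" 1 a b] by (simp add: I_def)
  have u_scale [measurable]: "(\<lambda>z. u (x - t *\<^sub>R z)) \<in> borel_measurable borel" for x t by measurable
  \<comment> \<open>Pairs u with the box shifted by -2 s_n z; this is the inner integral after the
    order of integration is exchanged.\<close>
  define \<Psi> where "\<Psi> n z = (LINT x|lborel. u x * I ((2 * s n) *\<^sub>R z + x))" for n z
  have fub: "(LINT x|lborel. I x * (LINT z|lborel. gaussian 1 z * u (x - (2 * s n) *\<^sub>R z))) = (LINT z|lborel. gaussian 1 z * \<Psi> n z)" for n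
  proof -
    define G where "G = (\<lambda>(x, z). I x * (gaussian 1 z * u (x - (2 * s n) *\<^sub>R z)))"
    have G_meas [measurable]: "G \<in> borel_measurable (lborel \<Otimes>\<^sub>M lborel)"
      unfolding G_def by measurable
    have g_int: "integrable lborel (\<lambda>z. gaussian 1 z * u (x - (2 * s n) *\<^sub>R z))" for x
      using integrable_bounded_mult[of "\<lambda>z. u (x - (2 * s n) *\<^sub>R z)" lborel B "gaussian 1"] u gaussian_integrable[of 1]
      by (simp add: mult.commute)
    have G_int: "integrable (lborel \<Otimes>\<^sub>M lborel) G"
    proof (rule lborel_pair.Fubini_integrable)
      show "integrable lborel (\<lambda>x. LINT z|lborel. norm (G (x, z)))"
      proof (rule Bochner_Integration.integrable_bound)
        show "integrable lborel (\<lambda>x. norm (I x) * ((LINT z|lborel. norm (gaussian 1 (z::real^'d))) * B))"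
          by (intro integrable_mult_left integrable_norm I_int)
        show "AE x in lborel. norm (LINT z|lborel. norm (G (x, z))) \<le> norm (norm (I x) * ((LINT z|lborel. norm (gaussian 1 (z::real^'d))) * B))"
        proof (rule AE_I2)
          fix x
          have "(LINT z|lborel. norm (G (x, z))) = norm (I x) * (LINT z|lborel. norm (gaussian 1 z * u (x - (2 * s n) *\<^sub>R z)))"
            by (simp add: G_def norm_mult)
          also have "\<dots> \<le> norm (I x) * (LINT z|lborel. norm (gaussian 1 (z::real^'d)) * B)"
          proof (intro mult_left_mono Bochner_Integration.integral_mono)
            show "integrable lborel (\<lambda>z::real^'d. norm (gaussian 1 z) * B)"
              by (intro integrable_mult_left integrable_norm gaussian_integrable) simp
            show "norm (gaussian 1 z * u (x - (2 * s n) *\<^sub>R z)) \<le> norm (gaussian 1 z) * B" for z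
              unfolding norm_mult by (intro mult_left_mono u) simp
          qed (use g_int in auto)
          finally have "(LINT z|lborel. norm (G (x, z))) \<le> norm (I x) * ((LINT z|lborel. norm (gaussian 1 (z::real^'d))) * B)" by simp
          moreover have "0 \<le> (LINT z|lborel. norm (G (x, z)))" by simp
          ultimately show "norm (LINT z|lborel. norm (G (x, z))) \<le> norm (norm (I x) * ((LINT z|lborel. norm (gaussian 1 (z::real^'d))) * B))"
            by simp
        qed
      qed measurable
      show "AE x in lborel. integrable lborel (\<lambda>z. G (x, z))"
        unfolding G_def prod.case by (intro AE_I2 integrable_mult_right g_int)
    qed fact
    have "(LINT x|lborel. I x * (LINT z|lborel. gaussian 1 z * u (x - (2 * s n) *\<^sub>R z))) = (LINT x|lborel. LINT z|lborel. G (x, z))"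
      by (simp add: G_def)
    also have "\<dots> = (LINT z|lborel. LINT x|lborel. G (x, z))"
      using lborel_pair.Fubini_integral[of "\<lambda>x z. G (x, z)"] G_int by (simp add: case_prod_unfold)
    also have "\<dots> = (LINT z|lborel. gaussian 1 z * \<Psi> n z)"
    proof (rule Bochner_Integration.integral_cong[OF refl])
      fix z
      have "(LINT x|lborel. G (x, z)) = gaussian 1 z * (LINT x|lborel. I x * u (x - (2 * s n) *\<^sub>R z))"
        unfolding G_def prod.case by (subst integral_mult_right_zero[symmetric]) (simp add: mult_ac)
      also have "(LINT x|lborel. I x * u (x - (2 * s n) *\<^sub>R z)) = \<Psi> n z"
        unfolding \<Psi>_def by (subst lborel_integral_affine[of 1 _ "(2 * s n) *\<^sub>R z"]) (simp_all add: mult.commute)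
      finally show "(LINT x|lborel. G (x, z)) = gaussian 1 z * \<Psi> n z" .
    qed
    finally show ?thesis .
  qed
  \<comment> \<open>Bounds on the steps and on the box place all shifted boxes, for fixed z, in one
    ball and so give a dominating function.\<close>
  obtain S where S: "\<And>n. s n \<le> S"
    using convergent_imp_Bseq[OF convergentI[OF s(1)]] by (auto simp: Bseq_def intro: order_trans[OF abs_ge_self])
  obtain R where R: "\<And>x. x \<in> box a b \<Longrightarrow> norm x \<le> R"
    using bounded_box[of a b] by (auto simp: bounded_iff)
  have \<Psi>_lim: "(\<lambda>n. \<Psi> n z) \<longlonglongrightarrow> (LINT x|lborel. u x * I x)" for z
    unfolding \<Psi>_def
  proof (rule integral_dominated_convergence[where w="\<lambda>x. B * indicator (cball 0 (R + 2 * S * norm z)) x"])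
    have "emeasure lborel (cball (0::real^'d) (R + 2 * S * norm z)) < \<infinity>"
      using emeasure_compact_finite[of "cball (0::real^'d) (R + 2 * S * norm z)"] by simp
    then show "integrable lborel (\<lambda>x::real^'d. B * indicator (cball 0 (R + 2 * S * norm z)) x)"
      by (intro integrable_mult_right integrable_real_indicator) auto
    show "AE x in lborel. norm (u x * I ((2 * s n) *\<^sub>R z + x)) \<le> B * indicator (cball 0 (R + 2 * S * norm z)) x" for n
    proof (rule AE_I2)
      fix x
      show "norm (u x * I ((2 * s n) *\<^sub>R z + x)) \<le> B * indicator (cball 0 (R + 2 * S * norm z)) x"
      proof (cases "(2 * s n) *\<^sub>R z + x \<in> box a b")
        case True
        have "norm x \<le> norm ((2 * s n) *\<^sub>R z + x) + norm ((2 * s n) *\<^sub>R z)"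
          using norm_triangle_ineq4[of "(2 * s n) *\<^sub>R z + x" "(2 * s n) *\<^sub>R z"] by simp
        also have "\<dots> \<le> R + 2 * S * norm z"
          using R[OF True] S[of n] s(2)[of n] by (intro add_mono) (auto intro!: mult_right_mono)
        finally show ?thesis using True u[of x] by (simp add: I_def)
      qed (simp add: I_def B0)
    qed
    \<comment> \<open>Off the null boundary, the shifted indicator is eventually equal to the
      original one.\<close>
    have "emeasure lborel (cbox a b - box a b) = 0"
      using emeasure_lborel_cbox_finite[of a b]
      by (subst emeasure_Diff) (auto simp: emeasure_lborel_cbox_eq emeasure_lborel_box_eq box_subset_cbox)
    then have "AE x in lborel. x \<notin> cbox a b - box a b"
      by (intro AE_not_in null_setsI) auto
    then show "AE x in lborel. (\<lambda>n. u x * I ((2 * s n) *\<^sub>R z + x)) \<longlonglongrightarrow> u x * I x"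
    proof eventually_elim
      case (elim x)
      have lim: "(\<lambda>n. (2 * s n) *\<^sub>R z + x) \<longlonglongrightarrow> x"
      proof -
        have "(\<lambda>n. (2 * s n) *\<^sub>R z + x) \<longlonglongrightarrow> (2 * 0) *\<^sub>R z + x" by (intro tendsto_intros s)
        then show ?thesis by simp
      qed
      have "eventually (\<lambda>n. I ((2 * s n) *\<^sub>R z + x) = I x) sequentially"
      proof (cases "x \<in> box a b")
        case True
        from topological_tendstoD[OF lim open_box True] show ?thesis
          by eventually_elim (use True in \<open>simp add: I_def\<close>)
      next
        case False
        then have "x \<in> - cbox a b" using elim by auto
        from topological_tendstoD[OF lim _ this] have "eventually (\<lambda>n. (2 * s n) *\<^sub>R z + x \<in> - cbox a b) sequentially"
          by (simp add: open_Compl closed_cbox)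
        then show ?thesis
          by eventually_elim (use False box_subset_cbox[of a b] in \<open>auto simp: I_def indicator_def\<close>)
      qed
      then have "(\<lambda>n. I ((2 * s n) *\<^sub>R z + x)) \<longlonglongrightarrow> I x" by (rule tendsto_eventually)
      then show ?case by (intro tendsto_intros)
    qed
  qed measurable
  have \<Psi>_meas [measurable]: "\<Psi> n \<in> borel_measurable borel" for n
    unfolding \<Psi>_def[abs_def] by measurable
  have \<Psi>_le: "norm (\<Psi> n z) \<le> B * (LINT x|lborel. norm (I x))" for n z
  proof -
    have intI: "integrable lborel (\<lambda>x. I ((2 * s n) *\<^sub>R z + x))"
      using lborel_integrable_affine[OF _ I_int, of 1] by simp
    have "norm (\<Psi> n z) \<le> (LINT x|lborel. B * norm (I ((2 * s n) *\<^sub>R z + x)))"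
      unfolding \<Psi>_def
    proof (rule Bochner_Integration.integral_norm_bound_integral)
      show "integrable lborel (\<lambda>x. u x * I ((2 * s n) *\<^sub>R z + x))"
        by (rule integrable_bounded_mult[OF _ u intI]) measurable
      show "norm (u x * I ((2 * s n) *\<^sub>R z + x)) \<le> B * norm (I ((2 * s n) *\<^sub>R z + x))" for x
        unfolding norm_mult by (intro mult_right_mono u) simp
    qed (use intI in auto)
    also have "\<dots> = B * (LINT x|lborel. norm (I x))"
      using lborel_integral_affine[of 1 "\<lambda>x. norm (I x)" "(2 * s n) *\<^sub>R z"] by simp
    finally show ?thesis .
  qed
  have "(\<lambda>n. LINT z|lborel. gaussian 1 z * \<Psi> n z) \<longlonglongrightarrow> (LINT z::real^'d|lborel. gaussian 1 z * (LINT x|lborel. u x * I x))"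
  proof (rule integral_dominated_convergence[where w="\<lambda>z. norm (gaussian 1 z) * (B * (LINT x|lborel. norm (I x)))"])
    show "integrable lborel (\<lambda>z::real^'d. norm (gaussian 1 z) * (B * (LINT x|lborel. norm (I x))))"
      by (intro integrable_mult_left integrable_norm gaussian_integrable) simp
    show "AE z in lborel. (\<lambda>n. gaussian 1 z * \<Psi> n z) \<longlonglongrightarrow> gaussian 1 z * (LINT x|lborel. u x * I x)"
      by (intro AE_I2 tendsto_intros \<Psi>_lim)
    show "AE z in lborel. norm (gaussian 1 z * \<Psi> n z) \<le> norm (gaussian 1 z) * (B * (LINT x|lborel. norm (I x)))" for n
      unfolding norm_mult by (intro AE_I2 mult_left_mono \<Psi>_le) simp
  qed measurable
  then have lim: "(\<lambda>n. K * (LINT z|lborel. gaussian 1 z * \<Psi> n z)) \<longlonglongrightarrow> K * (LINT z::real^'d|lborel. gaussian 1 z * (LINT x|lborel. u x * I x))"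
    by (intro tendsto_intros)
  have mass: "K * (LINT z::real^'d|lborel. gaussian 1 z * c) = c" for c
  proof -
    have "(LINT z::real^'d|lborel. gaussian 1 z) = of_real (sqrt pi ^ CARD('d))"
      unfolding gaussian_def by (subst integral_of_real) (use gaussian_integral[of 1, where 'd='d] in simp_all)
    then show ?thesis by (simp add: K_def)
  qed
  have eq: "(LINT x|lborel. I x * (LINT y|lborel. u y * heat_kernel ((s n)\<^sup>2) (x - y)))
      = K * (LINT z|lborel. gaussian 1 z * \<Psi> n z)" for n
    unfolding conv fub[symmetric] by (subst integral_mult_right_zero[symmetric]) (simp add: mult_ac)
  have "(LINT x|lborel. u x * I x) = (LINT x|lborel. I x * u x)"
    by (simp only: mult.commute)
  with lim show ?thesis
    unfolding I_def[symmetric] eq mass by simp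
qed

lemma norm_sum_lowpass_coeff: "(\<Sum>j=1..L. norm (lowpass_coeff L j)) \<le> 2 ^ L"
proof -
  have "(\<Sum>j=1..L. norm (lowpass_coeff L j)) = (\<Sum>j=1..L. real (L choose j))"
    by (simp add: lowpass_coeff_def norm_mult norm_power)
  also have "\<dots> \<le> (\<Sum>j\<le>L. real (L choose j))"
    by (rule sum_mono2) auto
  also have "\<dots> = 2 ^ L"
    by (simp only: of_nat_sum[symmetric] choose_row_sum of_nat_power of_nat_numeral)
  finally show ?thesis .
qed

lemma lowpass_kernel_integrable:
  assumes "0 < r"
  shows "integrable lborel (lowpass_kernel L r :: real^'d::finite \<Rightarrow> complex)"
  unfolding lowpass_kernel_def[abs_def]
  by (intro Bochner_Integration.integrable_sum integrable_mult_right heat_kernel_integral) (use assms in auto)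

lemma heat_convolution_bound:
  fixes u :: "real^'d::finite \<Rightarrow> complex"
  assumes [measurable]: "u \<in> borel_measurable borel" and u: "\<And>x. norm (u x) \<le> B" and c: "0 < c"
  shows "norm (LINT y|lborel. u y * heat_kernel c (x - y)) \<le> B"
proof -
  have int: "integrable lborel (\<lambda>y. heat_kernel c (x - y))"
    by (rule integrable_reflect) (rule heat_kernel_integral(1)[OF c])
  have "norm (LINT y|lborel. u y * heat_kernel c (x - y)) \<le> (LINT y|lborel. B * norm (heat_kernel c (x - y)))"
  proof (rule Bochner_Integration.integral_norm_bound_integral)
    show "integrable lborel (\<lambda>y. u y * heat_kernel c (x - y))"
      by (rule integrable_bounded_mult[OF _ u int]) measurable
    show "norm (u y * heat_kernel c (x - y)) \<le> B * norm (heat_kernel c (x - y))" for y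
      unfolding norm_mult by (intro mult_right_mono u) simp
  qed (use int in auto)
  also have "\<dots> = B"
    using integral_reflect[of "\<lambda>y. norm (heat_kernel c y)" x] heat_kernel_integral(2)[OF c, where 'd='d] by simp
  finally show ?thesis .
qed

lemma lowpass_convolution_eq:
  fixes u :: "real^'d::finite \<Rightarrow> complex"
  assumes [measurable]: "u \<in> borel_measurable borel" and u: "\<And>x. norm (u x) \<le> B" and r: "0 < r"
  shows "(LINT y|lborel. u y * lowpass_kernel L r (x - y))
    = (\<Sum>j=1..L. lowpass_coeff L j * (LINT y|lborel. u y * heat_kernel (real j * r\<^sup>2) (x - y)))"
proof -
  have int: "integrable lborel (\<lambda>y. u y * heat_kernel (real j * r\<^sup>2) (x - y))" if "j \<in> {1..L}" for j
    by (rule integrable_bounded_mult[OF _ u integrable_reflect[OF heat_kernel_integral(1)]])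
      (use that r in auto)
  have "(LINT y|lborel. u y * lowpass_kernel L r (x - y))
      = (LINT y|lborel. (\<Sum>j=1..L. lowpass_coeff L j * (u y * heat_kernel (real j * r\<^sup>2) (x - y))))"
    unfolding lowpass_kernel_def by (simp add: sum_distrib_left mult_ac)
  also have "\<dots> = (\<Sum>j=1..L. LINT y|lborel. lowpass_coeff L j * (u y * heat_kernel (real j * r\<^sup>2) (x - y)))"
    by (rule Bochner_Integration.integral_sum) (intro integrable_mult_right int)
  finally show ?thesis by simp
qed

lemma lowpass_convolution_bound:
  fixes u :: "real^'d::finite \<Rightarrow> complex"
  assumes "u \<in> borel_measurable borel" and u: "\<And>x. norm (u x) \<le> B" and r: "0 < r"
  shows "norm (LINT y|lborel. u y * lowpass_kernel L r (x - y)) \<le> 2 ^ L * B"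
proof -
  have B: "0 \<le> B" using order_trans[OF norm_ge_zero u] .
  have "norm (LINT y|lborel. u y * lowpass_kernel L r (x - y)) \<le> (\<Sum>j=1..L. norm (lowpass_coeff L j) * B)"
    unfolding lowpass_convolution_eq[OF assms]
  proof (rule order_trans[OF norm_sum sum_mono])
    fix j assume "j \<in> {1..L}"
    then show "norm (lowpass_coeff L j * (LINT y|lborel. u y * heat_kernel (real j * r\<^sup>2) (x - y))) \<le> norm (lowpass_coeff L j) * B"
      unfolding norm_mult using r by (intro mult_left_mono heat_convolution_bound[OF assms(1) u]) auto
  qed
  also have "\<dots> \<le> 2 ^ L * B"
    unfolding sum_distrib_right[symmetric] by (rule mult_right_mono[OF norm_sum_lowpass_coeff B])
  finally show ?thesis .
qed

lemma lowpass_kernel_box_tendsto: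
  fixes u :: "real^'d::finite \<Rightarrow> complex"
  assumes u_meas [measurable]: "u \<in> borel_measurable borel" and u: "\<And>x. norm (u x) \<le> B"
    and r: "r \<longlonglongrightarrow> 0" "\<And>n. 0 < r n" and L: "0 < L"
  shows "(\<lambda>n. LINT x|lborel. indicator (box a b) x * (LINT y|lborel. u y * lowpass_kernel L (r n) (x - y)))
    \<longlonglongrightarrow> (LINT x|lborel. indicator (box a b) x * u x)"
proof -
  define J where "J j n = (LINT x|lborel. indicator (box a b) x * (LINT y|lborel. u y * heat_kernel (real j * (r n)\<^sup>2) (x - y)))" for j n
  have J_lim: "J j \<longlonglongrightarrow> (LINT x|lborel. indicator (box a b) x * u x)" if "j \<in> {1..L}" for j
  proof -
    have "(\<lambda>n. sqrt (real j) * r n) \<longlonglongrightarrow> 0"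
      using tendsto_mult_right_zero[OF r(1)] .
    moreover have "0 < sqrt (real j) * r n" for n using that r(2) by simp
    moreover have "(sqrt (real j) * r n)\<^sup>2 = real j * (r n)\<^sup>2" for n by (simp add: power_mult_distrib)
    ultimately show ?thesis
      using heat_kernel_box_tendsto[OF u_meas u, of "\<lambda>n. sqrt (real j) * r n" a b] by (simp add: J_def[abs_def])
  qed
  have int: "integrable lborel (\<lambda>x. indicator (box a b) x * (LINT y|lborel. u y * heat_kernel (real j * (r n)\<^sup>2) (x - y)))"
    if "j \<in> {1..L}" for j n
    by (rule integrable_indicator_box[of _ B]) (measurable, use that r(2) in \<open>auto intro!: heat_convolution_bound[OF u_meas u] mult_pos_pos zero_less_power\<close>)
  have eq: "(LINT x|lborel. indicator (box a b) x * (LINT y|lborel. u y * lowpass_kernel L (r n) (x - y)))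
      = (\<Sum>j=1..L. lowpass_coeff L j * J j n)" for n
  proof -
    have "(LINT x|lborel. indicator (box a b) x * (LINT y|lborel. u y * lowpass_kernel L (r n) (x - y)))
      = (LINT x|lborel. (\<Sum>j=1..L. lowpass_coeff L j * (indicator (box a b) x * (LINT y|lborel. u y * heat_kernel (real j * (r n)\<^sup>2) (x - y)))))"
      unfolding lowpass_convolution_eq[OF u_meas u r(2)] by (simp add: sum_distrib_left mult_ac)
    also have "\<dots> = (\<Sum>j=1..L. LINT x|lborel. lowpass_coeff L j * (indicator (box a b) x * (LINT y|lborel. u y * heat_kernel (real j * (r n)\<^sup>2) (x - y))))"
      by (rule Bochner_Integration.integral_sum) (intro integrable_mult_right int)
    finally show ?thesis by (simp add: J_def)
  qed
  have "(\<lambda>n. \<Sum>j=1..L. lowpass_coeff L j * J j n) \<longlonglongrightarrow> (\<Sum>j=1..L. lowpass_coeff L j * (LINT x|lborel. indicator (box a b) x * u x))"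
    by (intro tendsto_intros J_lim)
  then show ?thesis
    unfolding eq sum_distrib_right[symmetric] by (simp only: sum_lowpass_coeff[OF L] mult_1_left)
qed

section \<open>The integral equation\<close>

lemma convolution_reflect:
  fixes f k :: "'a::euclidean_space \<Rightarrow> complex"
  shows "(LINT y|lborel. f y * k (x - y)) = (LINT s|lborel. f (x - s) * k s)"
  using integral_reflect[of "\<lambda>s. f (x - s) * k s" x] by simp

text \<open>The terms form a geometric series of ratio 2^(-\<theta>), proportional to r^\<theta>; a
  small r makes the whole sum small.\<close>

lemma geometric_radius_bound:
  fixes C \<theta> \<delta> :: real
  assumes "0 \<le> C" "0 < \<theta>" "0 < \<delta>"
  shows "\<exists>r. 0 < r \<and> r \<le> 1 \<and> summable (\<lambda>i. C * (r / 2 ^ i) powr \<theta>) \<and> (\<Sum>i. C * (r / 2 ^ i) powr \<theta>) \<le> \<delta>"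
proof -
  define a where "a = 2 powr (- \<theta>)"
  have a: "0 < a" "a < 1" using assms(2) by (auto simp: a_def powr_less_one)
  have eq: "C * (r / 2 ^ i) powr \<theta> = C * r powr \<theta> * a ^ i" if "0 < r" for r i
  proof -
    have "(2 ^ i) powr \<theta> = (2 powr \<theta>) ^ i"
      by (simp add: powr_realpow[symmetric] powr_powr mult.commute)
    moreover have "(r / 2 ^ i) powr \<theta> = r powr \<theta> / (2 ^ i) powr \<theta>"
      by (rule powr_divide)
    ultimately show ?thesis
      by (simp add: a_def powr_minus power_inverse divide_inverse)
  qed
  \<comment> \<open>Chosen so that (C + 1) r^\<theta> / (1 - a) \<le> \<delta>; C + 1 instead of C
    avoids division by zero.\<close>
  define r where "r = min 1 ((\<delta> * (1 - a) / (C + 1)) powr (1 / \<theta>))"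
  have pos: "0 < \<delta> * (1 - a) / (C + 1)" using a assms by simp
  then have r: "0 < r" "r \<le> 1" using a assms by (auto simp: r_def)
  have "r powr \<theta> \<le> ((\<delta> * (1 - a) / (C + 1)) powr (1 / \<theta>)) powr \<theta>"
    using r assms(2) by (intro powr_mono2) (auto simp: r_def)
  also have "\<dots> = \<delta> * (1 - a) / (C + 1)"
  proof -
    have "(x powr (1 / \<theta>)) powr \<theta> = x" if "0 < x" for x :: real
      using that assms(2) by (simp add: powr_powr)
    from this[OF pos] show ?thesis .
  qed
  finally have le: "r powr \<theta> \<le> \<delta> * (1 - a) / (C + 1)" .
  have sums: "(\<lambda>i. C * (r / 2 ^ i) powr \<theta>) sums (C * r powr \<theta> * (1 / (1 - a)))"
    unfolding eq[OF r(1)] using a by (intro sums_mult geometric_sums) simp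
  have "C * r powr \<theta> * (1 / (1 - a)) \<le> (C + 1) * (\<delta> * (1 - a) / (C + 1)) * (1 / (1 - a))"
    using le a assms by (intro mult_right_mono mult_mono) auto
  also have "\<dots> = \<delta>" using a assms by simp
  finally show ?thesis
    using r sums_summable[OF sums] sums_unique[OF sums] by auto
qed

text \<open>The band identities at the scales r / 2^i telescope. The low-pass convolutions at scale
  r / 2^n therefore converge pointwise to V, the right-hand side of the equation. They also converge
  to u when tested against boxes, and the two limits agree almost everywhere.\<close>

lemma integral_equation:
  fixes p q u :: "real^'d::finite \<Rightarrow> complex" and F :: "complex \<Rightarrow> complex" and L :: nat
  assumes q: "symbol_family {()} (\<lambda>_ \<xi>. japanese_bracket \<xi> powr (- M)) (\<lambda>_. q)" and M: "0 < M"
    and q_meas [measurable]: "q \<in> borel_measurable borel" and pq: "\<And>\<xi>. p \<xi> * q \<xi> = 1"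
    and u_meas [measurable]: "u \<in> borel_measurable borel" and u: "\<And>x. norm (u x) \<le> B"
    and Fu_meas [measurable]: "(\<lambda>x. F (u x)) \<in> borel_measurable borel" and Fu: "\<And>x. norm (F (u x)) \<le> B'"
    and sol: "distribution_solution p F u"
    and L: "CARD('d) + 3 \<le> L" and \<delta>: "0 < \<delta>"
  shows "\<exists>r k. 0 < r \<and> integrable lborel k \<and> (LINT x|lborel. norm (k x)) \<le> \<delta> \<and>
    (AE x in lborel. u x = (LINT y|lborel. u y * lowpass_kernel L r (x - y)) + (LINT s|lborel. F (u (x - s)) * k s))"
proof -
  define \<theta> where "\<theta> = min M 1"
  have \<theta>: "0 < \<theta>" using M by (simp add: \<theta>_def)
  obtain C where C: "0 \<le> C" and ex: "\<And>r. 0 < r \<Longrightarrow> r \<le> 1 \<Longrightarrow> \<exists>\<kappa>. integrable lborel \<kappa> \<and>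
      (LINT x|lborel. norm (\<kappa> x)) \<le> C * r powr \<theta> \<and>
      (\<forall>x. (LINT y|lborel. u y * inverse_fourier (\<lambda>\<xi>. bandpass L (r *\<^sub>R \<xi>)) (x - y)) = (LINT y|lborel. F (u y) * \<kappa> (x - y)))"
    using band_identity[OF q M q_meas pq u_meas u Fu_meas Fu sol L] unfolding \<theta>_def by blast
  obtain r where r: "0 < r" "r \<le> 1" and sum: "summable (\<lambda>i. C * (r / 2 ^ i) powr \<theta>)"
    and le: "(\<Sum>i. C * (r / 2 ^ i) powr \<theta>) \<le> \<delta>"
    using geometric_radius_bound[OF C \<theta> \<delta>] by blast
  have ri: "0 < r / 2 ^ i" "r / 2 ^ i \<le> 1" for i :: nat
  proof -
    show "0 < r / 2 ^ i" using r by simp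
    have "r \<le> 1 * 2 ^ i" using r(2) one_le_power[of "2::real" i] by linarith
    then show "r / 2 ^ i \<le> 1" by (simp add: divide_le_eq)
  qed
  obtain \<kappa> where \<kappa>: "\<And>i. integrable lborel (\<kappa> i)" "\<And>i. (LINT x|lborel. norm (\<kappa> i x)) \<le> C * (r / 2 ^ i) powr \<theta>"
    "\<And>i x. (LINT y|lborel. u y * inverse_fourier (\<lambda>\<xi>. bandpass L ((r / 2 ^ i) *\<^sub>R \<xi>)) (x - y)) = (LINT y|lborel. F (u y) * \<kappa> i (x - y))"
    using ex[OF ri] by metis
  have sum\<kappa>: "summable (\<lambda>i. LINT x|lborel. norm (\<kappa> i x))"
    by (rule summable_comparison_test'[OF sum]) (use \<kappa>(2) in simp)
  obtain k where k: "integrable lborel k" "(LINT x|lborel. norm (k x)) \<le> (\<Sum>i. LINT x|lborel. norm (\<kappa> i x))"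
    and k_sums: "\<And>f B. f \<in> borel_measurable lborel \<Longrightarrow> (\<And>x. norm (f x) \<le> B) \<Longrightarrow>
      (\<lambda>i. LINT x|lborel. f x * \<kappa> i x) sums (LINT x|lborel. f x * k x)"
    using integrable_kernel_series[OF \<kappa>(1) sum\<kappa>] by blast
  have k_le: "(LINT x|lborel. norm (k x)) \<le> \<delta>"
    using k(2) suminf_le[OF \<kappa>(2) sum\<kappa> sum] le by linarith
  have B0: "0 \<le> B" "0 \<le> B'" using order_trans[OF norm_ge_zero u] order_trans[OF norm_ge_zero Fu] .
  define U where "U s x = (LINT y|lborel. u y * lowpass_kernel L s (x - y))" for s x
  have U_meas [measurable]: "U s \<in> borel_measurable borel" for s
    unfolding U_def[abs_def] by measurable
  have U_le: "norm (U s x) \<le> 2 ^ L * B" if "0 < s" for s x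
    unfolding U_def by (rule lowpass_convolution_bound[OF u_meas u that])
  have int_lp: "integrable lborel (\<lambda>y. u y * lowpass_kernel L s (x - y))" if "0 < s" for s x
    by (rule integrable_bounded_mult[OF _ u integrable_reflect[OF lowpass_kernel_integrable[OF that]]]) measurable
  have step: "(LINT s|lborel. F (u (x - s)) * \<kappa> i s) = U (r / 2 ^ Suc i) x - U (r / 2 ^ i) x" for i x
  proof -
    have half: "r / 2 ^ i / 2 = r / 2 ^ Suc i" by simp
    have "(LINT s|lborel. F (u (x - s)) * \<kappa> i s) = (LINT y|lborel. F (u y) * \<kappa> i (x - y))"
      by (rule convolution_reflect[of "\<lambda>y. F (u y)", symmetric])
    also have "\<dots> = (LINT y|lborel. u y * lowpass_kernel L (r / 2 ^ Suc i) (x - y) - u y * lowpass_kernel L (r / 2 ^ i) (x - y))"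
      unfolding \<kappa>(3)[symmetric] inverse_fourier_bandpass[OF ri(1)] half by (simp only: right_diff_distrib)
    also have "\<dots> = U (r / 2 ^ Suc i) x - U (r / 2 ^ i) x"
      unfolding U_def by (rule Bochner_Integration.integral_diff[OF int_lp[OF ri(1)] int_lp[OF ri(1)]])
    finally show ?thesis .
  qed
  define V where "V x = U r x + (LINT s|lborel. F (u (x - s)) * k s)" for x
  have k_meas [measurable]: "k \<in> borel_measurable borel" using borel_measurable_integrable[OF k(1)] by simp
  have Fu_meas2 [measurable]: "(\<lambda>(x, s). F (u (x - s))) \<in> borel_measurable (borel \<Otimes>\<^sub>M borel)"
    using measurable_compose[OF _ Fu_meas, of "\<lambda>(x, s). x - s" "borel \<Otimes>\<^sub>M borel"] by (simp add: case_prod_unfold)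
  have V_meas [measurable]: "V \<in> borel_measurable borel"
    unfolding V_def[abs_def] by measurable
  have U_lim: "(\<lambda>n. U (r / 2 ^ n) x) \<longlonglongrightarrow> V x" for x
  proof -
    have "(\<lambda>i. LINT s|lborel. F (u (x - s)) * \<kappa> i s) sums (LINT s|lborel. F (u (x - s)) * k s)"
      by (rule k_sums[of _ B']) (measurable, rule Fu)
    then have "(\<lambda>n. \<Sum>i<n. U (r / 2 ^ Suc i) x - U (r / 2 ^ i) x) \<longlonglongrightarrow> (LINT s|lborel. F (u (x - s)) * k s)"
      by (simp only: step sums_def)
    then have "(\<lambda>n. U (r / 2 ^ n) x - U (r / 2 ^ 0) x) \<longlonglongrightarrow> (LINT s|lborel. F (u (x - s)) * k s)"
      by (simp only: sum_lessThan_telescope[of "\<lambda>i. U (r / 2 ^ i) x"])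
    from tendsto_add[OF tendsto_const[of "U r x"] this] show ?thesis
      by (simp add: V_def)
  qed
  have V_le: "norm (V x) \<le> 2 ^ L * B" for x
    by (rule tendsto_upperbound[OF tendsto_norm[OF U_lim]]) (auto intro!: always_eventually U_le ri)
  have "AE x in lborel. u x - V x = 0"
  \<comment> \<open>Pointwise bounded convergence and weak convergence give the same integral over
    every box.\<close>
  proof (rule AE_zero_of_box_integrals)
    show "norm (u x - V x) \<le> B + 2 ^ L * B" for x
      using norm_triangle_ineq4[of "u x" "V x"] u[of x] V_le[of x] by linarith
    fix a b :: "real^'d"
    have int_u: "integrable lborel (\<lambda>x. indicator (box a b) x * u x)" by (rule integrable_indicator_box[OF u_meas u])
    have int_V: "integrable lborel (\<lambda>x. indicator (box a b) x * V x)" by (rule integrable_indicator_box[OF V_meas V_le])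
    have r_lim: "(\<lambda>n. r / 2 ^ n) \<longlonglongrightarrow> 0"
    proof -
      have "(\<lambda>n. r * (1 / 2) ^ n) \<longlonglongrightarrow> 0"
        by (rule tendsto_mult_right_zero[OF LIMSEQ_realpow_zero]) auto
      then show ?thesis by (simp add: power_one_over)
    qed
    have "(\<lambda>n. LINT x|lborel. indicator (box a b) x * U (r / 2 ^ n) x) \<longlonglongrightarrow> (LINT x|lborel. indicator (box a b) x * u x)"
      unfolding U_def by (rule lowpass_kernel_box_tendsto[OF u_meas u r_lim ri(1)]) (use L in simp)
    moreover have "(\<lambda>n. LINT x|lborel. indicator (box a b) x * U (r / 2 ^ n) x) \<longlonglongrightarrow> (LINT x|lborel. indicator (box a b) x * V x)"
    proof (rule integral_dominated_convergence[where w="\<lambda>x. norm (indicator (box a b) x * (of_real (2 ^ L * B) :: complex))"])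
      show "integrable lborel (\<lambda>x. norm (indicator (box a b) x * (of_real (2 ^ L * B) :: complex)))"
        by (intro integrable_norm integrable_indicator_box[of _ "2 ^ L * B"]) (use B0 in \<open>auto simp: norm_mult norm_power\<close>)
      show "AE x in lborel. (\<lambda>n. indicator (box a b) x * U (r / 2 ^ n) x) \<longlonglongrightarrow> indicator (box a b) x * V x"
        by (intro AE_I2 tendsto_intros U_lim)
      show "AE x in lborel. norm (indicator (box a b) x * U (r / 2 ^ n) x) \<le> norm (indicator (box a b) x * (of_real (2 ^ L * B) :: complex))" for n
        using U_le[OF ri(1)] B0 by (intro AE_I2) (auto simp: norm_mult norm_power indicator_def)
    qed measurable
    ultimately have "(LINT x|lborel. indicator (box a b) x * u x) = (LINT x|lborel. indicator (box a b) x * V x)"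
      by (rule LIMSEQ_unique)
    then show "(LINT x|lborel. indicator (box a b) x * (u x - V x)) = 0"
      unfolding right_diff_distrib by (simp add: Bochner_Integration.integral_diff[OF int_u int_V])
  qed measurable
  then have "AE x in lborel. u x = (LINT y|lborel. u y * lowpass_kernel L r (x - y)) + (LINT s|lborel. F (u (x - s)) * k s)"
    by eventually_elim (simp add: V_def U_def)
  with r(1) k(1) k_le show ?thesis by blast
qed

section \<open>Holomorphic functions on a strip\<close>

text \<open>Additivity is part of being a Frechet derivative, so only complex homogeneity is
  recorded. The pointwise form suits closure rules.\<close>

definition holomorphic_at_vec :: "(complex^'d::finite \<Rightarrow> complex) \<Rightarrow> complex^'d \<Rightarrow> bool" where
  "holomorphic_at_vec f z \<longleftrightarrow> (\<exists>L. (f has_derivative L) (at z) \<and> (\<forall>c h. L (c *s h) = c * L h))"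

lemma linear_vec_complex_iff:
  fixes L :: "complex^'d::finite \<Rightarrow> complex"
  assumes "bounded_linear L"
  shows "Vector_Spaces.linear (*s) (*) L \<longleftrightarrow> (\<forall>c h. L (c *s h) = c * L h)"
proof
  assume "Vector_Spaces.linear (*s) (*) L"
  then interpret Vector_Spaces.linear "(*s)" "(*)" L .
  show "\<forall>c h. L (c *s h) = c * L h" using scale by blast
next
  interpret bounded_linear L by fact
  assume "\<forall>c h. L (c *s h) = c * L h"
  then show "Vector_Spaces.linear (*s) (*) L"
    by (unfold_locales) (auto simp: add vec.scale_right_distrib vec.scale_left_distrib algebra_simps)
qed

lemma holomorphic_on_vec_iff: "holomorphic_on_vec f \<Omega> \<longleftrightarrow> (\<forall>z\<in>\<Omega>. holomorphic_at_vec f z)"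
  unfolding holomorphic_on_vec_def holomorphic_at_vec_def
  by (metis has_derivative_bounded_linear linear_vec_complex_iff)

lemma holomorphic_at_vec_const: "holomorphic_at_vec (\<lambda>_. c) z"
  unfolding holomorphic_at_vec_def by (intro exI[of _ "\<lambda>_. 0"]) auto

lemma holomorphic_at_vec_nth: "holomorphic_at_vec (\<lambda>z. z $ i) z"
  unfolding holomorphic_at_vec_def
  by (intro exI[of _ "\<lambda>h. h $ i"]) (auto intro!: bounded_linear_imp_has_derivative bounded_linear_vec_nth)

lemma holomorphic_at_vec_add:
  assumes "holomorphic_at_vec f z" "holomorphic_at_vec g z"
  shows "holomorphic_at_vec (\<lambda>z. f z + g z) z"
proof -
  obtain L where L: "(f has_derivative L) (at z)" "\<And>c h. L (c *s h) = c * L h"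
    using assms(1) unfolding holomorphic_at_vec_def by blast
  obtain K where K: "(g has_derivative K) (at z)" "\<And>c h. K (c *s h) = c * K h"
    using assms(2) unfolding holomorphic_at_vec_def by blast
  show ?thesis
    unfolding holomorphic_at_vec_def
    by (intro exI conjI, rule has_derivative_add[OF L(1) K(1)]) (simp add: L(2) K(2) distrib_left)
qed

lemma holomorphic_at_vec_mult:
  assumes "holomorphic_at_vec f z" "holomorphic_at_vec g z"
  shows "holomorphic_at_vec (\<lambda>z. f z * g z) z"
proof -
  obtain L where L: "(f has_derivative L) (at z)" "\<And>c h. L (c *s h) = c * L h"
    using assms(1) unfolding holomorphic_at_vec_def by blast
  obtain K where K: "(g has_derivative K) (at z)" "\<And>c h. K (c *s h) = c * K h"
    using assms(2) unfolding holomorphic_at_vec_def by blast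
  show ?thesis
    unfolding holomorphic_at_vec_def
    by (intro exI conjI, rule has_derivative_mult[OF L(1) K(1)]) (simp add: L(2) K(2) distrib_left mult_ac)
qed

lemma holomorphic_at_vec_sum:
  "(\<And>i. i \<in> I \<Longrightarrow> holomorphic_at_vec (f i) z) \<Longrightarrow> holomorphic_at_vec (\<lambda>z. \<Sum>i\<in>I. f i z) z"
  by (induction I rule: infinite_finite_induct) (auto intro: holomorphic_at_vec_const holomorphic_at_vec_add)

lemma holomorphic_at_vec_power: "holomorphic_at_vec f z \<Longrightarrow> holomorphic_at_vec (\<lambda>z. f z ^ n) z"
  by (induction n) (auto intro: holomorphic_at_vec_const holomorphic_at_vec_mult)

lemma holomorphic_at_vec_diff:
  assumes "holomorphic_at_vec f z" "holomorphic_at_vec g z"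
  shows "holomorphic_at_vec (\<lambda>z. f z - g z) z"
  using holomorphic_at_vec_add[OF assms(1) holomorphic_at_vec_mult[OF holomorphic_at_vec_const[of "-1"] assms(2)]] by simp

lemma holomorphic_at_vec_exp:
  assumes "holomorphic_at_vec f z"
  shows "holomorphic_at_vec (\<lambda>z. exp (f z)) z"
proof -
  obtain L where L: "(f has_derivative L) (at z)" "\<And>c h. L (c *s h) = c * L h"
    using assms(1) unfolding holomorphic_at_vec_def by blast
  show ?thesis
    unfolding holomorphic_at_vec_def
    by (intro exI conjI, rule has_derivative_compose[OF L(1) DERIV_exp[unfolded has_field_derivative_def]])
      (simp add: L(2) mult_ac)
qed

lemma holomorphic_at_vec_shift:
  assumes "holomorphic_at_vec f (z - a)"
  shows "holomorphic_at_vec (\<lambda>z. f (z - a)) z"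
proof -
  obtain L where L: "(f has_derivative L) (at (z - a))" "\<And>c h. L (c *s h) = c * L h"
    using assms(1) unfolding holomorphic_at_vec_def by blast
  have "((\<lambda>z. z - a) has_derivative (\<lambda>h. h)) (at z)" by (auto intro!: derivative_eq_intros)
  from has_derivative_compose[OF this L(1)] L(2) show ?thesis
    unfolding holomorphic_at_vec_def by blast
qed

definition vec_cnj :: "complex^'d::finite \<Rightarrow> complex^'d" where
  "vec_cnj z = (\<chi> j. cnj (z $ j))"

lemma norm_vec_cnj: "norm (vec_cnj z) = norm z"
  by (simp add: vec_cnj_def norm_vec_def)

lemma bounded_linear_vec_cnj: "bounded_linear vec_cnj"
proof (rule bounded_linear_intro[of _ 1])
  show "norm (vec_cnj z) \<le> norm z * 1" for z by (simp add: norm_vec_cnj)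
qed (simp_all add: vec_cnj_def vec_eq_iff)

lemma vec_cnj_embed: "vec_cnj (embed_complex x) = embed_complex x"
  by (simp add: vec_cnj_def embed_complex_def)

text \<open>Conjugating argument and value composes two antilinear maps with a complex linear
  derivative, and the result is complex linear.\<close>

lemma holomorphic_at_vec_cnj:
  assumes "holomorphic_at_vec f (vec_cnj z)"
  shows "holomorphic_at_vec (\<lambda>z. cnj (f (vec_cnj z))) z"
proof -
  obtain L where L: "(f has_derivative L) (at (vec_cnj z))" "\<And>c h. L (c *s h) = c * L h"
    using assms(1) unfolding holomorphic_at_vec_def by blast
  have "((\<lambda>z. cnj (f (vec_cnj z))) has_derivative (\<lambda>h. cnj (L (vec_cnj h)))) (at z)"
    by (intro has_derivative_cnj has_derivative_compose[OF bounded_linear_imp_has_derivative[OF bounded_linear_vec_cnj] L(1)])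
  moreover have "vec_cnj (c *s h) = cnj c *s vec_cnj h" for c and h :: "complex^'a"
    by (simp add: vec_cnj_def vec_eq_iff)
  ultimately show ?thesis
    unfolding holomorphic_at_vec_def using L(2) by (intro exI[of _ "\<lambda>h. cnj (L (vec_cnj h))"]) simp
qed

lemma norm_vector_scalar_mult: "norm (c *s (h::complex^'d::finite)) = norm c * norm h"
  by (simp add: norm_vec_def norm_mult L2_set_right_distrib)

lemma vector_scalar_mult_of_real: "of_real t *s (h::complex^'d::finite) = t *\<^sub>R h"
proof -
  have "complex_of_real t * h $ i = t *\<^sub>R (h $ i)" for i
    by (simp add: scaleR_conv_of_real)
  then show ?thesis by (simp add: vec_eq_iff)
qed

text \<open>Cauchy's estimates on the complex line through \<open>z\<close> in the direction \<open>h\<close>.\<close>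

lemma holomorphic_vec_estimates:
  fixes f :: "complex^'d::finite \<Rightarrow> complex"
  assumes holo: "\<And>w. w \<in> ball z r \<Longrightarrow> holomorphic_at_vec f w"
    and bound: "\<And>w. w \<in> ball z r \<Longrightarrow> norm (f w) \<le> B"
    and L: "(f has_derivative L) (at z)" "\<And>c h. L (c *s h) = c * L h"
    and h: "norm h < r / 2"
  shows "norm (L h) \<le> 2 * B * norm h / r"
    and "norm (f (z + h) - f z - L h) \<le> (norm h)\<^sup>2 * (8 * B / r\<^sup>2)"
proof -
  have "norm (L h) \<le> 2 * B * norm h / r \<and> norm (f (z + h) - f z - L h) \<le> (norm h)\<^sup>2 * (8 * B / r\<^sup>2)"
  proof (cases "h = 0")
    case True
    then show ?thesis using linear_0[OF has_derivative_linear[OF L(1)]] by simp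
  next
    case False
    \<comment> \<open>On the line the ball becomes the disc of radius \<rho> > 2. Discs of radius
      \<rho>/2 about points of the unit disc stay inside it, and h corresponds to the parameter
      1.\<close>
    define \<rho> where "\<rho> = r / norm h"
    have \<rho>: "2 < \<rho>" using h False by (simp add: \<rho>_def field_simps)
    define g where "g \<zeta> = f (z + \<zeta> *s h)" for \<zeta>
    have in_ball: "z + \<zeta> *s h \<in> ball z r" if "norm \<zeta> < \<rho>" for \<zeta>
      using that False by (simp add: dist_norm norm_vector_scalar_mult \<rho>_def field_simps)
    have line: "((\<lambda>\<zeta>. z + \<zeta> *s h) has_derivative (\<lambda>\<mu>. \<mu> *s h)) (at \<zeta>)" for \<zeta>
    proof -
      have "bounded_linear (\<lambda>\<mu>::complex. \<mu> *s h)"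
        by (rule bounded_linear_intro[of _ "norm h"])
          (auto simp: norm_vector_scalar_mult vec_eq_iff algebra_simps)
      then show ?thesis
        by (auto intro!: derivative_eq_intros bounded_linear_imp_has_derivative)
    qed
    have g_der: "(g has_field_derivative K h) (at \<zeta>)"
      if "(f has_derivative K) (at (z + \<zeta> *s h))" "\<And>c h. K (c *s h) = c * K h" for K \<zeta>
    proof -
      have "(\<lambda>\<mu>. K (\<mu> *s h)) = (*) (K h)"
        by (rule ext) (simp add: that(2))
      with has_derivative_compose[OF line that(1)] show ?thesis
        unfolding g_def has_field_derivative_def by simp
    qed
    have g_holo: "g holomorphic_on ball 0 \<rho>"
      unfolding holomorphic_on_open[OF open_ball]
      using g_der in_ball holo unfolding holomorphic_at_vec_def by (metis mem_ball_0)
    have cball_sub: "cball w (\<rho> / 2) \<subseteq> ball 0 \<rho>" if "norm w \<le> 1" for w :: complex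
    proof
      fix x assume "x \<in> cball w (\<rho> / 2)"
      then have "norm (x - w) \<le> \<rho> / 2" by (simp add: dist_norm norm_minus_commute)
      then have "norm x \<le> norm w + \<rho> / 2" using norm_triangle_ineq[of "x - w" w] by simp
      then show "x \<in> ball 0 \<rho>" using that \<rho> by simp
    qed
    have cauchy: "norm ((deriv ^^ n) g w) \<le> fact n * B / (\<rho> / 2) ^ n" if "norm w \<le> 1" for n w
    proof (rule Cauchy_inequality)
      show "g holomorphic_on ball w (\<rho> / 2)"
        using cball_sub[OF that] ball_subset_cball by (intro holomorphic_on_subset[OF g_holo]) blast
      show "continuous_on (cball w (\<rho> / 2)) g"
        using cball_sub[OF that] by (intro holomorphic_on_imp_continuous_on holomorphic_on_subset[OF g_holo])
      show "norm (g x) \<le> B" if x: "norm (w - x) = \<rho> / 2" for x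
      proof -
        have "x \<in> ball 0 \<rho>" using cball_sub[OF \<open>norm w \<le> 1\<close>] x by (auto simp: dist_norm)
        then show ?thesis unfolding g_def by (intro bound in_ball) simp
      qed
    qed (use \<rho> in simp)
    have g0: "(g has_field_derivative L h) (at 0)"
      by (rule g_der) (use L in simp_all)
    then have d0: "deriv g 0 = L h" by (rule DERIV_imp_deriv)
    from cauchy[of 0 1] have "norm (L h) \<le> 2 * B * norm h / r"
      using False by (simp add: d0 \<rho>_def mult_ac)
    moreover
    \<comment> \<open>First-order Taylor formula from 0 to 1, with the second derivative bounded on
      the unit disc by Cauchy's inequality.\<close>
    have "norm ((deriv ^^ 0) g 1 - (\<Sum>i\<le>1. (deriv ^^ i) g 0 * (1 - 0) ^ i / fact i)) \<le> (2 * B / (\<rho> / 2)\<^sup>2) * norm (1 - 0 :: complex) ^ Suc 1 / fact 1"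
    proof (rule complex_Taylor[where S="cball 0 1" and f="\<lambda>i. (deriv ^^ i) g"])
      fix i and x :: complex assume x: "x \<in> cball 0 1"
      then have "x \<in> ball 0 \<rho>" using \<rho> by simp
      then have "((deriv ^^ i) g has_field_derivative deriv ((deriv ^^ i) g) x) (at x)"
        by (intro holomorphic_derivI[OF holomorphic_higher_deriv[OF g_holo]]) auto
      then show "((deriv ^^ i) g has_field_derivative (deriv ^^ Suc i) g x) (at x within cball 0 1)"
        by (simp add: has_field_derivative_at_within)
      show "norm ((deriv ^^ Suc 1) g x) \<le> 2 * B / (\<rho> / 2)\<^sup>2"
        using cauchy[of x 2] x by (simp add: numeral_2_eq_2)
    qed auto
    then have "norm (f (z + h) - f z - L h) \<le> (norm h)\<^sup>2 * (8 * B / r\<^sup>2)"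
    proof -
      assume "norm ((deriv ^^ 0) g 1 - (\<Sum>i\<le>1. (deriv ^^ i) g 0 * (1 - 0) ^ i / fact i)) \<le> (2 * B / (\<rho> / 2)\<^sup>2) * norm (1 - 0 :: complex) ^ Suc 1 / fact 1"
      then have "norm (g 1 - g 0 - L h) \<le> 2 * B / (\<rho> / 2)\<^sup>2"
        by (simp add: d0 diff_diff_eq)
      moreover have "2 * B / (\<rho> / 2)\<^sup>2 = (norm h)\<^sup>2 * (8 * B / r\<^sup>2)"
        by (simp add: \<rho>_def power_divide)
      ultimately show ?thesis by (simp add: g_def)
    qed
    ultimately show ?thesis by blast
  qed
  then show "norm (L h) \<le> 2 * B * norm h / r" "norm (f (z + h) - f z - L h) \<le> (norm h)\<^sup>2 * (8 * B / r\<^sup>2)" by auto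
qed

text \<open>Only the functions themselves need an integrable majorant: Cauchy's estimates convert it
  into majorants of the derivative and of the quadratic remainder. The measure is arbitrary, so with
  counting measure the lemma also covers series.\<close>

lemma holomorphic_at_vec_integral:
  fixes f :: "complex^'d::finite \<Rightarrow> 'a \<Rightarrow> complex"
  assumes r: "0 < r"
    and meas: "\<And>z. z \<in> ball z0 r \<Longrightarrow> f z \<in> borel_measurable M"
    and holo: "\<And>z s. z \<in> ball z0 r \<Longrightarrow> s \<in> space M \<Longrightarrow> holomorphic_at_vec (\<lambda>z. f z s) z"
    and bound: "\<And>z s. z \<in> ball z0 r \<Longrightarrow> s \<in> space M \<Longrightarrow> norm (f z s) \<le> B s"
    and B: "integrable M B"
  shows "holomorphic_at_vec (\<lambda>z. LINT s|M. f z s) z0"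
proof -
  have z0: "z0 \<in> ball z0 r" using r by simp
  obtain L where L: "\<And>s. s \<in> space M \<Longrightarrow> ((\<lambda>z. f z s) has_derivative L s) (at z0)"
    "\<And>s c h. s \<in> space M \<Longrightarrow> L s (c *s h) = c * L s h"
    using holo[OF z0] unfolding holomorphic_at_vec_def by metis
  have L_scale: "L s (t *\<^sub>R h) = of_real t * L s h" if "s \<in> space M" for s t h
    using L(2)[OF that, of "of_real t" h] by (simp add: vector_scalar_mult_of_real)
  note est = holomorphic_vec_estimates[OF holo bound L]
  have L_bound: "norm (L s h) \<le> 2 * B s * norm h / r" if s: "s \<in> space M" for s h
  proof (cases "h = 0")
    case True
    then show ?thesis using L_scale[OF s, of 0 0] by simp
  next
    case False
    \<comment> \<open>Scales h to length r/4, inside the range of the estimates; linearity then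
      removes the restriction on h.\<close>
    define t where "t = r / (4 * norm h)"
    have t: "0 < t" using r False by (simp add: t_def)
    have "norm (L s (t *\<^sub>R h)) \<le> 2 * B s * norm (t *\<^sub>R h) / r"
      by (rule est(1)) (use s t r False in \<open>auto simp: t_def\<close>)
    then have "t * norm (L s h) \<le> t * (2 * B s * norm h / r)"
      using t by (simp add: L_scale[OF s] norm_mult mult_ac)
    from mult_left_le_imp_le[OF this t] show ?thesis .
  qed
  \<comment> \<open>The derivatives were chosen separately for each s; measurability is recovered
    from difference quotients.\<close>
  have L_meas: "(\<lambda>s. L s h) \<in> borel_measurable M" for h
  proof -
    define t where "t n = r / (4 * (norm h + 1)) * (1 / real (Suc n))" for n
    have t_pos: "0 < t n" for n using r by (simp add: t_def add_nonneg_pos)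
    have t_lim: "t \<longlonglongrightarrow> 0"
      unfolding t_def by (rule tendsto_mult_right_zero[OF LIMSEQ_Suc[OF lim_1_over_n]])
    have t_small: "norm (t n *\<^sub>R h) < r / 2" for n
    proof -
      have "t n * norm h \<le> r / (4 * (norm h + 1)) * 1 * norm h"
        unfolding t_def using r by (intro mult_right_mono mult_left_mono) (auto simp: add_nonneg_nonneg)
      also have "\<dots> \<le> r / 4" using r by (simp add: field_simps add_pos_nonneg)
      finally show ?thesis using t_pos[of n] r by simp
    qed
    have in_ball: "z0 + t n *\<^sub>R h \<in> ball z0 r" for n
      using t_small[of n] r by (simp add: dist_norm)
    show ?thesis
    proof (rule borel_measurable_LIMSEQ_metric)
      show "(\<lambda>s. (f (z0 + t n *\<^sub>R h) s - f z0 s) / of_real (t n)) \<in> borel_measurable M" for n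
        using meas[OF in_ball[of n]] meas[OF z0] by measurable
      fix s assume s: "s \<in> space M"
      have "norm ((f (z0 + t n *\<^sub>R h) s - f z0 s) / of_real (t n) - L s h) \<le> t n * ((norm h)\<^sup>2 * (8 * B s / r\<^sup>2))" for n
      proof -
        have "(f (z0 + t n *\<^sub>R h) s - f z0 s) / of_real (t n) - L s h = (f (z0 + t n *\<^sub>R h) s - f z0 s - L s (t n *\<^sub>R h)) / of_real (t n)"
          using t_pos[of n] by (simp add: L_scale[OF s] field_simps)
        then have "norm ((f (z0 + t n *\<^sub>R h) s - f z0 s) / of_real (t n) - L s h)
          = norm (f (z0 + t n *\<^sub>R h) s - f z0 s - L s (t n *\<^sub>R h)) / t n"
          using t_pos[of n] by (simp add: norm_divide)
        also have "\<dots> \<le> (norm (t n *\<^sub>R h))\<^sup>2 * (8 * B s / r\<^sup>2) / t n"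
          using t_pos[of n] by (intro divide_right_mono est(2)) (use s t_small[of n] in auto)
        also have "\<dots> = t n * ((norm h)\<^sup>2 * (8 * B s / r\<^sup>2))"
          using t_pos[of n] by (simp add: power_mult_distrib power2_eq_square)
        finally show ?thesis .
      qed
      moreover have "(\<lambda>n. t n * ((norm h)\<^sup>2 * (8 * B s / r\<^sup>2))) \<longlonglongrightarrow> 0"
        by (rule tendsto_mult_left_zero[OF t_lim])
      ultimately have "(\<lambda>n. (f (z0 + t n *\<^sub>R h) s - f z0 s) / of_real (t n) - L s h) \<longlonglongrightarrow> 0"
        by (rule Lim_null_comparison[OF always_eventually[OF allI]])
      then show "(\<lambda>n. (f (z0 + t n *\<^sub>R h) s - f z0 s) / of_real (t n)) \<longlonglongrightarrow> L s h"
        by (simp only: LIM_zero_iff)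
    qed
  qed
  have L_int: "integrable M (\<lambda>s. L s h)" for h
  proof (rule Bochner_Integration.integrable_bound)
    show "integrable M (\<lambda>s. B s * (2 * norm h / r))" using B by simp
    show "AE s in M. norm (L s h) \<le> norm (B s * (2 * norm h / r))"
    proof (rule AE_I2)
      fix s assume s: "s \<in> space M"
      have "norm (L s h) \<le> B s * (2 * norm h / r)" using L_bound[OF s, of h] by (simp add: mult_ac)
      then show "norm (L s h) \<le> norm (B s * (2 * norm h / r))"
        unfolding real_norm_def by (rule order_trans[OF _ abs_ge_self])
    qed
  qed (rule L_meas)
  have f_int: "integrable M (f z)" if "z \<in> ball z0 r" for z
  proof (rule Bochner_Integration.integrable_bound[OF B meas[OF that] AE_I2])
    fix s assume "s \<in> space M"
    from bound[OF that this] show "norm (f z s) \<le> norm (B s)" by simp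
  qed
  define K where "K h = (LINT s|M. L s h)" for h
  have K_scale: "K (c *s h) = c * K h" for c h
  proof -
    have "K (c *s h) = (LINT s|M. c * L s h)"
      unfolding K_def by (rule Bochner_Integration.integral_cong) (auto simp: L(2))
    then show ?thesis by (simp add: K_def)
  qed
  have bl: "bounded_linear K"
  proof (rule bounded_linear_intro[of _ "(LINT s|M. B s) * (2 / r)"])
    show "K (x + y) = K x + K y" for x y
    proof -
      have "K (x + y) = (LINT s|M. L s x + L s y)"
        unfolding K_def
        by (rule Bochner_Integration.integral_cong) (auto simp: linear_add[OF has_derivative_linear[OF L(1)]])
      then show ?thesis unfolding K_def by (simp add: Bochner_Integration.integral_add[OF L_int L_int])
    qed
    show "K (t *\<^sub>R x) = t *\<^sub>R K x" for t x
      using K_scale[of "of_real t" x] by (simp add: vector_scalar_mult_of_real scaleR_conv_of_real)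
    show "norm (K x) \<le> norm x * ((LINT s|M. B s) * (2 / r))" for x
    proof -
      have "norm (K x) \<le> (LINT s|M. norm (L s x))" unfolding K_def by (rule integral_norm_bound)
      also have "\<dots> \<le> (LINT s|M. B s * (2 * norm x / r))"
        by (rule Bochner_Integration.integral_mono) (use L_int B L_bound in \<open>auto simp: mult_ac\<close>)
      finally show ?thesis by (simp add: mult_ac)
    qed
  qed
  have "((\<lambda>z. LINT s|M. f z s) has_derivative K) (at z0)"
  proof (rule has_derivative_of_square_remainder[OF bl, of "r / 2" _ _ "(LINT s|M. B s) * (8 / r\<^sup>2)"])
    fix h :: "complex^'d" assume h: "norm h < r / 2"
    have h_ball: "z0 + h \<in> ball z0 r" using h r by (simp add: dist_norm)
    have "norm ((LINT s|M. f (z0 + h) s) - (LINT s|M. f z0 s) - K h) = norm (LINT s|M. f (z0 + h) s - f z0 s - L s h)"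
      unfolding K_def
      by (simp only: Bochner_Integration.integral_diff[OF Bochner_Integration.integrable_diff[OF f_int[OF h_ball] f_int[OF z0]] L_int]
          Bochner_Integration.integral_diff[OF f_int[OF h_ball] f_int[OF z0]])
    also have "\<dots> \<le> (LINT s|M. norm (f (z0 + h) s - f z0 s - L s h))" by (rule integral_norm_bound)
    also have "\<dots> \<le> (LINT s|M. B s * ((norm h)\<^sup>2 * (8 / r\<^sup>2)))"
    proof (rule Bochner_Integration.integral_mono)
      show "integrable M (\<lambda>s. norm (f (z0 + h) s - f z0 s - L s h))"
        by (intro integrable_norm Bochner_Integration.integrable_diff f_int h_ball z0 L_int)
      show "norm (f (z0 + h) s - f z0 s - L s h) \<le> B s * ((norm h)\<^sup>2 * (8 / r\<^sup>2))" if "s \<in> space M" for s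
        using est(2)[OF _ that _ that that that h] by (simp add: mult_ac)
    qed (use B in simp)
    finally show "norm ((LINT s|M. f (z0 + h) s) - (LINT s|M. f z0 s) - K h) \<le> (norm h)\<^sup>2 * ((LINT s|M. B s) * (8 / r\<^sup>2))"
      by (simp add: mult_ac)
  qed (use r in simp)
  with K_scale show ?thesis unfolding holomorphic_at_vec_def by blast
qed

section \<open>Geometry of the complex strip\<close>

lemma embed_complex_nth [simp]: "embed_complex x $ j = of_real (x $ j)"
  by (simp add: embed_complex_def)

definition vec_Re :: "complex^'d::finite \<Rightarrow> real^'d" where
  "vec_Re z = (\<chi> j. Re (z $ j))"

definition vec_Im :: "complex^'d::finite \<Rightarrow> real^'d" where
  "vec_Im z = (\<chi> j. Im (z $ j))"

lemma norm_vec_Re_le: "norm (vec_Re z) \<le> norm z" and norm_vec_Im_le: "norm (vec_Im z) \<le> norm z"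
  unfolding vec_Re_def vec_Im_def norm_vec_def
  by (auto intro!: L2_set_mono simp: abs_Re_le_cmod abs_Im_le_cmod)

lemma vec_Re_Im_diff: "vec_Re (z - w) = vec_Re z - vec_Re w" "vec_Im (z - w) = vec_Im z - vec_Im w"
  by (simp_all add: vec_Re_def vec_Im_def vec_eq_iff)

lemma vec_Re_Im_embed: "vec_Re (embed_complex x) = x" "vec_Im (embed_complex x) = 0"
  by (simp_all add: vec_Re_def vec_Im_def vec_eq_iff)

lemma mem_complex_strip: "z \<in> complex_strip \<epsilon> \<longleftrightarrow> norm (vec_Im z) < \<epsilon>"
  by (simp add: complex_strip_def vec_Im_def)

lemma open_complex_strip: "open (complex_strip \<epsilon> :: (complex^'d::finite) set)"
proof -
  have "continuous_on UNIV (\<lambda>z::complex^'d. norm (vec_Im z))"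
    unfolding vec_Im_def
    by (intro continuous_on_norm continuous_on_vec_lambda continuous_on_Im continuous_on_component continuous_on_id)
  from open_Collect_less[OF this continuous_on_const[of _ \<epsilon>]] show ?thesis
    by (simp add: complex_strip_def vec_Im_def)
qed

lemma complex_strip_shift: "z \<in> complex_strip \<epsilon> \<Longrightarrow> z - embed_complex s \<in> complex_strip \<epsilon>"
  by (simp add: mem_complex_strip vec_Re_Im_diff vec_Re_Im_embed)

lemma complex_strip_cnj: "z \<in> complex_strip \<epsilon> \<Longrightarrow> vec_cnj z \<in> complex_strip \<epsilon>"
proof -
  have "vec_Im (vec_cnj z) = - vec_Im z" by (simp add: vec_Im_def vec_cnj_def vec_eq_iff)
  then show "z \<in> complex_strip \<epsilon> \<Longrightarrow> vec_cnj z \<in> complex_strip \<epsilon>"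
    by (simp add: mem_complex_strip)
qed

lemma embed_in_strip: "0 < \<epsilon> \<Longrightarrow> embed_complex x \<in> complex_strip \<epsilon>"
  by (simp add: mem_complex_strip vec_Re_Im_embed)

lemma continuous_on_embed_complex: "continuous_on UNIV (\<lambda>s::real^'d::finite. z - embed_complex s)"
  unfolding embed_complex_def
  by (intro continuous_intros continuous_on_vec_lambda continuous_on_of_real continuous_on_component)

lemma measurable_on_strip:
  assumes v: "\<And>z. z \<in> complex_strip \<epsilon> \<Longrightarrow> holomorphic_at_vec v z" and z: "z \<in> complex_strip \<epsilon>"
  shows "(\<lambda>s::real^'d::finite. v (z - embed_complex s)) \<in> borel_measurable borel"
proof (rule borel_measurable_continuous_onI)
  have "continuous_on (complex_strip \<epsilon>) v"
    unfolding continuous_on_eq_continuous_at[OF open_complex_strip]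
    using v has_derivative_continuous unfolding holomorphic_at_vec_def by blast
  then show "continuous_on UNIV (\<lambda>s::real^'d. v (z - embed_complex s))"
    by (rule continuous_on_compose2[OF _ continuous_on_embed_complex]) (use z complex_strip_shift in blast)
qed

section \<open>The fixed point on a complex strip\<close>

text \<open>On the strip the antiholomorphic variable \<open>cnj (u x)\<close> is replaced by the holomorphic function
  \<open>cnj (v (vec_cnj z))\<close>, which agrees with it on real points.\<close>

definition strip_step ::
    "(complex^'d::finite \<Rightarrow> complex) \<Rightarrow> (real^'d \<Rightarrow> complex) \<Rightarrow> (complex \<Rightarrow> complex \<Rightarrow> complex) \<Rightarrow>
      (complex^'d \<Rightarrow> complex) \<Rightarrow> complex^'d \<Rightarrow> complex" where
  "strip_step W k P v z = W z + (LINT s|lborel.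
      P (v (z - embed_complex s)) (cnj (v (vec_cnj (z - embed_complex s)))) * k s)"

text \<open>One iteration, started at 0, is compared with two limits: on the strip its increments
  decay geometrically and produce a holomorphic U, while on real points the same contraction brings
  it to the given u. Neither a complete function space nor a separate uniqueness statement is
  involved.\<close>

lemma holomorphic_strip_fixed_point:
  fixes W :: "complex^'d::finite \<Rightarrow> complex" and k u :: "real^'d \<Rightarrow> complex" and P :: "complex \<Rightarrow> complex \<Rightarrow> complex"
  assumes \<epsilon>: "0 < \<epsilon>"
    and W: "\<And>z. z \<in> complex_strip \<epsilon> \<Longrightarrow> holomorphic_at_vec W z" "\<And>z. z \<in> complex_strip \<epsilon> \<Longrightarrow> norm (W z) \<le> B"
    and k: "integrable lborel k" "(LINT s|lborel. norm (k s)) \<le> \<delta>"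
    and P_holo: "\<And>f g z. holomorphic_at_vec f z \<Longrightarrow> holomorphic_at_vec g (z :: complex^'d) \<Longrightarrow> holomorphic_at_vec (\<lambda>z. P (f z) (g z)) z"
    and P_meas: "\<And>f g. f \<in> borel_measurable borel \<Longrightarrow> g \<in> borel_measurable borel \<Longrightarrow>
      (\<lambda>s::real^'d. P (f s) (g s)) \<in> borel_measurable borel"
    and P_bound: "\<And>a b. norm a \<le> R \<Longrightarrow> norm b \<le> R \<Longrightarrow> norm (P a b) \<le> \<Lambda>"
    and P_lip: "\<And>a b a' b'. norm a \<le> R \<Longrightarrow> norm b \<le> R \<Longrightarrow> norm a' \<le> R \<Longrightarrow> norm b' \<le> R \<Longrightarrow>
      norm (P a b - P a' b') \<le> \<Lambda> * (norm (a - a') + norm (b - b'))"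
    and small: "B + \<delta> * \<Lambda> \<le> R" "4 * (\<delta> * \<Lambda>) \<le> 1"
    and u: "u \<in> borel_measurable borel" "\<And>x. norm (u x) \<le> R"
    and u_eq: "AE x in lborel. u x = W (embed_complex x) + (LINT s|lborel. P (u (x - s)) (cnj (u (x - s))) * k s)"
  shows "\<exists>U. (\<forall>z\<in>complex_strip \<epsilon>. holomorphic_at_vec U z) \<and> (\<forall>z\<in>complex_strip \<epsilon>. norm (U z) \<le> 2 * R) \<and>
    (AE x in lborel. U (embed_complex x) = u x)"
proof -
  define \<Omega> where "\<Omega> = (complex_strip \<epsilon> :: (complex^'d) set)"
  have shift: "\<And>z s. z \<in> \<Omega> \<Longrightarrow> z - embed_complex s \<in> \<Omega>" and cnj\<Omega>: "\<And>z. z \<in> \<Omega> \<Longrightarrow> vec_cnj z \<in> \<Omega>"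
    unfolding \<Omega>_def by (fact complex_strip_shift complex_strip_cnj)+
  have R0: "0 \<le> R" using order_trans[OF norm_ge_zero u(2)] .
  have \<Lambda>0: "0 \<le> \<Lambda>" using order_trans[OF norm_ge_zero P_bound[of 0 0]] R0 by simp
  have good_conv: "(\<forall>z\<in>\<Omega>. holomorphic_at_vec v z) \<and> (\<forall>z\<in>\<Omega>. norm (v z) \<le> R) \<Longrightarrow>
      (\<forall>z\<in>\<Omega>. (\<lambda>s. P (v (z - embed_complex s)) (cnj (v (vec_cnj (z - embed_complex s))))) \<in> borel_measurable borel)" for v
  proof
    fix z assume v: "(\<forall>z\<in>\<Omega>. holomorphic_at_vec v z) \<and> (\<forall>z\<in>\<Omega>. norm (v z) \<le> R)" and z: "z \<in> \<Omega>"
    have "holomorphic_at_vec (\<lambda>z. cnj (v (vec_cnj z))) z" if "z \<in> complex_strip \<epsilon>" for z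
      using v that cnj\<Omega> by (intro holomorphic_at_vec_cnj) (auto simp: \<Omega>_def)
    from measurable_on_strip[OF this] z
    have "(\<lambda>s. cnj (v (vec_cnj (z - embed_complex s)))) \<in> borel_measurable borel" by (simp add: \<Omega>_def)
    moreover have "(\<lambda>s. v (z - embed_complex s)) \<in> borel_measurable borel"
      by (rule measurable_on_strip[of \<epsilon>]) (use v z in \<open>auto simp: \<Omega>_def\<close>)
    ultimately show "(\<lambda>s. P (v (z - embed_complex s)) (cnj (v (vec_cnj (z - embed_complex s))))) \<in> borel_measurable borel"
      by (intro P_meas)
  qed
  have int_bound: "norm (LINT s|lborel. f s * k s) \<le> C * \<delta>" and int_k: "integrable lborel (\<lambda>s. f s * k s)"
    if [measurable]: "f \<in> borel_measurable borel" and f: "\<And>s. norm (f s) \<le> C" for f C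
  proof -
    show int: "integrable lborel (\<lambda>s. f s * k s)"
      by (rule integrable_bounded_mult[OF _ f k(1)]) measurable
    have C: "0 \<le> C" using order_trans[OF norm_ge_zero f] .
    have "norm (LINT s|lborel. f s * k s) \<le> (LINT s|lborel. C * norm (k s))"
    proof (rule Bochner_Integration.integral_norm_bound_integral[OF int])
      show "norm (f s * k s) \<le> C * norm (k s)" for s
        unfolding norm_mult by (intro mult_right_mono f) simp
    qed (use k(1) in simp)
    also have "\<dots> \<le> C * \<delta>" using mult_left_mono[OF k(2) C] by simp
    finally show "norm (LINT s|lborel. f s * k s) \<le> C * \<delta>" .
  qed
  have step_good: "(\<forall>z\<in>\<Omega>. holomorphic_at_vec (strip_step W k P v) z) \<and> (\<forall>z\<in>\<Omega>. norm (strip_step W k P v z) \<le> R)"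
    if v: "(\<forall>z\<in>\<Omega>. holomorphic_at_vec v z) \<and> (\<forall>z\<in>\<Omega>. norm (v z) \<le> R)" for v
  proof (intro conjI ballI)
    fix z assume z: "z \<in> \<Omega>"
    have le: "norm (P (v (z - embed_complex s)) (cnj (v (vec_cnj (z - embed_complex s))))) \<le> \<Lambda>" if "z \<in> \<Omega>" for z s
      using v shift[OF that] cnj\<Omega>[OF shift[OF that]] by (intro P_bound) auto
    have "norm (strip_step W k P v z) \<le> norm (W z) + norm (LINT s|lborel. P (v (z - embed_complex s)) (cnj (v (vec_cnj (z - embed_complex s)))) * k s)"
      unfolding strip_step_def by (rule norm_triangle_ineq)
    also have "\<dots> \<le> B + \<Lambda> * \<delta>"
      using z by (intro add_mono W(2) int_bound le good_conv[OF v, rule_format]) (auto simp: \<Omega>_def)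
    finally show "norm (strip_step W k P v z) \<le> R" using small(1) by (simp add: mult.commute)
    obtain r where r: "0 < r" "ball z r \<subseteq> \<Omega>"
      using open_complex_strip z unfolding \<Omega>_def open_contains_ball by blast
    have "holomorphic_at_vec (\<lambda>z. LINT s|lborel. P (v (z - embed_complex s)) (cnj (v (vec_cnj (z - embed_complex s)))) * k s) z"
    proof (rule holomorphic_at_vec_integral[OF r(1)])
      fix w assume "w \<in> ball z r"
      then have w: "w \<in> \<Omega>" using r(2) by blast
      show "(\<lambda>s. P (v (w - embed_complex s)) (cnj (v (vec_cnj (w - embed_complex s)))) * k s) \<in> borel_measurable lborel"
        using good_conv[OF v, rule_format, OF w] borel_measurable_integrable[OF k(1)] by measurable
      fix s
      show "holomorphic_at_vec (\<lambda>z. P (v (z - embed_complex s)) (cnj (v (vec_cnj (z - embed_complex s)))) * k s) w"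
        using v shift[OF w] cnj\<Omega>[OF shift[OF w]]
        by (intro holomorphic_at_vec_mult holomorphic_at_vec_const P_holo holomorphic_at_vec_shift[of v]
            holomorphic_at_vec_shift[of "\<lambda>z. cnj (v (vec_cnj z))"] holomorphic_at_vec_cnj) auto
      show "norm (P (v (w - embed_complex s)) (cnj (v (vec_cnj (w - embed_complex s)))) * k s) \<le> \<Lambda> * norm (k s)"
        unfolding norm_mult by (intro mult_right_mono le w) simp
    qed (use k(1) in simp)
    then show "holomorphic_at_vec (strip_step W k P v) z"
      unfolding strip_step_def[abs_def] using W(1) z by (intro holomorphic_at_vec_add) (auto simp: \<Omega>_def)
  qed
  define v where "v n = (strip_step W k P ^^ n) (\<lambda>_. 0)" for n
  have v_Suc: "v (Suc n) = strip_step W k P (v n)" for n by (simp add: v_def)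
  have v_good: "(\<forall>z\<in>\<Omega>. holomorphic_at_vec (v n) z) \<and> (\<forall>z\<in>\<Omega>. norm (v n z) \<le> R)" for n
  proof (induction n)
    case 0
    then show ?case using R0 by (auto simp: v_def holomorphic_at_vec_const)
  next
    case (Suc n)
    then show ?case unfolding v_Suc by (rule step_good)
  qed
  \<comment> \<open>Both arguments of P change, and on the conjugated point too the increment is
    bounded by the hypothesis. The step therefore contracts by 2 \<delta> \<Lambda> \<le>
    1/2.\<close>
  have v_diff: "norm (v (Suc n) z - v n z) \<le> R * (1 / 2) ^ n" if "z \<in> \<Omega>" for n z
    using that
  proof (induction n arbitrary: z)
    case 0
    then show ?case using v_good[of 1] by (simp add: v_def)
  next
    case (Suc n)
    define f where "f m s = P (v m (z - embed_complex s)) (cnj (v m (vec_cnj (z - embed_complex s))))" for m s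
    have f_meas [measurable]: "f m \<in> borel_measurable borel" for m
      unfolding f_def using good_conv[OF v_good] Suc.prems by blast
    have z': "z - embed_complex s \<in> \<Omega>" "vec_cnj (z - embed_complex s) \<in> \<Omega>" for s
      using shift[OF Suc.prems] cnj\<Omega> by auto
    have vR: "norm (v m w) \<le> R" if "w \<in> \<Omega>" for m w using v_good that by blast
    have f_le: "norm (f m s) \<le> \<Lambda>" for m s
      unfolding f_def by (intro P_bound) (auto intro!: vR z')
    have f_diff: "norm (f (Suc n) s - f n s) \<le> 2 * \<Lambda> * (R * (1 / 2) ^ n)" for s
    proof -
      have "norm (f (Suc n) s - f n s) \<le> \<Lambda> * (norm (v (Suc n) (z - embed_complex s) - v n (z - embed_complex s))
        + norm (cnj (v (Suc n) (vec_cnj (z - embed_complex s))) - cnj (v n (vec_cnj (z - embed_complex s)))))"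
        unfolding f_def by (rule P_lip) (auto intro!: vR z')
      also have "\<dots> \<le> \<Lambda> * (R * (1 / 2) ^ n + R * (1 / 2) ^ n)"
        unfolding complex_cnj_diff[symmetric] complex_mod_cnj
        by (intro mult_left_mono add_mono Suc.IH z' \<Lambda>0)
      finally show ?thesis by simp
    qed
    have "v (Suc (Suc n)) z - v (Suc n) z = (LINT s|lborel. f (Suc n) s * k s) - (LINT s|lborel. f n s * k s)"
      by (simp add: v_Suc[of "Suc n"] v_Suc[of n, THEN fun_cong, of z] strip_step_def f_def)
    also have "\<dots> = (LINT s|lborel. (f (Suc n) s - f n s) * k s)"
      unfolding left_diff_distrib
      by (rule Bochner_Integration.integral_diff[OF int_k int_k, symmetric]) (use f_le in auto)
    also have "norm \<dots> \<le> 2 * \<Lambda> * (R * (1 / 2) ^ n) * \<delta>"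
      by (rule int_bound[OF _ f_diff]) measurable
    also have "\<dots> = (4 * (\<delta> * \<Lambda>)) * (R * (1 / 2) ^ Suc n)" by simp
    also have "\<dots> \<le> 1 * (R * (1 / 2) ^ Suc n)"
      using R0 by (intro mult_right_mono small) auto
    finally show ?case by simp
  qed
  have geo: "(\<lambda>n. R * (1 / 2) ^ n) sums (2 * R)"
    using sums_mult[OF geometric_sums[of "1 / 2 :: real"], of R] by (simp add: mult.commute[of 2])
  \<comment> \<open>The limit is written as an integral over counting measure, so that the lemma on
    parameter integrals gives holomorphy.\<close>
  define U where "U z = (LINT n|count_space UNIV. v (Suc n) z - v n z)" for z
  have int_v: "integrable (count_space UNIV) (\<lambda>n. v (Suc n) z - v n z)" if "z \<in> \<Omega>" for z
    unfolding integrable_count_space_nat_iff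
    by (rule summable_comparison_test'[OF sums_summable[OF geo]]) (use v_diff[OF that] in simp)
  have U_sums: "(\<lambda>n. v (Suc n) z - v n z) sums U z" if "z \<in> \<Omega>" for z
    unfolding U_def by (rule sums_integral_count_space_nat[OF int_v[OF that]])
  have U_lim: "(\<lambda>n. v n z) \<longlonglongrightarrow> U z" if "z \<in> \<Omega>" for z
  proof -
    have "(\<lambda>n. v n z - v 0 z) \<longlonglongrightarrow> U z"
      using U_sums[OF that] unfolding sums_def by (simp only: sum_lessThan_telescope[of "\<lambda>n. v n z"])
    then show ?thesis by (simp add: v_def)
  qed
  have U_bound: "norm (U z) \<le> 2 * R" if "z \<in> \<Omega>" for z
    using LIMSEQ_le_const2[OF tendsto_norm[OF U_lim[OF that]], of R] v_good that R0 by fastforce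
  have U_holo: "holomorphic_at_vec U z" if z: "z \<in> \<Omega>" for z
  proof -
    obtain r where r: "0 < r" "ball z r \<subseteq> \<Omega>"
      using open_complex_strip z unfolding \<Omega>_def open_contains_ball by blast
    show ?thesis
      unfolding U_def[abs_def]
    proof (rule holomorphic_at_vec_integral[OF r(1)])
      show "integrable (count_space UNIV) (\<lambda>n. R * (1 / 2) ^ n)"
        unfolding integrable_count_space_nat_iff using sums_summable[OF geo] R0 by (simp add: abs_mult)
      fix w n assume "w \<in> ball z r"
      then have w: "w \<in> \<Omega>" using r(2) by blast
      show "holomorphic_at_vec (\<lambda>z. v (Suc n) z - v n z) w"
        using v_good w by (intro holomorphic_at_vec_diff) blast+
      show "norm (v (Suc n) w - v n w) \<le> R * (1 / 2) ^ n" by (rule v_diff[OF w])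
    qed auto
  qed
  \<comment> \<open>The equation for u holds almost everywhere, so the comparison is made outside a
    null set for each n; countably many such sets are joined afterwards.\<close>
  have v_u: "AE x in lborel. norm (v n (embed_complex x) - u x) \<le> 2 * R * (1 / 2) ^ n" for n
  proof (induction n)
    case 0
    have "norm (u x) \<le> 2 * R" for x using u(2)[of x] R0 by simp
    then show ?case by (simp add: v_def)
  next
    case (Suc n)
    show ?case
      using u_eq
    proof eventually_elim
      case (elim x)
      have x: "embed_complex x \<in> \<Omega>" unfolding \<Omega>_def by (rule embed_in_strip[OF \<epsilon>])
      define f where "f s = P (v n (embed_complex x - embed_complex s)) (cnj (v n (vec_cnj (embed_complex x - embed_complex s))))" for s
      define g where "g s = P (u (x - s)) (cnj (u (x - s)))" for s
      have emb: "embed_complex x - embed_complex s = embed_complex (x - s)" for s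
        by (simp add: vec_eq_iff)
      have x': "embed_complex (x - s) \<in> \<Omega>" for s unfolding \<Omega>_def by (rule embed_in_strip[OF \<epsilon>])
      have vR: "norm (v n (embed_complex (x - s))) \<le> R" for s using v_good x' by blast
      have f_meas [measurable]: "f \<in> borel_measurable borel"
        unfolding f_def using good_conv[OF v_good] x by blast
      have g_meas [measurable]: "g \<in> borel_measurable borel"
      proof -
        have "(\<lambda>s. u (x - s)) \<in> borel_measurable borel" using u(1) by measurable
        moreover from this have "(\<lambda>s. cnj (u (x - s))) \<in> borel_measurable borel"
          by (rule measurable_compose[OF _ borel_measurable_continuous_onI]) (intro continuous_intros)
        ultimately show ?thesis unfolding g_def by (rule P_meas)
      qed
      have f_le: "norm (f s) \<le> \<Lambda>" and g_le: "norm (g s) \<le> \<Lambda>" for s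
        unfolding f_def g_def emb vec_cnj_embed by (auto intro!: P_bound vR u(2))
      \<comment> \<open>For fixed x the exceptional set in s is a reflected translate of a null set,
        hence null.\<close>
      have "AE s in lborel. norm (v n (embed_complex (x + (-1) *\<^sub>R s)) - u (x + (-1) *\<^sub>R s)) \<le> 2 * R * (1 / 2) ^ n"
        by (rule AE_lborel_affine[OF Suc.IH]) simp
      then have AE_fg: "AE s in lborel. norm (f s - g s) \<le> 2 * \<Lambda> * (2 * R * (1 / 2) ^ n)"
      proof eventually_elim
        case (elim s)
        then have le: "norm (v n (embed_complex (x - s)) - u (x - s)) \<le> 2 * R * (1 / 2) ^ n" by simp
        have "norm (f s - g s) \<le> \<Lambda> * (norm (v n (embed_complex (x - s)) - u (x - s)) + norm (cnj (v n (embed_complex (x - s))) - cnj (u (x - s))))"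
          unfolding f_def g_def emb vec_cnj_embed by (rule P_lip) (auto intro!: vR u(2))
        also have "\<dots> \<le> \<Lambda> * (2 * R * (1 / 2) ^ n + 2 * R * (1 / 2) ^ n)"
          unfolding complex_cnj_diff[symmetric] complex_mod_cnj by (intro mult_left_mono add_mono le \<Lambda>0)
        finally show ?case by simp
      qed
      have "v (Suc n) (embed_complex x) - u x = (LINT s|lborel. f s * k s) - (LINT s|lborel. g s * k s)"
        using elim by (simp add: v_Suc strip_step_def f_def g_def)
      also have "\<dots> = (LINT s|lborel. (f s - g s) * k s)"
        unfolding left_diff_distrib
        by (rule Bochner_Integration.integral_diff[OF int_k int_k, symmetric]) (use f_le g_le in auto)
      also have "norm \<dots> \<le> (LINT s|lborel. norm ((f s - g s) * k s))" by (rule integral_norm_bound)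
      also have "\<dots> \<le> (LINT s|lborel. 2 * \<Lambda> * (2 * R * (1 / 2) ^ n) * norm (k s))"
      proof (rule integral_mono_AE)
        show "integrable lborel (\<lambda>s. norm ((f s - g s) * k s))"
          unfolding left_diff_distrib using f_le g_le by (intro integrable_norm Bochner_Integration.integrable_diff int_k) auto
        show "AE s in lborel. norm ((f s - g s) * k s) \<le> 2 * \<Lambda> * (2 * R * (1 / 2) ^ n) * norm (k s)"
          using AE_fg by eventually_elim (unfold norm_mult, intro mult_right_mono, auto)
      qed (use k(1) in simp)
      also have "\<dots> = 2 * \<Lambda> * (2 * R * (1 / 2) ^ n) * (LINT s|lborel. norm (k s))" by simp
      also have "\<dots> \<le> 2 * \<Lambda> * (2 * R * (1 / 2) ^ n) * \<delta>"
        using \<Lambda>0 R0 by (intro mult_left_mono k(2)) auto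
      also have "\<dots> = (4 * (\<delta> * \<Lambda>)) * (2 * R * (1 / 2) ^ Suc n)" by simp
      also have "\<dots> \<le> 1 * (2 * R * (1 / 2) ^ Suc n)"
        using R0 by (intro mult_right_mono small) auto
      finally show "norm (v (Suc n) (embed_complex x) - u x) \<le> 2 * R * (1 / 2) ^ Suc n" by simp
    qed
  qed
  have "AE x in lborel. \<forall>n. norm (v n (embed_complex x) - u x) \<le> 2 * R * (1 / 2) ^ n"
    using v_u by (simp add: AE_all_countable)
  then have "AE x in lborel. U (embed_complex x) = u x"
  proof eventually_elim
    case (elim x)
    have "(\<lambda>n. 2 * R * (1 / 2) ^ n) \<longlonglongrightarrow> 0"
      by (rule tendsto_mult_right_zero[OF LIMSEQ_realpow_zero]) auto
    then have "(\<lambda>n. v n (embed_complex x) - u x) \<longlonglongrightarrow> 0"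
      by (rule Lim_null_comparison[rotated]) (use elim in simp)
    then have "(\<lambda>n. v n (embed_complex x)) \<longlonglongrightarrow> u x" by (simp only: LIM_zero_iff)
    moreover have "embed_complex x \<in> \<Omega>" unfolding \<Omega>_def by (rule embed_in_strip[OF \<epsilon>])
    ultimately show ?case using LIMSEQ_unique[OF U_lim] by blast
  qed
  with U_holo U_bound show ?thesis unfolding \<Omega>_def by blast
qed

section \<open>Complex extension of the low-frequency part\<close>

text \<open>The sum of squares is the bilinear one, without conjugates, so the function is entire
  and extends \<open>heat_kernel\<close>.\<close>

definition heat_kernel_complex :: "real \<Rightarrow> complex^'d::finite \<Rightarrow> complex" where
  "heat_kernel_complex c z = of_real (1 / sqrt (4 * pi * c) ^ CARD('d)) * exp (- (of_real (1 / (4 * c)) * (\<Sum>i\<in>UNIV. (z $ i)\<^sup>2)))"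

lemma holomorphic_heat_kernel_complex: "holomorphic_at_vec (heat_kernel_complex c) z"
proof -
  have eq: "heat_kernel_complex c = (\<lambda>z::complex^'a. of_real (1 / sqrt (4 * pi * c) ^ CARD('a)) *
      exp ((- of_real (1 / (4 * c))) * (\<Sum>i\<in>UNIV. (z $ i)\<^sup>2)))"
    by (rule ext) (simp only: heat_kernel_complex_def mult_minus_left)
  show ?thesis
    unfolding eq
    by (intro holomorphic_at_vec_mult holomorphic_at_vec_const holomorphic_at_vec_exp holomorphic_at_vec_sum
        holomorphic_at_vec_power holomorphic_at_vec_nth)
qed

text \<open>The sum of the z_i^2 has real part |Re z|^2 - |Im z|^2, so leaving the real space costs
  a factor that depends on the imaginary part alone.\<close>

lemma norm_heat_kernel_complex:
  assumes "0 < c"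
  shows "norm (heat_kernel_complex c z) = exp ((norm (vec_Im z))\<^sup>2 / (4 * c)) * norm (heat_kernel c (vec_Re z))"
proof -
  have "Re (\<Sum>i\<in>UNIV. (z $ i)\<^sup>2) = (norm (vec_Re z))\<^sup>2 - (norm (vec_Im z))\<^sup>2"
  proof -
    have "Re (\<Sum>i\<in>UNIV. (z $ i)\<^sup>2) = (\<Sum>i\<in>UNIV. (Re (z $ i))\<^sup>2 - (Im (z $ i))\<^sup>2)"
      by (simp add: power2_eq_square)
    then show ?thesis
      by (simp only: norm_vec_squared vec_Re_def vec_Im_def vec_lambda_beta sum_subtractf)
  qed
  then have "Re (- (of_real (1 / (4 * c)) * (\<Sum>i\<in>UNIV. (z $ i)\<^sup>2))) = (norm (vec_Im z))\<^sup>2 / (4 * c) + (- (1 / (4 * c)) * (norm (vec_Re z))\<^sup>2)"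
    by (simp add: diff_divide_distrib)
  then show ?thesis
    unfolding heat_kernel_complex_def heat_kernel_def gaussian_def norm_mult norm_of_real norm_exp_eq_Re
    by (simp add: exp_add[symmetric])
qed

lemma heat_kernel_complex_embed: "heat_kernel_complex c (embed_complex x) = heat_kernel c x"
proof -
  have "(\<Sum>i\<in>UNIV. (embed_complex x $ i)\<^sup>2) = of_real ((norm x)\<^sup>2)"
    by (simp add: norm_vec_squared)
  then show ?thesis
    by (simp add: heat_kernel_complex_def heat_kernel_def gaussian_def exp_of_real[symmetric])
qed

lemma vec_Re_Im_shift:
  "vec_Re (z - embed_complex y) = vec_Re z - y" "vec_Im (z - embed_complex y) = vec_Im z"
  by (simp_all add: vec_Re_Im_diff vec_Re_Im_embed)

lemma heat_extension:
  fixes u :: "real^'d::finite \<Rightarrow> complex"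
  assumes u_meas [measurable]: "u \<in> borel_measurable borel" and u: "\<And>x. norm (u x) \<le> B" and c: "0 < c"
  defines "W \<equiv> \<lambda>z. LINT y|lborel. u y * heat_kernel_complex c (z - embed_complex y)"
  shows "holomorphic_at_vec W z" and "norm (W z) \<le> exp ((norm (vec_Im z))\<^sup>2 / (4 * c)) * B"
proof -
  have B0: "0 \<le> B" using order_trans[OF norm_ge_zero u] .
  have meas [measurable]: "(\<lambda>y::real^'d. heat_kernel_complex c (z - embed_complex y)) \<in> borel_measurable borel" for z
    by (rule measurable_on_strip[of "norm (vec_Im z) + 1"]) (auto simp: holomorphic_heat_kernel_complex mem_complex_strip)
  have norm_le: "norm (u y * heat_kernel_complex c (z - embed_complex y)) \<le> exp ((norm (vec_Im z))\<^sup>2 / (4 * c)) * B * norm (heat_kernel c (vec_Re z - y))" for z y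
  proof -
    have "norm (u y * heat_kernel_complex c (z - embed_complex y)) \<le> B * norm (heat_kernel_complex c (z - embed_complex y))"
      unfolding norm_mult by (intro mult_right_mono u) simp
    then show ?thesis by (simp add: norm_heat_kernel_complex[OF c] vec_Re_Im_shift mult_ac)
  qed
  have heat_int: "integrable lborel (\<lambda>y. heat_kernel c (x - y))" for x :: "real^'d"
    by (rule integrable_reflect) (rule heat_kernel_integral(1)[OF c])
  have "integrable lborel (\<lambda>y. u y * heat_kernel_complex c (z - embed_complex y))"
    by (rule Bochner_Integration.integrable_bound[OF integrable_mult_right[OF integrable_norm[OF heat_int]], of _ "exp ((norm (vec_Im z))\<^sup>2 / (4 * c)) * B" "vec_Re z"])
      (use norm_le[of _ z] B0 in \<open>auto intro!: AE_I2 simp: abs_mult\<close>)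
  then have "norm (W z) \<le> (LINT y|lborel. exp ((norm (vec_Im z))\<^sup>2 / (4 * c)) * B * norm (heat_kernel c (vec_Re z - y)))"
    unfolding W_def
    by (rule Bochner_Integration.integral_norm_bound_integral[OF _ integrable_mult_right[OF integrable_norm[OF heat_int]] norm_le])
  also have "\<dots> = exp ((norm (vec_Im z))\<^sup>2 / (4 * c)) * B"
    using integral_reflect[of "\<lambda>y. norm (heat_kernel c y)" "vec_Re z"] heat_kernel_integral(2)[OF c, where 'd='d] by simp
  finally show "norm (W z) \<le> exp ((norm (vec_Im z))\<^sup>2 / (4 * c)) * B" .
  obtain A where A: "\<And>x::real^'d. (1 + (norm x)\<^sup>2) ^ 0 * norm (gaussian (1 / (4 * c)) x) \<le> A * envelope x"
    using gaussian_bound[of "1 / (4 * c)" 0] c by auto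
  have "0 \<le> A * envelope (0::real^'d)" using order_trans[OF norm_ge_zero A[of 0, simplified]] .
  then have A0: "0 \<le> A" using envelope_pos[of "0::real^'d"] by (simp add: zero_le_mult_iff)
  define S where "S = 1 / sqrt (4 * pi * c) ^ CARD('d)"
  have S0: "0 \<le> S" using c by (simp add: S_def)
  have heat_env: "norm (heat_kernel c x) \<le> S * (A * envelope x)" for x :: "real^'d"
  proof -
    have "norm (heat_kernel c x) = S * norm (gaussian (1 / (4 * c)) x)"
      using c unfolding heat_kernel_def norm_mult norm_of_real by (simp add: S_def)
    also have "\<dots> \<le> S * (A * envelope x)" using A[of x] S0 by (intro mult_left_mono) auto
    finally show ?thesis .
  qed
  \<comment> \<open>Uniform over the unit ball about z: the imaginary part grows by at most 1, and
    moving the real part costs the factor 4^d of \<open>envelope_shift\<close>.\<close>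
  define D where "D = exp ((norm (vec_Im z) + 1)\<^sup>2 / (4 * c)) * B * (S * (A * 4 ^ CARD('d)))"
  show "holomorphic_at_vec W z"
    unfolding W_def
  proof (rule holomorphic_at_vec_integral[where r=1 and B="\<lambda>y. D * envelope (vec_Re z - y)"])
    show "integrable lborel (\<lambda>y. D * envelope (vec_Re z - y))"
      by (intro integrable_mult_right integrable_reflect envelope_integrable)
    fix w assume w: "w \<in> ball z 1"
    show "(\<lambda>y. u y * heat_kernel_complex c (w - embed_complex y)) \<in> borel_measurable lborel" by measurable
    fix y
    show "holomorphic_at_vec (\<lambda>z. u y * heat_kernel_complex c (z - embed_complex y)) w"
      by (intro holomorphic_at_vec_mult holomorphic_at_vec_const holomorphic_at_vec_shift holomorphic_heat_kernel_complex)
    have wz: "norm (w - z) \<le> 1" using w by (simp add: dist_norm norm_minus_commute)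
    have "norm (vec_Im w) \<le> norm (vec_Im z) + norm (vec_Im (w - z))"
      using norm_triangle_ineq[of "vec_Im z" "vec_Im (w - z)"] by (simp add: vec_Re_Im_diff)
    then have im: "norm (vec_Im w) \<le> norm (vec_Im z) + 1" using norm_vec_Im_le[of "w - z"] wz by linarith
    have re: "norm (heat_kernel c (vec_Re w - y)) \<le> S * (A * 4 ^ CARD('d)) * envelope (vec_Re z - y)"
    proof -
      have "envelope (vec_Re w - y) = envelope ((vec_Re z - y) + vec_Re (w - z))" by (simp add: vec_Re_Im_diff)
      also have "\<dots> \<le> 4 ^ CARD('d) * envelope (vec_Re z - y)"
        by (rule envelope_shift) (use norm_vec_Re_le[of "w - z"] wz in linarith)
      finally have "S * (A * envelope (vec_Re w - y)) \<le> S * (A * (4 ^ CARD('d) * envelope (vec_Re z - y)))"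
        using S0 A0 by (intro mult_left_mono)
      with heat_env[of "vec_Re w - y"] show ?thesis by (simp add: mult_ac)
    qed
    have "norm (u y * heat_kernel_complex c (w - embed_complex y)) \<le> exp ((norm (vec_Im w))\<^sup>2 / (4 * c)) * B * norm (heat_kernel c (vec_Re w - y))"
      by (rule norm_le)
    also have "\<dots> \<le> exp ((norm (vec_Im z) + 1)\<^sup>2 / (4 * c)) * B * (S * (A * 4 ^ CARD('d)) * envelope (vec_Re z - y))"
      using im re c B0 by (intro mult_mono) (auto intro!: divide_right_mono power_mono)
    finally show "norm (u y * heat_kernel_complex c (w - embed_complex y)) \<le> D * envelope (vec_Re z - y)"
      by (simp add: D_def mult.assoc)
  qed simp
qed

text \<open>At time j r^2 and for |Im z| < r the growth factor is at most exp(1/(4 j)) \<le> 2,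
  whatever r is. This is why the width of the strip equals the scale.\<close>

lemma lowpass_extension:
  fixes u :: "real^'d::finite \<Rightarrow> complex"
  assumes u_meas [measurable]: "u \<in> borel_measurable borel" and u: "\<And>x. norm (u x) \<le> B" and r: "0 < r"
  shows "\<exists>W. (\<forall>z\<in>complex_strip r. holomorphic_at_vec W z) \<and> (\<forall>z\<in>complex_strip r. norm (W z) \<le> 2 * 2 ^ L * B) \<and>
    (\<forall>x. W (embed_complex x) = (LINT y|lborel. u y * lowpass_kernel L r (x - y)))"
proof -
  have B0: "0 \<le> B" using order_trans[OF norm_ge_zero u] .
  define G where "G j z = (LINT y|lborel. u y * heat_kernel_complex (real j * r\<^sup>2) (z - embed_complex y))" for j z
  define W where "W z = (\<Sum>j=1..L. lowpass_coeff L j * G j z)" for z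
  have c: "0 < real j * r\<^sup>2" if "j \<in> {1..L}" for j using that r by simp
  have "holomorphic_at_vec W z" for z
    unfolding W_def[abs_def] G_def
    by (intro holomorphic_at_vec_sum holomorphic_at_vec_mult holomorphic_at_vec_const heat_extension(1)[OF u_meas u c])
  moreover have "norm (W z) \<le> 2 * 2 ^ L * B" if z: "z \<in> complex_strip r" for z
  proof -
    have "norm (W z) \<le> (\<Sum>j=1..L. norm (lowpass_coeff L j) * (2 * B))"
      unfolding W_def
    proof (rule order_trans[OF norm_sum sum_mono])
      fix j assume j: "j \<in> {1..L}"
      have "(norm (vec_Im z))\<^sup>2 / (4 * (real j * r\<^sup>2)) \<le> r\<^sup>2 / (4 * (real j * r\<^sup>2))"
        using z c[OF j] by (intro divide_right_mono power_mono) (auto simp: mem_complex_strip)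
      also have "\<dots> \<le> 1 / 4"
        using j r by (simp add: divide_simps)
      finally have "exp ((norm (vec_Im z))\<^sup>2 / (4 * (real j * r\<^sup>2))) \<le> exp (1 / 4)" by simp
      also have "\<dots> \<le> exp (1 / 2 :: real)" by simp
      also have "\<dots> \<le> 2" using exp_half_le2 by simp
      finally have "exp ((norm (vec_Im z))\<^sup>2 / (4 * (real j * r\<^sup>2))) * B \<le> 2 * B"
        using B0 by (rule mult_right_mono)
      with heat_extension(2)[OF u_meas u c[OF j], of z] have "norm (G j z) \<le> 2 * B"
        unfolding G_def by linarith
      then show "norm (lowpass_coeff L j * G j z) \<le> norm (lowpass_coeff L j) * (2 * B)"
        unfolding norm_mult by (rule mult_left_mono) simp
    qed
    also have "\<dots> \<le> 2 ^ L * (2 * B)"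
      unfolding sum_distrib_right[symmetric] using B0 by (intro mult_right_mono norm_sum_lowpass_coeff) simp
    finally show ?thesis by simp
  qed
  moreover have "W (embed_complex x) = (LINT y|lborel. u y * lowpass_kernel L r (x - y))" for x
  proof -
    have "embed_complex x - embed_complex y = embed_complex (x - y)" for y
      by (simp add: vec_eq_iff)
    then show ?thesis
      unfolding lowpass_convolution_eq[OF u_meas u r] W_def G_def by (simp add: heat_kernel_complex_embed)
  qed
  ultimately show ?thesis by blast
qed

section \<open>Polynomial nonlinearities and elliptic symbols\<close>

text \<open>One constant for the bound and for the Lipschitz estimate, in two independent variables;
  in this form the property is stable under sums and products.\<close>

definition lipschitz_on_polydisc :: "real \<Rightarrow> (complex \<Rightarrow> complex \<Rightarrow> complex) \<Rightarrow> bool" where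
  "lipschitz_on_polydisc R P \<longleftrightarrow> (\<exists>\<Lambda>\<ge>0. \<forall>a b. norm a \<le> R \<longrightarrow> norm b \<le> R \<longrightarrow> norm (P a b) \<le> \<Lambda> \<and>
     (\<forall>a' b'. norm a' \<le> R \<longrightarrow> norm b' \<le> R \<longrightarrow> norm (P a b - P a' b') \<le> \<Lambda> * (norm (a - a') + norm (b - b'))))"

lemma lipschitz_on_polydisc_const: "lipschitz_on_polydisc R (\<lambda>_ _. c)"
  unfolding lipschitz_on_polydisc_def by (intro exI[of _ "norm c"]) auto

lemma lipschitz_on_polydisc_fst: "lipschitz_on_polydisc R (\<lambda>a _. a)"
  and lipschitz_on_polydisc_snd: "lipschitz_on_polydisc R (\<lambda>_ b. b)"
proof -
  have "norm x \<le> max 1 \<bar>R\<bar>" if "norm x \<le> R" for x :: complex using that by auto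
  moreover have "norm x \<le> max 1 \<bar>R\<bar> * (norm x + norm y)" "norm y \<le> max 1 \<bar>R\<bar> * (norm x + norm y)" for x y :: complex
  proof -
    have "1 * (norm x + norm y) \<le> max 1 \<bar>R\<bar> * (norm x + norm y)"
      by (intro mult_right_mono) auto
    moreover have "norm x \<le> norm x + norm y" "norm y \<le> norm x + norm y" by auto
    ultimately show "norm x \<le> max 1 \<bar>R\<bar> * (norm x + norm y)" "norm y \<le> max 1 \<bar>R\<bar> * (norm x + norm y)"
      unfolding mult_1_left by (blast intro: order_trans)+
  qed
  ultimately show "lipschitz_on_polydisc R (\<lambda>a _. a)" "lipschitz_on_polydisc R (\<lambda>_ b. b)"
    unfolding lipschitz_on_polydisc_def by (auto intro!: exI[of _ "max 1 \<bar>R\<bar>"])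
qed

lemma lipschitz_on_polydisc_add:
  assumes "lipschitz_on_polydisc R P" "lipschitz_on_polydisc R Q"
  shows "lipschitz_on_polydisc R (\<lambda>a b. P a b + Q a b)"
proof -
  obtain \<Lambda> where \<Lambda>: "0 \<le> \<Lambda>" "\<And>a b. norm a \<le> R \<Longrightarrow> norm b \<le> R \<Longrightarrow> norm (P a b) \<le> \<Lambda>"
    "\<And>a b a' b'. norm a \<le> R \<Longrightarrow> norm b \<le> R \<Longrightarrow> norm a' \<le> R \<Longrightarrow> norm b' \<le> R \<Longrightarrow>
      norm (P a b - P a' b') \<le> \<Lambda> * (norm (a - a') + norm (b - b'))"
    using assms(1) unfolding lipschitz_on_polydisc_def by blast
  obtain \<Gamma> where \<Gamma>: "0 \<le> \<Gamma>" "\<And>a b. norm a \<le> R \<Longrightarrow> norm b \<le> R \<Longrightarrow> norm (Q a b) \<le> \<Gamma>"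
    "\<And>a b a' b'. norm a \<le> R \<Longrightarrow> norm b \<le> R \<Longrightarrow> norm a' \<le> R \<Longrightarrow> norm b' \<le> R \<Longrightarrow>
      norm (Q a b - Q a' b') \<le> \<Gamma> * (norm (a - a') + norm (b - b'))"
    using assms(2) unfolding lipschitz_on_polydisc_def by blast
  show ?thesis
    unfolding lipschitz_on_polydisc_def
  proof (intro exI[of _ "\<Lambda> + \<Gamma>"] conjI allI impI)
    show "0 \<le> \<Lambda> + \<Gamma>" using \<Lambda> \<Gamma> by simp
    fix a b :: complex assume ab: "norm a \<le> R" "norm b \<le> R"
    show "norm (P a b + Q a b) \<le> \<Lambda> + \<Gamma>"
      using norm_triangle_ineq[of "P a b" "Q a b"] \<Lambda>(2)[OF ab] \<Gamma>(2)[OF ab] by linarith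
    fix a' b' :: complex assume ab': "norm a' \<le> R" "norm b' \<le> R"
    show "norm (P a b + Q a b - (P a' b' + Q a' b')) \<le> (\<Lambda> + \<Gamma>) * (norm (a - a') + norm (b - b'))"
      using norm_diff_triangle_ineq[of "P a b" "Q a b" "P a' b'" "Q a' b'"] \<Lambda>(3)[OF ab ab'] \<Gamma>(3)[OF ab ab']
      unfolding distrib_right[of \<Lambda> \<Gamma>] by linarith
  qed
qed

lemma lipschitz_on_polydisc_mult:
  assumes "lipschitz_on_polydisc R P" "lipschitz_on_polydisc R Q"
  shows "lipschitz_on_polydisc R (\<lambda>a b. P a b * Q a b)"
proof -
  obtain \<Lambda> where \<Lambda>: "0 \<le> \<Lambda>" "\<And>a b. norm a \<le> R \<Longrightarrow> norm b \<le> R \<Longrightarrow> norm (P a b) \<le> \<Lambda>"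
    "\<And>a b a' b'. norm a \<le> R \<Longrightarrow> norm b \<le> R \<Longrightarrow> norm a' \<le> R \<Longrightarrow> norm b' \<le> R \<Longrightarrow>
      norm (P a b - P a' b') \<le> \<Lambda> * (norm (a - a') + norm (b - b'))"
    using assms(1) unfolding lipschitz_on_polydisc_def by blast
  obtain \<Gamma> where \<Gamma>: "0 \<le> \<Gamma>" "\<And>a b. norm a \<le> R \<Longrightarrow> norm b \<le> R \<Longrightarrow> norm (Q a b) \<le> \<Gamma>"
    "\<And>a b a' b'. norm a \<le> R \<Longrightarrow> norm b \<le> R \<Longrightarrow> norm a' \<le> R \<Longrightarrow> norm b' \<le> R \<Longrightarrow>
      norm (Q a b - Q a' b') \<le> \<Gamma> * (norm (a - a') + norm (b - b'))"
    using assms(2) unfolding lipschitz_on_polydisc_def by blast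
  show ?thesis
    unfolding lipschitz_on_polydisc_def
  proof (intro exI[of _ "2 * (\<Lambda> * \<Gamma>)"] conjI allI impI)
    show "0 \<le> 2 * (\<Lambda> * \<Gamma>)" using \<Lambda> \<Gamma> by simp
    fix a b :: complex assume ab: "norm a \<le> R" "norm b \<le> R"
    have "norm (P a b * Q a b) \<le> \<Lambda> * \<Gamma>"
      unfolding norm_mult using \<Lambda>(1) by (intro mult_mono \<Lambda>(2) \<Gamma>(2) ab) auto
    then show "norm (P a b * Q a b) \<le> 2 * (\<Lambda> * \<Gamma>)" using \<Lambda>(1) \<Gamma>(1) by (simp add: mult_nonneg_nonneg order_trans)
    fix a' b' :: complex assume ab': "norm a' \<le> R" "norm b' \<le> R"
    define t where "t = norm (a - a') + norm (b - b')"
    have "P a b * Q a b - P a' b' * Q a' b' = P a b * (Q a b - Q a' b') + (P a b - P a' b') * Q a' b'"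
      by (simp add: algebra_simps)
    then have "norm (P a b * Q a b - P a' b' * Q a' b') \<le> norm (P a b) * norm (Q a b - Q a' b') + norm (P a b - P a' b') * norm (Q a' b')"
      by (metis norm_mult norm_triangle_ineq)
    also have "\<dots> \<le> \<Lambda> * (\<Gamma> * t) + (\<Lambda> * t) * \<Gamma>"
      unfolding t_def using \<Lambda>(1) \<Gamma>(1)
      by (intro add_mono mult_mono \<Lambda>(2,3) \<Gamma>(2,3) ab ab') auto
    finally show "norm (P a b * Q a b - P a' b' * Q a' b') \<le> 2 * (\<Lambda> * \<Gamma>) * (norm (a - a') + norm (b - b'))"
      by (simp add: t_def mult_ac)
  qed
qed

lemma lipschitz_on_polydisc_polynomial:
  "lipschitz_on_polydisc R (\<lambda>a b. \<Sum>j\<le>N. \<Sum>k\<le>N. c j k * a ^ j * b ^ k)"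
proof -
  have power: "lipschitz_on_polydisc R (\<lambda>a b. P a b ^ n)" if "lipschitz_on_polydisc R P" for P and n :: nat
    by (induction n) (auto intro!: lipschitz_on_polydisc_const lipschitz_on_polydisc_mult that)
  have sum: "lipschitz_on_polydisc R (\<lambda>a b. \<Sum>i\<in>I. P i a b)" if "\<And>i. lipschitz_on_polydisc R (P i)" for P and I :: "nat set"
    by (induction I rule: infinite_finite_induct) (auto intro!: lipschitz_on_polydisc_const lipschitz_on_polydisc_add that)
  show ?thesis
    by (intro sum lipschitz_on_polydisc_mult lipschitz_on_polydisc_const power lipschitz_on_polydisc_fst lipschitz_on_polydisc_snd)
qed

text \<open>Partial derivatives are homogeneous of degree \<mu> - 1, and a homogeneous function is
  controlled by its values on the compact unit sphere. Homogeneity is assumed off the origin only,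
  since the derivatives have no prescribed value there.\<close>

lemma symbol_bound_homogeneous:
  fixes f :: "real^'d::finite \<Rightarrow> complex"
  assumes "smooth_on (UNIV - {0}) f"
    and "\<And>t \<xi>. 0 < t \<Longrightarrow> \<xi> \<noteq> 0 \<Longrightarrow> f (t *\<^sub>R \<xi>) = of_real (t powr \<mu>) * f \<xi>"
  shows "\<exists>C\<ge>0. symbol_bound n (\<lambda>\<xi>. C * norm \<xi> powr \<mu>) f"
  using assms
proof (induction n arbitrary: f \<mu>)
  \<comment> \<open>The order zero estimate, for arbitrary f and \<mu> because the induction changes
    both.\<close>
  have bound: "\<exists>C\<ge>0. \<forall>\<xi>. \<xi> \<noteq> 0 \<longrightarrow> norm (f \<xi>) \<le> C * norm \<xi> powr \<mu>"
    if smooth: "smooth_on (UNIV - {0}) f"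
      and hom: "\<And>t \<xi>. 0 < t \<Longrightarrow> \<xi> \<noteq> 0 \<Longrightarrow> f (t *\<^sub>R \<xi>) = of_real (t powr \<mu>) * f \<xi>"
    for f :: "real^'d \<Rightarrow> complex" and \<mu>
  proof -
    have "f differentiable (at \<xi>)" if "\<xi> \<noteq> 0" for \<xi>
      using smooth that unfolding smooth_on_def iterated_partial_def by (metis DiffI UNIV_I foldr.simps(1) id_apply singletonD)
    then have "continuous_on (sphere 0 1) f"
      by (intro continuous_at_imp_continuous_on ballI differentiable_imp_continuous_within) (metis mem_sphere_0 norm_zero zero_neq_one)
    then have "bounded (f ` sphere 0 1)"
      by (intro compact_imp_bounded compact_continuous_image) auto
    then obtain C where C: "\<And>x. norm x = 1 \<Longrightarrow> norm (f x) \<le> C"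
      unfolding bounded_iff by (metis imageI mem_sphere_0)
    have "norm (f \<xi>) \<le> max 0 C * norm \<xi> powr \<mu>" if "\<xi> \<noteq> 0" for \<xi>
    proof -
      have "f \<xi> = of_real (norm \<xi> powr \<mu>) * f ((1 / norm \<xi>) *\<^sub>R \<xi>)"
        using hom[of "norm \<xi>" "(1 / norm \<xi>) *\<^sub>R \<xi>"] that by simp
      then have "norm (f \<xi>) = norm (f ((1 / norm \<xi>) *\<^sub>R \<xi>)) * norm \<xi> powr \<mu>"
        by (metis abs_of_nonneg mult.commute norm_mult norm_of_real powr_ge_zero)
      also have "\<dots> \<le> max 0 C * norm \<xi> powr \<mu>"
        by (intro mult_right_mono order_trans[OF C]) (use that in auto)
      finally show ?thesis .
    qed
    then show ?thesis by (intro exI[of _ "max 0 C"]) auto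
  qed
  case 0
  then show ?case using bound[of f \<mu>] by auto
  case (Suc n)
  have diff: "f differentiable (at \<xi>)" if "\<xi> \<noteq> 0" for \<xi>
    using Suc.prems(1) that unfolding smooth_on_def iterated_partial_def by (metis DiffI UNIV_I foldr.simps(1) id_apply singletonD)
  have "\<exists>C\<ge>0. symbol_bound n (\<lambda>\<xi>. C * norm \<xi> powr (\<mu> - 1)) (partial_deriv i f)" for i
  proof (rule Suc.IH)
    have "iterated_partial is (partial_deriv i f) = iterated_partial (is @ [i]) f" for "is"
      by (simp add: iterated_partial_def)
    then show "smooth_on (UNIV - {0}) (partial_deriv i f)"
      using Suc.prems(1) by (simp add: smooth_on_def)
    fix t :: real and \<xi> :: "real^'d" assume t: "0 < t" and \<xi>: "\<xi> \<noteq> 0"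
    have "((\<lambda>\<eta>. f (t *\<^sub>R \<eta>)) has_derivative (\<lambda>v. frechet_derivative f (at (t *\<^sub>R \<xi>)) (t *\<^sub>R v))) (at \<xi>)"
      by (rule has_derivative_compose[OF has_derivative_scaleR_right[OF has_derivative_ident] has_derivative_partial_deriv[OF diff]])
        (use t \<xi> in simp)
    then have "partial_deriv i (\<lambda>\<eta>. f (t *\<^sub>R \<eta>)) \<xi> = frechet_derivative f (at (t *\<^sub>R \<xi>)) (t *\<^sub>R axis i 1)"
      by (rule partial_deriv_eq)
    also have "\<dots> = of_real t * partial_deriv i f (t *\<^sub>R \<xi>)"
    proof -
      have "linear (frechet_derivative f (at (t *\<^sub>R \<xi>)))" using t \<xi> by (intro linear_frechet_derivative diff) simp
      from linear_scale[OF this, of t "axis i 1"] show ?thesis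
        by (simp only: partial_deriv_def scaleR_conv_of_real[of t "_::complex"])
    qed
    also have "partial_deriv i (\<lambda>\<eta>. f (t *\<^sub>R \<eta>)) \<xi> = partial_deriv i (\<lambda>\<eta>. of_real (t powr \<mu>) * f \<eta>) \<xi>"
      by (rule partial_deriv_cong[of "- {0}"]) (use Suc.prems(2) t \<xi> in auto)
    also have "\<dots> = of_real (t powr \<mu>) * partial_deriv i f \<xi>"
      by (subst partial_deriv_eq[OF has_derivative_mult_right[OF has_derivative_partial_deriv[OF diff[OF \<xi>]]]])
        (simp add: partial_deriv_def)
    finally have "of_real t * partial_deriv i f (t *\<^sub>R \<xi>) = of_real (t powr \<mu>) * partial_deriv i f \<xi>" by simp
    then have "partial_deriv i f (t *\<^sub>R \<xi>) = of_real (t powr \<mu>) * partial_deriv i f \<xi> / of_real t"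
      using t by (simp add: eq_divide_eq mult.commute)
    then show "partial_deriv i f (t *\<^sub>R \<xi>) = of_real (t powr (\<mu> - 1)) * partial_deriv i f \<xi>"
      using t by (simp add: powr_diff)
  qed
  then obtain C where C: "\<And>i. 0 \<le> C i" "\<And>i. symbol_bound n (\<lambda>\<xi>. C i * norm \<xi> powr (\<mu> - 1)) (partial_deriv i f)"
    by metis
  obtain D where D: "0 \<le> D" "\<And>\<xi>. \<xi> \<noteq> 0 \<Longrightarrow> norm (f \<xi>) \<le> D * norm \<xi> powr \<mu>"
    using bound[OF Suc.prems] by blast
  define K where "K = D + (\<Sum>i\<in>UNIV. C i)"
  have C_le: "C i \<le> K" for i
    using member_le_sum[of i UNIV C] C(1) D(1) by (simp add: K_def add_increasing)
  have K: "D \<le> K" "0 \<le> K" using C(1) D(1) by (auto simp: K_def sum_nonneg)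
  have "symbol_bound (Suc n) (\<lambda>\<xi>. K * norm \<xi> powr \<mu>) f"
    unfolding symbol_bound.simps(2)
  proof (intro conjI allI impI)
    fix \<xi> :: "real^'d" assume "\<xi> \<noteq> 0"
    then show "f differentiable (at \<xi>)" by (rule diff)
    show "norm (f \<xi>) \<le> K * norm \<xi> powr \<mu>"
      using D(2)[OF \<open>\<xi> \<noteq> 0\<close>] mult_right_mono[OF K(1), of "norm \<xi> powr \<mu>"] by simp
  next
    fix i
    show "symbol_bound n (\<lambda>\<xi>. K * norm \<xi> powr \<mu> / norm \<xi>) (partial_deriv i f)"
    proof (rule symbol_bound_mono[OF C(2)[of i]])
      fix \<xi> :: "real^'d" assume "\<xi> \<noteq> 0"
      have "C i * norm \<xi> powr (\<mu> - 1) \<le> K * norm \<xi> powr (\<mu> - 1)" by (intro mult_right_mono C_le) simp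
      also have "\<dots> = K * norm \<xi> powr \<mu> / norm \<xi>" using \<open>\<xi> \<noteq> 0\<close> by (simp add: powr_diff)
      finally show "C i * norm \<xi> powr (\<mu> - 1) \<le> K * norm \<xi> powr \<mu> / norm \<xi>" .
    qed
  qed
  with K(2) show ?case by blast
qed

lemma borel_measurable_symbol:
  assumes "symbol_family {()} (\<lambda>_. w) (\<lambda>_. f)"
  shows "f \<in> borel_measurable borel"
proof -
  obtain C where "\<And>a. a \<in> {()} \<Longrightarrow> symbol_bound (Suc 0) (\<lambda>\<xi>. C * w \<xi>) f"
    using symbol_familyE[OF assms, where n="Suc 0"] by blast
  then have "continuous_on (- {0}) f"
    by (intro continuous_at_imp_continuous_on ballI differentiable_imp_continuous_within) auto
  then have "(\<lambda>x. indicator (- {0}) x *\<^sub>R f x) \<in> borel_measurable borel"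
    by (rule borel_measurable_continuous_on_indicator[rotated]) simp
  then have "(\<lambda>x. indicator (- {0}) x *\<^sub>R f x + indicator {0} x *\<^sub>R f 0) \<in> borel_measurable borel"
    by measurable
  also have "(\<lambda>x. indicator (- {0}) x *\<^sub>R f x + indicator {0} x *\<^sub>R f 0) = f"
    by (auto simp: indicator_def)
  finally show ?thesis .
qed

text \<open>Since 0 < m_j \<le> M, the powers |\<xi>|^(m_j) lie below the bracket to the power M
  near the origin as well as at infinity. So p is a symbol of that size, and ellipticity is the
  lower bound needed for inversion.\<close>

lemma elliptic_symbol_inverse:
  fixes p :: "real^'d::finite \<Rightarrow> complex"
  assumes m: "\<And>j. j \<in> {1..h} \<Longrightarrow> 0 < m j \<and> m j \<le> M"
    and p: "\<And>\<xi>. p \<xi> = p0 + (\<Sum>j=1..h. pm j \<xi>)"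
    and smooth: "\<And>j. j \<in> {1..h} \<Longrightarrow> smooth_on (UNIV - {0}) (pm j)"
    and hom: "\<And>j. j \<in> {1..h} \<Longrightarrow> pos_homogeneous (m j) (pm j)"
    and C: "0 < C" "\<And>\<xi>. C * japanese_bracket \<xi> powr M \<le> norm (p \<xi>)" and M: "0 < M"
  shows "symbol_family {()} (\<lambda>_ \<xi>. japanese_bracket \<xi> powr (- M)) (\<lambda>_ \<xi>. 1 / p \<xi>)"
proof -
  have pos: "0 < japanese_bracket \<xi>" for \<xi> :: "real^'d"
    using japanese_bracket_ge(1)[of \<xi>] by linarith
  have "symbol_family {()} (\<lambda>_ \<xi>. japanese_bracket \<xi> powr M) (\<lambda>_. pm j)" if j: "j \<in> {1..h}" for j
  proof (rule symbol_family_mono[of _ "\<lambda>_ \<xi>. norm \<xi> powr m j" _ 1])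
    show "symbol_family {()} (\<lambda>_ \<xi>. norm \<xi> powr m j) (\<lambda>_. pm j)"
      unfolding symbol_family_def
      using symbol_bound_homogeneous[OF smooth[OF j], of "m j"] hom[OF j] unfolding pos_homogeneous_def by simp
    fix \<xi> :: "real^'d"
    have "norm \<xi> powr m j \<le> japanese_bracket \<xi> powr m j"
      using m[OF j] japanese_bracket_ge(2) by (intro powr_mono2) auto
    also have "\<dots> \<le> japanese_bracket \<xi> powr M"
      using m[OF j] japanese_bracket_ge(1) by (intro powr_mono) auto
    finally show "norm \<xi> powr m j \<le> 1 * japanese_bracket \<xi> powr M" by simp
  qed auto
  moreover have "symbol_family {()} (\<lambda>_ \<xi>::real^'d. japanese_bracket \<xi> powr M) (\<lambda>_ _. p0)"
  proof (rule symbol_family_mono[OF symbol_family_const[OF order_refl], of "norm p0"])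
    fix \<xi> :: "real^'d"
    have "1 \<le> japanese_bracket \<xi> powr M"
      using M japanese_bracket_ge(1)[of \<xi>] by (simp add: ge_one_powr_ge_zero)
    from mult_left_mono[OF this, of "norm p0"] show "norm p0 \<le> norm p0 * japanese_bracket \<xi> powr M" by simp
  qed auto
  ultimately have "symbol_family {()} (\<lambda>_ \<xi>. japanese_bracket \<xi> powr M) (\<lambda>_. p)"
    unfolding p[abs_def] by (intro symbol_family_add symbol_family_sum)
  from symbol_family_inverse[OF this C(1) C(2)]
  have "symbol_family {()} (\<lambda>_ \<xi>. 1 / japanese_bracket \<xi> powr M) (\<lambda>_ \<xi>. 1 / p \<xi>)"
    using less_imp_neq[OF pos, symmetric] by simp
  then show ?thesis
    by (simp only: powr_minus_divide)
qed

text \<open>Passes to a Borel function that is bounded everywhere, so that Fubini, translation and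
  pointwise bounds apply without exceptional sets.\<close>

lemma bounded_borel_representative:
  fixes u :: "'a::euclidean_space \<Rightarrow> complex"
  assumes u: "u \<in> borel_measurable lebesgue" and B: "AE x in lebesgue. norm (u x) \<le> B" "0 \<le> B"
  shows "\<exists>v. v \<in> borel_measurable borel \<and> (\<forall>x. norm (v x) \<le> B) \<and> (AE x in lebesgue. v x = u x)"
proof -
  have "(\<lambda>x. Re (u x)) \<in> borel_measurable lebesgue" "(\<lambda>x. Im (u x)) \<in> borel_measurable lebesgue"
    using u by measurable
  then obtain g1 g2 where g [measurable]: "g1 \<in> borel_measurable borel" "g2 \<in> borel_measurable borel"
    and AE: "AE x in lborel. Re (u x) = g1 x" "AE x in lborel. Im (u x) = g2 x"
    using completion_ex_borel_measurable_real[of _ lborel] by (metis measurable_lborel2)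
  define v where "v x = (if norm (Complex (g1 x) (g2 x)) \<le> B then Complex (g1 x) (g2 x) else 0)" for x
  have eq: "Complex (g1 x) (g2 x) = of_real (g1 x) + \<i> * of_real (g2 x)" for x
    by (simp add: complex_eq_iff)
  have "v \<in> borel_measurable borel" unfolding v_def eq by measurable
  moreover have "norm (v x) \<le> B" for x using B(2) by (simp add: v_def)
  moreover have "AE x in lebesgue. v x = u x"
    using AE_completion[OF AE(1)] AE_completion[OF AE(2)] B(1)
  proof eventually_elim
    case (elim x)
    then have "Complex (g1 x) (g2 x) = u x" by (simp add: complex_eq_iff)
    with elim show ?case by (simp add: v_def)
  qed
  ultimately show ?thesis by blast
qed

lemma distribution_solution_cong:
  fixes u v :: "real^'d::finite \<Rightarrow> complex"
  assumes sol: "distribution_solution p F u" and AE: "AE x in lebesgue. v x = u x"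
    and u: "u \<in> borel_measurable lebesgue" and v: "v \<in> borel_measurable lebesgue"
    and F: "F \<in> borel_measurable borel" and p: "p \<in> borel_measurable borel"
  shows "distribution_solution p F v"
  unfolding distribution_solution_def
proof (intro allI impI)
  fix \<phi> :: "real^'d \<Rightarrow> complex" assume \<phi>: "schwartz \<phi>"
  have "\<phi> differentiable (at x)" for x
    using \<phi> unfolding schwartz_def smooth_on_def iterated_partial_def by (metis UNIV_I foldr.simps(1) id_apply)
  then have "continuous_on UNIV \<phi>"
    by (simp add: differentiable_imp_continuous_on differentiable_on_def)
  then have \<phi>_meas [measurable]: "\<phi> \<in> borel_measurable borel"
    by (rule borel_measurable_continuous_onI)
  have "fourier \<phi> = (\<lambda>\<xi>. fourier_integral \<phi> (- \<xi>))"
    by (rule ext) (rule fourier_eq[OF \<phi>_meas])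
  then have "(\<lambda>\<xi>. p (- \<xi>) * fourier \<phi> \<xi>) \<in> borel_measurable borel"
    using p by simp
  then have "fourier_multiplier (\<lambda>\<xi>. p (- \<xi>)) \<phi> \<in> borel_measurable borel"
    unfolding fourier_multiplier_def by (rule inverse_fourier_measurable)
  then have 1: "fourier_multiplier (\<lambda>\<xi>. p (- \<xi>)) \<phi> \<in> borel_measurable lebesgue"
    and 2: "\<phi> \<in> borel_measurable lebesgue"
    using \<phi>_meas by (simp_all add: measurable_completion)
  have "multiplier_distribution p v \<phi> = multiplier_distribution p u \<phi>"
    unfolding multiplier_distribution_def
    by (rule integral_cong_AE) (use AE 1 u v in \<open>auto elim: eventually_mono\<close>)
  also have "\<dots> = (LINT x|lebesgue. F (u x) * \<phi> x)"
    using sol \<phi> by (simp add: distribution_solution_def)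
  also have "\<dots> = (LINT x|lebesgue. F (v x) * \<phi> x)"
    by (rule integral_cong_AE)
      (use AE 2 measurable_compose[OF u F] measurable_compose[OF v F] in \<open>auto elim: eventually_mono\<close>)
  finally show "multiplier_distribution p v \<phi> = (LINT x|lebesgue. F (v x) * \<phi> x)" .
qed

theorem theorem1p4:
  fixes p :: "real^'d::finite \<Rightarrow> complex"
    and p0 :: complex
    and h :: nat
    and m :: "nat \<Rightarrow> real"
    and M :: real
    and pm :: "nat \<Rightarrow> real^'d \<Rightarrow> complex"
    and F :: "complex \<Rightarrow> complex"
    and u :: "real^'d \<Rightarrow> complex"
    and \<epsilon>0 :: real
  assumes h: "1 \<le> h"
    and m_pos: "\<forall>j\<in>{1..h}. 0 < m j"
    and m_mono: "strict_mono_on {1..h} m"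
    and M: "m h = M"
    and p: "\<forall>\<xi>. p \<xi> = p0 + (\<Sum>j=1..h. pm j \<xi>)"
    and pm_smooth: "\<forall>j\<in>{1..h}. smooth_on (UNIV - {0}) (pm j)"
    and pm_homogeneous: "\<forall>j\<in>{1..h}. pos_homogeneous (m j) (pm j)"
    and elliptic: "\<exists>C>0. \<forall>\<xi>. norm (p \<xi>) \<ge> C * japanese_bracket \<xi> powr M"
    and not_smooth: "\<exists>j\<in>{1..h}. \<not> smooth_on UNIV (pm j)"
    and F_poly: "polynomial_in_conjugates F"
    and F_0: "F 0 = 0"
    and F'_0: "(F has_derivative (\<lambda>_. 0)) (at 0)"
    and eps0: "\<epsilon>0 > 0"
    and u_decay: "in_Linfty (\<lambda>x. of_real (japanese_bracket x powr \<epsilon>0) * u x)"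
    and u_solution: "distribution_solution p F u"
  shows "\<exists>\<epsilon>>0. \<exists>U. holomorphic_on_vec U (complex_strip \<epsilon>)
      \<and> bounded (U ` complex_strip \<epsilon>)
      \<and> (AE x in lebesgue. U (embed_complex x) = u x)"
proof -
  have m: "0 < m j \<and> m j \<le> M" if "j \<in> {1..h}" for j
    using m_pos strict_mono_on_leD[OF m_mono that, of h] that h M by auto
  then have M_pos: "0 < M" using h M by auto
  obtain C where C: "0 < C" "\<And>\<xi>. C * japanese_bracket \<xi> powr M \<le> norm (p \<xi>)"
    using elliptic by blast
  have jb: "1 \<le> japanese_bracket x powr \<epsilon>0" for x :: "real^'d"
    using japanese_bracket_ge(1)[of x] eps0 by (simp add: ge_one_powr_ge_zero)
  define q where "q \<xi> = 1 / p \<xi>" for \<xi>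
  have q: "symbol_family {()} (\<lambda>_ \<xi>. japanese_bracket \<xi> powr (- M)) (\<lambda>_. q)"
    unfolding q_def[abs_def]
    by (rule elliptic_symbol_inverse[of h m M p p0 pm]) (use m p pm_smooth pm_homogeneous C M_pos in auto)
  have q_meas: "q \<in> borel_measurable borel" by (rule borel_measurable_symbol[OF q])
  have p_nz: "p \<xi> \<noteq> 0" for \<xi>
  proof -
    have "0 < C * japanese_bracket \<xi> powr M" using C(1) japanese_bracket_ge(1)[of \<xi>] by simp
    with C(2)[of \<xi>] show ?thesis by auto
  qed
  then have pq: "p \<xi> * q \<xi> = 1" for \<xi> by (simp add: q_def)
  \<comment> \<open>Measurability of p is read off from its reciprocal.\<close>
  have "p = (\<lambda>\<xi>. 1 / q \<xi>)" by (simp add: q_def fun_eq_iff)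
  then have p_meas: "p \<in> borel_measurable borel" using q_meas by simp

  obtain N c where F: "\<And>z. F z = (\<Sum>j\<le>N. \<Sum>k\<le>N. c j k * z ^ j * cnj z ^ k)"
    using F_poly unfolding polynomial_in_conjugates_def by blast
  \<comment> \<open>The polarised form of F, in which the conjugate of u becomes an independent
    variable.\<close>
  define P where "P a b = (\<Sum>j\<le>N. \<Sum>k\<le>N. c j k * a ^ j * b ^ k)" for a b
  have FP: "F z = P z (cnj z)" for z by (simp add: F P_def)
  have F_meas: "F \<in> borel_measurable borel"
    unfolding F by (intro borel_measurable_continuous_onI continuous_intros)

  obtain K where K: "AE x in lebesgue. norm (of_real (japanese_bracket x powr \<epsilon>0) * u x) \<le> K"
    and u_meas': "(\<lambda>x. of_real (japanese_bracket x powr \<epsilon>0) * u x) \<in> borel_measurable lebesgue"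
    using u_decay unfolding in_Linfty_def by blast
  define B where "B = max 0 K"
  have u_meas: "u \<in> borel_measurable lebesgue"
  proof -
    have "(\<lambda>x::real^'d. 1 / complex_of_real (japanese_bracket x powr \<epsilon>0)) \<in> borel_measurable borel"
      unfolding japanese_bracket_def by measurable
    then have "(\<lambda>x::real^'d. 1 / complex_of_real (japanese_bracket x powr \<epsilon>0)) \<in> borel_measurable lebesgue"
      by (simp add: measurable_completion)
    from borel_measurable_times[OF this u_meas'] show ?thesis
    proof (rule measurable_cong[THEN iffD1, rotated])
      fix x :: "real^'d"
      show "1 / complex_of_real (japanese_bracket x powr \<epsilon>0) * (of_real (japanese_bracket x powr \<epsilon>0) * u x) = u x"
        using japanese_bracket_ge(1)[of x] by auto
    qed
  qed
  have "AE x in lebesgue. norm (u x) \<le> B"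
    using K
  proof eventually_elim
    case (elim x)
    \<comment> \<open>The weight is at least 1, so a bound on the weighted function is a bound on
      u.\<close>
    have "1 * norm (u x) \<le> japanese_bracket x powr \<epsilon>0 * norm (u x)" by (intro mult_right_mono jb) simp
    with elim show ?case by (simp add: norm_mult B_def)
  qed
  from bounded_borel_representative[OF u_meas this]
  obtain v where v_meas [measurable]: "v \<in> borel_measurable borel" and v: "\<And>x. norm (v x) \<le> B" and vu: "AE x in lebesgue. v x = u x"
    by (auto simp: B_def)
  have sol: "distribution_solution p F v"
    by (rule distribution_solution_cong[OF u_solution vu u_meas _ F_meas p_meas]) (use v_meas in \<open>simp add: measurable_completion\<close>)

  define L where "L = CARD('d) + 3"
  \<comment> \<open>Room for the bound of the low-frequency part on the strip, for the solution on
    the real space, and for a nonlinear term of size \<delta> \<Lambda> \<le> 1.\<close>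
  define R where "R = 2 * 2 ^ L * B + B + 1"
  have B0: "0 \<le> B" by (simp add: B_def)
  have BR: "2 * 2 ^ L * B + 1 \<le> R" "B \<le> R" using B0 by (auto simp: R_def)
  obtain \<Lambda> where \<Lambda>: "0 \<le> \<Lambda>" "\<And>a b. norm a \<le> R \<Longrightarrow> norm b \<le> R \<Longrightarrow> norm (P a b) \<le> \<Lambda>"
    "\<And>a b a' b'. norm a \<le> R \<Longrightarrow> norm b \<le> R \<Longrightarrow> norm a' \<le> R \<Longrightarrow> norm b' \<le> R \<Longrightarrow>
      norm (P a b - P a' b') \<le> \<Lambda> * (norm (a - a') + norm (b - b'))"
    using lipschitz_on_polydisc_polynomial[where R=R and N=N and c=c] unfolding lipschitz_on_polydisc_def P_def by blast
  \<comment> \<open>Depends on R and \<Lambda> alone, so it is known before the scale r is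
    chosen.\<close>
  define \<delta> where "\<delta> = 1 / (4 * (\<Lambda> + 1))"
  have \<delta>: "0 < \<delta>" "4 * (\<delta> * \<Lambda>) \<le> 1" using \<Lambda>(1) by (auto simp: \<delta>_def field_simps)
  have vR: "norm (v x) \<le> R" for x using v[of x] BR(2) by linarith
  have Fv_meas: "(\<lambda>x. F (v x)) \<in> borel_measurable borel" by (rule measurable_compose[OF v_meas F_meas])
  have Fv: "norm (F (v x)) \<le> \<Lambda>" for x unfolding FP by (rule \<Lambda>(2)) (simp_all add: vR)
  obtain r k where r: "0 < r" and k: "integrable lborel k" "(LINT x|lborel. norm (k x)) \<le> \<delta>"
    and eq: "AE x in lborel. v x = (LINT y|lborel. v y * lowpass_kernel L r (x - y)) + (LINT s|lborel. F (v (x - s)) * k s)"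
    using integral_equation[OF q M_pos q_meas pq v_meas v Fv_meas Fv sol _ \<delta>(1), of L] by (auto simp: L_def)
  obtain W where W: "\<And>z. z \<in> complex_strip r \<Longrightarrow> holomorphic_at_vec W z" "\<And>z. z \<in> complex_strip r \<Longrightarrow> norm (W z) \<le> 2 * 2 ^ L * B"
    and W_eq: "\<And>x. W (embed_complex x) = (LINT y|lborel. v y * lowpass_kernel L r (x - y))"
    using lowpass_extension[OF v_meas v r, of L] by blast
  have "\<exists>U. (\<forall>z\<in>complex_strip r. holomorphic_at_vec U z) \<and> (\<forall>z\<in>complex_strip r. norm (U z) \<le> 2 * R) \<and>
    (AE x in lborel. U (embed_complex x) = v x)"
  proof (rule holomorphic_strip_fixed_point[OF r W k, where P=P and \<Lambda>=\<Lambda>])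
    show "holomorphic_at_vec (\<lambda>z. P (f z) (g z)) z" if "holomorphic_at_vec f z" "holomorphic_at_vec g z" for f g and z :: "complex^'d"
      unfolding P_def
      by (intro holomorphic_at_vec_sum holomorphic_at_vec_mult holomorphic_at_vec_const holomorphic_at_vec_power that)
    show "(\<lambda>s. P (f s) (g s)) \<in> borel_measurable borel"
      if [measurable]: "f \<in> borel_measurable borel" "g \<in> borel_measurable borel" for f g :: "real^'d \<Rightarrow> complex"
      unfolding P_def by measurable
    show "2 * 2 ^ L * B + \<delta> * \<Lambda> \<le> R" using BR(1) \<delta>(2) by linarith
    show "AE x in lborel. v x = W (embed_complex x) + (LINT s|lborel. P (v (x - s)) (cnj (v (x - s))) * k s)"
      using eq by (simp only: W_eq FP)
  qed (use \<Lambda> \<delta>(2) v_meas vR in blast)+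
  then obtain U where U: "\<And>z. z \<in> complex_strip r \<Longrightarrow> holomorphic_at_vec U z" "\<And>z. z \<in> complex_strip r \<Longrightarrow> norm (U z) \<le> 2 * R"
    and Uv: "AE x in lborel. U (embed_complex x) = v x" by blast
  have "AE x in lebesgue. U (embed_complex x) = u x"
    using AE_completion[OF Uv] vu by eventually_elim simp
  moreover have "bounded (U ` complex_strip r)"
    using U(2) by (auto simp: bounded_iff)
  moreover have "holomorphic_on_vec U (complex_strip r)"
    using U(1) by (simp add: holomorphic_on_vec_iff)
  ultimately show ?thesis using r by blast
qed

end
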